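(* Let $k$ be a field of arbitrary characteristic, $R=k[t_1,\dots,t_r]$ the graded polynomial ring with $\deg t_i=1$, and let $\tilde C$ be a free cochain complex over $R$ such that $\dim_k H^*(\tilde C)$ is non-zero and finite. Let $\tilde H=H\otimes_k R$ be the (additive) minimal model of $\tilde C$, where $H=H^*(\tilde C\otimes_R k)$. Then: (a) $\dim_k H=\sum_i\dim_k H^i(\tilde C\otimes_R k)\geq 2r$. (b) $\sum_q \ell_\Lambda(H^q)\ \geq\ \ell(\mathcal{F}_*(\tilde H))\ \geq\ r+1$. (c) If the linear part of the boundary of the minimal model $\tilde H$ vanishes (i.e. $\lambda_i=0$ for all $i$), then $H^q(\tilde C)$ is non-zero for at least $r+1$ degrees $q$.
   Context: A free cochain complex over $R$ is a graded free $R$-module $\tilde C\cong C\otimes_k R$ ($C$ a graded $k$-vector space) with an $R$-linear boundary of total degree $1$ and square zero; $H^q(\tilde C)$ denotes its cohomology in total degree $q$. $k$ is an $R$-module via the augmentation $t_i\mapsto 0$, and $I=(t_1,\dots,t_r)$. Minimal model: the (unique up to isomorphism) free cochain complex $\tilde H=H\otimes_k R$ over $R$ which is $R$-homotopy equivalent to $\tilde C$ and whose boundary $\bar d$ satisfies $\bar d(H\otimes k)\subset H\otimes I$ (vanishing constant part); then $H\cong H^*(\tilde C\otimes_R k)$. For $x\in H$, $\lambda_i(x)\in H$ is the coefficient of $t_i$ in $\bar d(x)$. The maps $\lambda_i$ preserve each $H^q$ and define an action of the exterior algebra $\Lambda=\Lambda_k(\lambda_1,\dots,\lambda_r)$ on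 $H^q$. With $\Lambda^+$ the ideal generated by $\lambda_1,\dots,\lambda_r$, $\ell_\Lambda(H^q)$ is the minimal integer $i\ge0$ with $(\Lambda^+)^iH^q=0$. Filtration: $\mathcal F_0(H)=0$, $\mathcal F_0(\tilde H)=0$, and inductively $\mathcal F_{i+1}(H)=\bar d^{-1}(\mathcal F_i(\tilde H))\cap (H\otimes k)$, $\mathcal F_{i+1}(\tilde H)=\mathcal F_{i+1}(H)\otimes R$ (so $\mathcal F_1(H)=\ker(\bar d|_{H\otimes k})$). The length $\ell(\mathcal F_*(\tilde H))$ is the smallest $i$ with $\mathcal F_i(\tilde H)=\mathcal F_{i+1}(\tilde H)$. *)

theory Defs
  imports Complex_Main "HOL-Library.Poly_Mapping"
begin

section \<open>The polynomial ring and free modules over it\<close>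

text \<open>
  A monomial in $t_0, t_1, \dots$ is its exponent vector, and polynomials over the field \<open>'k\<close>
  are elements of the ring \<open>mono \<Rightarrow>\<^sub>0 'k\<close>.  The ring \<open>R\<close> is the subring \<open>polys r\<close> of the polynomials
  that involve only $t_0, \dots, t_{r-1}$; all values of \<open>r\<close>, including 0, are allowed.
\<close>

type_synonym mono = "nat \<Rightarrow>\<^sub>0 nat"

definition monomials :: "nat \<Rightarrow> mono set" where
  "monomials r = {m. Poly_Mapping.keys m \<subseteq> {..<r}}"

definition mdeg :: "mono \<Rightarrow> nat" where
  "mdeg m = (\<Sum>i\<in>Poly_Mapping.keys m. Poly_Mapping.lookup m i)"

definition polys :: "nat \<Rightarrow> (mono \<Rightarrow>\<^sub>0 'k::field) set" where
  "polys r = {p. Poly_Mapping.keys p \<subseteq> monomials r}"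

text \<open>
  A \<open>k\<close>-vector space is a type \<open>'c\<close> with a scalar multiplication \<open>s\<close>.  For a subspace \<open>V\<close>, the
  module $V \otimes_k R$ is the set of polynomials in $t_0, \dots, t_{r-1}$ with coefficients
  in \<open>V\<close>: the function \<open>f\<close> stands for $\sum_m f(m) \otimes t^m$.
\<close>

definition tens :: "nat \<Rightarrow> 'c::ab_group_add set \<Rightarrow> (mono \<Rightarrow>\<^sub>0 'c) set" where
  "tens r V = {f. Poly_Mapping.keys f \<subseteq> monomials r \<and> (\<forall>m. Poly_Mapping.lookup f m \<in> V)}"

text \<open>The inclusion $x \mapsto x \otimes 1$.\<close>

definition emb :: "'c::ab_group_add \<Rightarrow> (mono \<Rightarrow>\<^sub>0 'c)" where
  "emb x = Poly_Mapping.single 0 x"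

text \<open>The submodule $V \otimes I$, where \<open>I\<close> is the ideal generated by the variables.\<close>

definition tensI :: "nat \<Rightarrow> 'c::ab_group_add set \<Rightarrow> (mono \<Rightarrow>\<^sub>0 'c) set" where
  "tensI r V = {f \<in> tens r V. Poly_Mapping.lookup f 0 = 0}"

definition pact ::
  "('k \<Rightarrow> 'c \<Rightarrow> 'c) \<Rightarrow> (mono \<Rightarrow>\<^sub>0 'k::zero) \<Rightarrow> (mono \<Rightarrow>\<^sub>0 'c::ab_group_add) \<Rightarrow> (mono \<Rightarrow>\<^sub>0 'c)" where
  "pact s p f = (\<Sum>m\<in>Poly_Mapping.keys p. \<Sum>n\<in>Poly_Mapping.keys f.
     Poly_Mapping.single (m + n) (s (Poly_Mapping.lookup p m) (Poly_Mapping.lookup f n)))"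

lemma poly_mapping_eq_sum_single:
  "(\<Sum>m\<in>Poly_Mapping.keys p. Poly_Mapping.single m (Poly_Mapping.lookup p m)) = p"
  by (rule poly_mapping_eqI)
     (simp add: lookup_sum lookup_single when_def in_keys_iff)

text \<open>On \<open>R\<close> itself the action is the multiplication of the polynomial ring.\<close>

lemma pact_times: "pact (*) p q = p * (q :: mono \<Rightarrow>\<^sub>0 'k::field)"
proof -
  have "p * q = (\<Sum>m\<in>Poly_Mapping.keys p. Poly_Mapping.single m (Poly_Mapping.lookup p m)) *
      (\<Sum>n\<in>Poly_Mapping.keys q. Poly_Mapping.single n (Poly_Mapping.lookup q n))"
    by (simp only: poly_mapping_eq_sum_single)
  then show ?thesis
    by (simp add: pact_def sum_product mult_single)
qed

text \<open>The underlying \<open>k\<close>-vector space structure, by restriction along the constants $k \to R$.\<close>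

definition kscale ::
  "('k \<Rightarrow> 'c \<Rightarrow> 'c) \<Rightarrow> 'k::zero \<Rightarrow> (mono \<Rightarrow>\<^sub>0 'c::ab_group_add) \<Rightarrow> (mono \<Rightarrow>\<^sub>0 'c)" where
  "kscale s a f = pact s (Poly_Mapping.single 0 a) f"


section \<open>Graded vector spaces and free cochain complexes\<close>

text \<open>An internal direct sum decomposition of \<open>'c\<close> into subspaces \<open>C q\<close>, \<open>q\<close> an integer.\<close>

definition graded_space ::
  "('k::field \<Rightarrow> 'c::ab_group_add \<Rightarrow> 'c) \<Rightarrow> (int \<Rightarrow> 'c set) \<Rightarrow> bool" where
  "graded_space s C \<longleftrightarrow> vector_space s \<and> (\<forall>q. module.subspace s (C q)) \<and>
     (\<forall>x. \<exists>!f :: int \<Rightarrow>\<^sub>0 'c. (\<forall>q. Poly_Mapping.lookup f q \<in> C q) \<and>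
        x = (\<Sum>q\<in>Poly_Mapping.keys f. Poly_Mapping.lookup f q))"

text \<open>The part of $C \otimes_k R$ of total degree \<open>q\<close>, every variable having degree 1.\<close>

definition tens_deg :: "nat \<Rightarrow> (int \<Rightarrow> 'c::ab_group_add set) \<Rightarrow> int \<Rightarrow> (mono \<Rightarrow>\<^sub>0 'c) set" where
  "tens_deg r C q =
     {f \<in> tens r UNIV. \<forall>m. Poly_Mapping.lookup f m \<in> C (q - int (mdeg m))}"

text \<open>\<open>R\<close>-linear maps $C \otimes_k R \to C' \otimes_k R$ of total degree \<open>n\<close>.  Maps are considered
  only on the carriers \<open>tens r UNIV\<close>; their values elsewhere are irrelevant.\<close>

definition R_hom ::
  "nat \<Rightarrow> ('k::field \<Rightarrow> 'c::ab_group_add \<Rightarrow> 'c) \<Rightarrow> (int \<Rightarrow> 'c set)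
     \<Rightarrow> ('k \<Rightarrow> 'e::ab_group_add \<Rightarrow> 'e) \<Rightarrow> (int \<Rightarrow> 'e set)
     \<Rightarrow> int \<Rightarrow> ((mono \<Rightarrow>\<^sub>0 'c) \<Rightarrow> (mono \<Rightarrow>\<^sub>0 'e)) \<Rightarrow> bool" where
  "R_hom r s C s' C' n \<phi> \<longleftrightarrow>
     (\<forall>f\<in>tens r UNIV. \<phi> f \<in> tens r UNIV) \<and>
     (\<forall>f\<in>tens r UNIV. \<forall>g\<in>tens r UNIV. \<phi> (f + g) = \<phi> f + \<phi> g) \<and>
     (\<forall>p\<in>polys r. \<forall>f\<in>tens r UNIV. \<phi> (pact s p f) = pact s' p (\<phi> f)) \<and>
     (\<forall>q. \<forall>f\<in>tens_deg r C q. \<phi> f \<in> tens_deg r C' (q + n))"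

definition free_complex ::
  "nat \<Rightarrow> ('k::field \<Rightarrow> 'c::ab_group_add \<Rightarrow> 'c) \<Rightarrow> (int \<Rightarrow> 'c set)
     \<Rightarrow> ((mono \<Rightarrow>\<^sub>0 'c) \<Rightarrow> (mono \<Rightarrow>\<^sub>0 'c)) \<Rightarrow> bool" where
  "free_complex r s C d \<longleftrightarrow> graded_space s C \<and> R_hom r s C s C 1 d \<and>
     (\<forall>f\<in>tens r UNIV. d (d f) = 0)"

definition homotopy_equivalent ::
  "nat \<Rightarrow> ('k::field \<Rightarrow> 'c::ab_group_add \<Rightarrow> 'c) \<Rightarrow> (int \<Rightarrow> 'c set)
     \<Rightarrow> ((mono \<Rightarrow>\<^sub>0 'c) \<Rightarrow> (mono \<Rightarrow>\<^sub>0 'c))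
     \<Rightarrow> ('k \<Rightarrow> 'e::ab_group_add \<Rightarrow> 'e) \<Rightarrow> (int \<Rightarrow> 'e set)
     \<Rightarrow> ((mono \<Rightarrow>\<^sub>0 'e) \<Rightarrow> (mono \<Rightarrow>\<^sub>0 'e)) \<Rightarrow> bool" where
  "homotopy_equivalent r s C d s' C' d' \<longleftrightarrow>
     (\<exists>\<phi> \<psi> h h'.
        R_hom r s C s' C' 0 \<phi> \<and> (\<forall>f\<in>tens r UNIV. \<phi> (d f) = d' (\<phi> f)) \<and>
        R_hom r s' C' s C 0 \<psi> \<and> (\<forall>f\<in>tens r UNIV. \<psi> (d' f) = d (\<psi> f)) \<and>
        R_hom r s C s C (-1) h \<and> (\<forall>f\<in>tens r UNIV. \<psi> (\<phi> f) - f = d (h f) + h (d f)) \<and>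
        R_hom r s' C' s' C' (-1) h' \<and> (\<forall>f\<in>tens r UNIV. \<phi> (\<psi> f) - f = d' (h' f) + h' (d' f)))"

text \<open>\<open>(sH, H, dH)\<close> is a minimal model of \<open>(s, C, d)\<close>.\<close>

definition minimal_model ::
  "nat \<Rightarrow> ('k::field \<Rightarrow> 'c::ab_group_add \<Rightarrow> 'c) \<Rightarrow> (int \<Rightarrow> 'c set)
     \<Rightarrow> ((mono \<Rightarrow>\<^sub>0 'c) \<Rightarrow> (mono \<Rightarrow>\<^sub>0 'c))
     \<Rightarrow> ('k \<Rightarrow> 'h::ab_group_add \<Rightarrow> 'h) \<Rightarrow> (int \<Rightarrow> 'h set)
     \<Rightarrow> ((mono \<Rightarrow>\<^sub>0 'h) \<Rightarrow> (mono \<Rightarrow>\<^sub>0 'h)) \<Rightarrow> bool" where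
  "minimal_model r s C d sH H dH \<longleftrightarrow>
     free_complex r sH H dH \<and> homotopy_equivalent r s C d sH H dH \<and>
     (\<forall>x. dH (emb x) \<in> tensI r UNIV)"


section \<open>Cohomology\<close>

text \<open>
  Quotients \<open>Z / B\<close> of subspaces of a vector space are handled through representatives:
  \<open>quot_basis s Z B X\<close> says that the classes of the elements of \<open>X\<close> are pairwise distinct and
  form a basis of \<open>Z / B\<close>.  As for the library's \<open>dim\<close>, an infinite-dimensional quotient
  has \<open>quot_dim\<close> equal to 0.
\<close>

definition quot_basis ::
  "('k::field \<Rightarrow> 'v::ab_group_add \<Rightarrow> 'v) \<Rightarrow> 'v set \<Rightarrow> 'v set \<Rightarrow> 'v set \<Rightarrow> bool" where
  "quot_basis s Z B X \<longleftrightarrow> X \<subseteq> Z \<and>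
     (\<forall>F a. finite F \<and> F \<subseteq> X \<and> (\<Sum>x\<in>F. s (a x) x) \<in> B \<longrightarrow> (\<forall>x\<in>F. a x = 0)) \<and>
     Z \<subseteq> module.span s (X \<union> B)"

definition quot_finite_dim ::
  "('k::field \<Rightarrow> 'v::ab_group_add \<Rightarrow> 'v) \<Rightarrow> 'v set \<Rightarrow> 'v set \<Rightarrow> bool" where
  "quot_finite_dim s Z B \<longleftrightarrow> (\<exists>X. finite X \<and> quot_basis s Z B X)"

definition quot_dim ::
  "('k::field \<Rightarrow> 'v::ab_group_add \<Rightarrow> 'v) \<Rightarrow> 'v set \<Rightarrow> 'v set \<Rightarrow> nat" where
  "quot_dim s Z B = card (SOME X. quot_basis s Z B X)"

definition cocycles :: "('v \<Rightarrow> 'v) \<Rightarrow> 'v set \<Rightarrow> 'v::zero set" where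
  "cocycles d A = {x \<in> A. d x = 0}"

text \<open>$H^q(\tilde C) \neq 0$, where $\tilde C = C \otimes_k R$ and \<open>q\<close> is the total degree.\<close>

definition coh_nonzero ::
  "nat \<Rightarrow> (int \<Rightarrow> 'c::ab_group_add set) \<Rightarrow> ((mono \<Rightarrow>\<^sub>0 'c) \<Rightarrow> (mono \<Rightarrow>\<^sub>0 'c)) \<Rightarrow> int \<Rightarrow> bool" where
  "coh_nonzero r C d q \<longleftrightarrow> \<not> cocycles d (tens_deg r C q) \<subseteq> d ` tens_deg r C (q - 1)"

text \<open>The total cohomology $H^*(\tilde C)$ has finite dimension, respectively its dimension.\<close>

definition total_coh_finite_dim ::
  "nat \<Rightarrow> ('k::field \<Rightarrow> 'c::ab_group_add \<Rightarrow> 'c) \<Rightarrow> ((mono \<Rightarrow>\<^sub>0 'c) \<Rightarrow> (mono \<Rightarrow>\<^sub>0 'c)) \<Rightarrow> bool" where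
  "total_coh_finite_dim r s d \<longleftrightarrow>
     quot_finite_dim (kscale s) (cocycles d (tens r UNIV)) (d ` tens r UNIV)"

definition total_coh_dim ::
  "nat \<Rightarrow> ('k::field \<Rightarrow> 'c::ab_group_add \<Rightarrow> 'c) \<Rightarrow> ((mono \<Rightarrow>\<^sub>0 'c) \<Rightarrow> (mono \<Rightarrow>\<^sub>0 'c)) \<Rightarrow> nat" where
  "total_coh_dim r s d =
     quot_dim (kscale s) (cocycles d (tens r UNIV)) (d ` tens r UNIV)"

text \<open>
  Since $(C \otimes_k R) \otimes_R k = C$ with \<open>k\<close> an \<open>R\<close>-module via $t_i \mapsto 0$, the complex
  $\tilde C \otimes_R k$ is \<open>C\<close> with the constant part of the boundary of \<open>x \<otimes> 1\<close>.
\<close>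

definition d_red :: "((mono \<Rightarrow>\<^sub>0 'c) \<Rightarrow> (mono \<Rightarrow>\<^sub>0 'c)) \<Rightarrow> 'c::ab_group_add \<Rightarrow> 'c" where
  "d_red d x = Poly_Mapping.lookup (d (emb x)) 0"

text \<open>The dimension of $H^q(\tilde C \otimes_R k)$.\<close>

definition red_coh_dim ::
  "('k::field \<Rightarrow> 'c::ab_group_add \<Rightarrow> 'c) \<Rightarrow> (int \<Rightarrow> 'c set)
     \<Rightarrow> ((mono \<Rightarrow>\<^sub>0 'c) \<Rightarrow> (mono \<Rightarrow>\<^sub>0 'c)) \<Rightarrow> int \<Rightarrow> nat" where
  "red_coh_dim s C d q =
     quot_dim s (cocycles (d_red d) (C q)) (d_red d ` C (q - 1))"


section \<open>The action of the exterior algebra and the filtration\<close>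

definition lam :: "((mono \<Rightarrow>\<^sub>0 'h) \<Rightarrow> (mono \<Rightarrow>\<^sub>0 'h)) \<Rightarrow> nat \<Rightarrow> 'h::ab_group_add \<Rightarrow> 'h" where
  "lam dH i x = Poly_Mapping.lookup (dH (emb x)) (Poly_Mapping.single i 1)"

text \<open>
  $(\Lambda^+)^i V$ for a $\Lambda$-submodule \<open>V\<close>: the ideal power $(\Lambda^+)^i$ is spanned by the
  products $\lambda_{j_1} \cdots \lambda_{j_n}$ with $n \ge i$, given here by the list of their indices.
\<close>

definition lam_power ::
  "nat \<Rightarrow> ('k::field \<Rightarrow> 'h::ab_group_add \<Rightarrow> 'h) \<Rightarrow> ((mono \<Rightarrow>\<^sub>0 'h) \<Rightarrow> (mono \<Rightarrow>\<^sub>0 'h))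
     \<Rightarrow> nat \<Rightarrow> 'h set \<Rightarrow> 'h set" where
  "lam_power r sH dH i V =
     module.span sH {foldr (lam dH) js x | js x. set js \<subseteq> {..<r} \<and> i \<le> length js \<and> x \<in> V}"

definition lam_length ::
  "nat \<Rightarrow> ('k::field \<Rightarrow> 'h::ab_group_add \<Rightarrow> 'h) \<Rightarrow> ((mono \<Rightarrow>\<^sub>0 'h) \<Rightarrow> (mono \<Rightarrow>\<^sub>0 'h))
     \<Rightarrow> 'h set \<Rightarrow> nat" where
  "lam_length r sH dH V = (LEAST i. lam_power r sH dH i V = {0})"

text \<open>\<open>filt r dH i\<close> is $\mathcal F_i(H)$, and \<open>tens r (filt r dH i)\<close> is $\mathcal F_i(\tilde H)$.\<close>

primrec filt ::
  "nat \<Rightarrow> ((mono \<Rightarrow>\<^sub>0 'h) \<Rightarrow> (mono \<Rightarrow>\<^sub>0 'h)) \<Rightarrow> nat \<Rightarrow> 'h::ab_group_add set" where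
  "filt r dH 0 = {0}"
| "filt r dH (Suc i) = {x. dH (emb x) \<in> tens r (filt r dH i)}"

definition filt_length ::
  "nat \<Rightarrow> ((mono \<Rightarrow>\<^sub>0 'h) \<Rightarrow> (mono \<Rightarrow>\<^sub>0 'h::ab_group_add)) \<Rightarrow> nat" where
  "filt_length r dH = (LEAST i. tens r (filt r dH i) = tens r (filt r dH (Suc i)))"

end

theory Submission
  imports Defs "Jordan_Normal_Form.Determinant"
begin

text \<open>
Write $\tilde H = H \otimes R$ and $d$ for its boundary.  Everything is proved for $\tilde H$; the
homotopy equivalence is used only to carry the cohomology of $\tilde C$ and of
$\tilde C \otimes_R k$ over to $\tilde H$ (\<open>coh_nonzero_transfer\<close>, \<open>quot_dim_eq_dim\<close>).

Finiteness of $H^*(\tilde H)$ has two consequences.  The cohomology vanishes above some degree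
\<open>P\<close> (\<open>acyclic_above\<close>), and, by the long exact sequences that belong to dividing by the
variables one after the other, $H = \tilde H / (t_0, \dots, t_{r-1}) \tilde H$ is
finite-dimensional (\<open>finite_dimensional_generators\<close>).

For the lower bound on the length of the filtration one compares $\tilde H$ with
$R / (t_0^N, \dots, t_{r-1}^N)$ and with \<open>k\<close>.  Let $x \in H$ be a nonzero cocycle in the lowest degree
and \<open>\<phi>\<close> a functional with $\phi(x) = 1$.  On the one hand, as soon as \<open>N\<close> is so large that all
obstructions lie in degrees above \<open>P\<close>, there are $y_0 = x, y_1, \dots, y_r$ with
$d y_{n+1} \equiv t_n^N y_n$ modulo $(t_0^N, \dots, t_{n-1}^N)$.  On the other hand minimality makes
\<open>\<phi>\<close> a cochain map $\beta_0 \colon \tilde H \to k$, and the Bockstein operators of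
$k[t_0, \dots, t_n] \to k[t_0, \dots, t_{n-1}]$ give cochain maps
$\beta_{n+1} = t_n^{-1} \beta_n d$ with values in $k[t_0, \dots, t_n]$.  Comparing coefficients,
$\beta_n(y_n)$ contains the monomial $(t_0 \cdots t_{n-1})^{N-1}$ with coefficient 1
(\<open>ex_bockstein_chain\<close>).  Since $\beta_n$ kills the \<open>n\<close>-th step of the filtration
(\<open>bockstein_filt\<close>), the \<open>r\<close>-th step is not everything (\<open>filt_not_exhausted\<close>).  This is the
comparison of two Koszul complexes through $\tilde H$, reduced to the one component of the comparison
maps that matters.

The upper bound for the length holds because $d$ maps $H^q$ to
$H^q \otimes (t_0, \dots, t_{r-1}) \oplus H^{<q} \otimes R$, so that each degree costs no more than its
$\Lambda$-length (\<open>H_subset_filt\<close>).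

If all $\lambda_i$ vanish, let \<open>p + 1\<close> be the first degree above the bottom degree of \<open>H\<close> in which
$H^*(\tilde H)$ vanishes.  Then $H^{\le p} \otimes R$ is a subcomplex without cohomology above \<open>p\<close>
(\<open>acyclic_above_generators\<close>), the preceding argument applies to it, and each of its degrees costs
only one step, so it occupies more than \<open>r\<close> degrees, all of which lie in the support of the
cohomology (\<open>cohomology_degrees_ge\<close>).

For the bound $\dim H \ge 2r$ write $\phi d = \sum_j t_j \beta^j$ and choose $y_i$ with
$d y_i = t_i^N x$.  The matrix $G = (\beta^j(y_i))$ satisfies $\sum_j t_j G_{ij} = t_i^N$, and this
forces $\det G \neq 0$ (\<open>coef_det_power_system\<close>).  Hence $x, y_0, \dots, y_{r-1}$ are linearly
independent over \<open>R\<close>, and so are the \<open>r\<close> cocycles \<open>x\<close> and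
$z_i = t_0^N y_i - t_i^N y_0$ for $1 \le i < r$.  Up to a factor $t_0^N$ on \<open>x\<close> they are boundaries,
of $y_0$ and of elements $w_i$; together, these are $2r$ independent elements of a free
module of rank $\dim H$ (\<open>dim_ge\<close>).
\<close>

abbreviation coef :: "('a \<Rightarrow>\<^sub>0 'b::zero) \<Rightarrow> 'a \<Rightarrow> 'b" where
  "coef \<equiv> Poly_Mapping.lookup"

abbreviation tpow :: "nat \<Rightarrow> nat \<Rightarrow> mono" where
  "tpow i n \<equiv> Poly_Mapping.single i n"

section \<open>Polynomials with coefficients in a vector space\<close>

text \<open>
Multiplication by the monomial $t^m$; unlike \<open>pact\<close> it does not refer to a scalar multiplication.
\<close>

definition shift :: "mono \<Rightarrow> (mono \<Rightarrow>\<^sub>0 'a::ab_group_add) \<Rightarrow> (mono \<Rightarrow>\<^sub>0 'a)" where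
  "shift m f = (\<Sum>n\<in>Poly_Mapping.keys f. Poly_Mapping.single (m + n) (coef f n))"

lemma coef_shift_add [simp]: "coef (shift m f) (m + n) = coef f n"
proof -
  have "coef (shift m f) (m + n)
      = (\<Sum>n'\<in>Poly_Mapping.keys f. if n' = n then coef f n' else 0)"
    unfolding shift_def lookup_sum by (rule sum.cong) (auto simp: lookup_single)
  then show ?thesis by (simp add: in_keys_iff)
qed

lemma coef_shift_other: "(\<And>n. l \<noteq> m + n) \<Longrightarrow> coef (shift m f) l = 0"
  unfolding shift_def lookup_sum
  by (rule sum.neutral) (metis lookup_single_not_eq)

lemma shift_eqI:
  assumes "\<And>n. coef f (m + n) = coef g n" and "\<And>l. (\<And>n. l \<noteq> m + n) \<Longrightarrow> coef f l = 0"
  shows "f = shift m g"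
proof (rule poly_mapping_eqI)
  fix l show "coef f l = coef (shift m g) l"
    by (cases "\<exists>n. l = m + n") (auto simp: assms coef_shift_other)
qed

lemma shift_add: "shift m (f + g) = shift m f + shift m g"
  by (rule shift_eqI [symmetric]) (auto simp: lookup_add coef_shift_other)

lemma additive_shift: "additive (shift m)"
  by standard (rule shift_add)

lemmas shift_zero [simp] = additive.zero [OF additive_shift]
  and shift_diff = additive.diff [OF additive_shift]
  and shift_sum = additive.sum [OF additive_shift]

lemma shift_shift: "shift m (shift n f) = shift (m + n) f"
proof (rule shift_eqI)
  fix l show "coef (shift m (shift n f)) (m + n + l) = coef f l"
    by (simp add: add.assoc)
next
  fix l assume l: "\<And>k. l \<noteq> m + n + k"
  show "coef (shift m (shift n f)) l = 0"
  proof (cases "\<exists>k. l = m + k")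
    case True
    then obtain k where "l = m + k" by blast
    with l show ?thesis by (auto simp: add.assoc intro: coef_shift_other)
  qed (auto intro: coef_shift_other)
qed

lemma shift_0 [simp]: "shift 0 f = f"
  by (rule shift_eqI [symmetric]) auto

lemma keys_shift: "Poly_Mapping.keys (shift m f) = (+) m ` Poly_Mapping.keys f"
proof (intro subset_antisym subsetI)
  fix l assume "l \<in> Poly_Mapping.keys (shift m f)"
  then show "l \<in> (+) m ` Poly_Mapping.keys f"
    by (metis coef_shift_add coef_shift_other imageI in_keys_iff)
qed (auto simp: in_keys_iff)

lemma shift_emb: "shift m (emb x) = Poly_Mapping.single m x"
  by (cases "x = 0") (auto simp: shift_def emb_def)

lemma sum_shift_emb:
  "(\<Sum>m\<in>Poly_Mapping.keys f. shift m (emb (coef f m))) = (f :: mono \<Rightarrow>\<^sub>0 'a::ab_group_add)"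
  unfolding shift_emb by (rule poly_mapping_eqI)
     (simp add: lookup_sum lookup_single when_def in_keys_iff)

lemma shift_times: "shift m (f :: mono \<Rightarrow>\<^sub>0 'k::field) = Poly_Mapping.single m 1 * f"
proof -
  have "Poly_Mapping.single m 1 * f = Poly_Mapping.single m 1 *
     (\<Sum>n\<in>Poly_Mapping.keys f. Poly_Mapping.single n (coef f n))"
    by (simp only: poly_mapping_eq_sum_single)
  then show ?thesis by (simp add: shift_def sum_distrib_left mult_single)
qed

lemma emb_add: "emb (x + y) = emb x + emb y"
  by (simp add: emb_def single_add)

lemma emb_zero [simp]: "emb 0 = 0"
  by (simp add: emb_def)

lemma coef_emb: "coef (emb x) m = (if m = 0 then x else 0)"
  by (auto simp: emb_def lookup_single)


text \<open>
The \<open>R\<close>-linear map that takes the value $\beta(x)$ at $x \otimes 1$.  It is defined for polynomials in all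
of the variables $t_0, t_1, \dots$, so that its laws need no carrier conditions.
\<close>

definition lift ::
  "('a::ab_group_add \<Rightarrow> (mono \<Rightarrow>\<^sub>0 'b::ab_group_add)) \<Rightarrow> (mono \<Rightarrow>\<^sub>0 'a) \<Rightarrow> (mono \<Rightarrow>\<^sub>0 'b)" where
  "lift \<beta> f = (\<Sum>m\<in>Poly_Mapping.keys f. shift m (\<beta> (coef f m)))"

lemma coef_lift: "coef (lift \<beta> f) l = (\<Sum>m\<in>Poly_Mapping.keys f. coef (shift m (\<beta> (coef f m))) l)"
  by (simp add: lift_def lookup_sum)

lemma lift_superset:
  assumes "additive \<beta>" "finite A" "Poly_Mapping.keys f \<subseteq> A"
  shows "lift \<beta> f = (\<Sum>m\<in>A. shift m (\<beta> (coef f m)))"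
  unfolding lift_def
  by (rule sum.mono_neutral_left) (use assms in \<open>auto simp: in_keys_iff additive.zero\<close>)

lemma lift_add:
  assumes "additive \<beta>"
  shows "lift \<beta> (f + g) = lift \<beta> f + lift \<beta> g"
proof -
  let ?A = "Poly_Mapping.keys f \<union> Poly_Mapping.keys g"
  have "lift \<beta> (f + g) = (\<Sum>m\<in>?A. shift m (\<beta> (coef (f + g) m)))"
    by (rule lift_superset [OF assms]) (simp_all add: keys_add)
  also have "\<dots> = lift \<beta> f + lift \<beta> g"
    by (simp add: lift_superset [OF assms, of ?A] lookup_add additive.add [OF assms] shift_add
      sum.distrib)
  finally show ?thesis .
qed

lemma additive_lift: "additive \<beta> \<Longrightarrow> additive (lift \<beta>)"
  by (simp add: additive_def lift_add)

lemmas lift_zero = additive.zero [OF additive_lift]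
  and lift_diff = additive.diff [OF additive_lift]
  and lift_sum = additive.sum [OF additive_lift]

lemma lift_emb: "additive \<beta> \<Longrightarrow> lift \<beta> (emb x) = \<beta> x"
  by (cases "x = 0") (auto simp: lift_def emb_def additive.zero)

lemma lift_shift: "lift \<beta> (shift m f) = shift m (lift \<beta> f)"
proof -
  have "lift \<beta> (shift m f) = (\<Sum>n\<in>Poly_Mapping.keys f. shift (m + n) (\<beta> (coef f n)))"
    unfolding lift_def keys_shift by (subst sum.reindex) (auto simp: inj_on_def)
  then show ?thesis by (simp add: lift_def shift_sum shift_shift)
qed

lemma equivariant_eq_lift:
  assumes "additive T" and "\<And>m f. T (shift m f) = shift m (T f)"
  shows "T f = lift (\<lambda>x. T (emb x)) f"
proof -
  have "T f = T (\<Sum>m\<in>Poly_Mapping.keys f. shift m (emb (coef f m)))"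
    by (simp only: sum_shift_emb)
  then show ?thesis by (simp add: lift_def additive.sum [OF assms(1)] assms(2))
qed

lemma lift_lift:
  assumes "additive \<alpha>" "additive \<beta>"
  shows "lift \<alpha> (lift \<beta> f) = lift (\<lambda>x. lift \<alpha> (\<beta> x)) f"
proof -
  have "additive (\<lambda>f. lift \<alpha> (lift \<beta> f))"
    using assms by (simp add: additive_def lift_add)
  then have "lift \<alpha> (lift \<beta> f) = lift (\<lambda>x. lift \<alpha> (lift \<beta> (emb x))) f"
    by (rule equivariant_eq_lift [where T = "\<lambda>f. lift \<alpha> (lift \<beta> f)"]) (simp add: lift_shift)
  then show ?thesis by (simp add: lift_emb assms)
qed

lemma vector_space_simps:
  assumes "vector_space s"
  shows "s a 0 = 0" "s 0 x = 0" "s 1 x = x"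
proof -
  interpret vector_space s by fact
  show "s a 0 = 0" "s 0 x = 0" "s 1 x = x" by simp_all
qed

lemma coef_kscale:
  assumes "vector_space s"
  shows "coef (kscale s a f) m = s a (coef f m)"
proof -
  interpret vector_space s by fact
  have "kscale s a f = (\<Sum>n\<in>Poly_Mapping.keys f. Poly_Mapping.single n (s a (coef f n)))"
    unfolding kscale_def pact_def by (cases "a = 0") auto
  then show ?thesis
    by (auto simp: lookup_sum lookup_single when_def in_keys_iff)
qed

lemma vector_space_kscale: "vector_space s \<Longrightarrow> vector_space (kscale s)"
  by (simp add: vector_space_def poly_mapping_eq_iff fun_eq_iff coef_kscale lookup_add)

lemma vector_space_times: "vector_space ((*) :: 'k::field \<Rightarrow> 'k \<Rightarrow> 'k)"
  by (simp add: vector_space_def algebra_simps)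

lemma shift_kscale: "vector_space s \<Longrightarrow> shift m (kscale s a f) = kscale s a (shift m f)"
  by (rule shift_eqI [symmetric]) (auto simp: coef_kscale coef_shift_other vector_space_simps)

lemma pact_eq_sum:
  assumes "vector_space s"
  shows "pact s p f = (\<Sum>m\<in>Poly_Mapping.keys p. shift m (kscale s (coef p m) f))"
proof (rule poly_mapping_eqI)
  interpret vector_space s by fact
  fix l
  have "(\<Sum>n\<in>Poly_Mapping.keys f. Poly_Mapping.single (m + n) (s (coef p m) (coef f n))) =
      shift m (kscale s (coef p m) f)" for m
  proof -
    have "shift m (kscale s (coef p m) f) = shift m (\<Sum>n\<in>Poly_Mapping.keys (kscale s (coef p m) f).
        Poly_Mapping.single n (s (coef p m) (coef f n)))"
      by (subst poly_mapping_eq_sum_single [symmetric]) (simp add: coef_kscale assms)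
    also have "\<dots> = (\<Sum>n\<in>Poly_Mapping.keys (kscale s (coef p m) f).
        Poly_Mapping.single (m + n) (s (coef p m) (coef f n)))"
      by (simp add: shift_sum shift_emb [symmetric] shift_shift)
    also have "\<dots> = (\<Sum>n\<in>Poly_Mapping.keys f.
        Poly_Mapping.single (m + n) (s (coef p m) (coef f n)))"
      by (rule sum.mono_neutral_left) (auto simp: in_keys_iff coef_kscale assms)
    finally show ?thesis ..
  qed
  then show "coef (pact s p f) l
      = coef (\<Sum>m\<in>Poly_Mapping.keys p. shift m (kscale s (coef p m) f)) l"
    by (simp add: pact_def)
qed

lemma pact_single: "vector_space s \<Longrightarrow> pact s (Poly_Mapping.single m 1) f = shift m f"
  by (subst pact_eq_sum) (auto intro!: shift_eqI simp: coef_kscale coef_shift_other vector_space_simps)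

lemma equivariant_pact:
  assumes "vector_space s" "vector_space s'" "additive T"
    and "\<And>m f. T (shift m f) = shift m (T f)" and "\<And>a f. T (kscale s a f) = kscale s' a (T f)"
  shows "T (pact s p f) = pact s' p (T f)"
  by (simp add: pact_eq_sum assms additive.sum [OF assms(3)])

lemma lift_kscale:
  assumes "vector_space s" "vector_space s'" "additive \<beta>"
    and "\<And>a x. \<beta> (s a x) = kscale s' a (\<beta> x)"
  shows "lift \<beta> (kscale s a f) = kscale s' a (lift \<beta> f)"
proof -
  interpret K: vector_space "kscale s'" by (rule vector_space_kscale [OF assms(2)])
  have "lift \<beta> (kscale s a f) = (\<Sum>m\<in>Poly_Mapping.keys f. shift m (\<beta> (coef (kscale s a f) m)))"
    by (rule lift_superset) (auto simp: assms in_keys_iff coef_kscale vector_space_simps)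
  then show ?thesis
    by (simp add: lift_def coef_kscale assms shift_kscale K.scale_sum_right)
qed

lemma lift_pact:
  assumes "vector_space s" "vector_space s'" "additive \<beta>"
    and "\<And>a x. \<beta> (s a x) = kscale s' a (\<beta> x)"
  shows "lift \<beta> (pact s p f) = pact s' p (lift \<beta> f)"
  using assms by (intro equivariant_pact) (auto simp: additive_lift lift_shift lift_kscale)


section \<open>Monomials\<close>

lemma mdeg_superset: "finite A \<Longrightarrow> Poly_Mapping.keys m \<subseteq> A \<Longrightarrow> mdeg m = (\<Sum>i\<in>A. coef m i)"
  unfolding mdeg_def by (rule sum.mono_neutral_left) (auto simp: in_keys_iff)

lemma mdeg_add: "mdeg (m + n) = mdeg m + mdeg n"
proof -
  let ?A = "Poly_Mapping.keys m \<union> Poly_Mapping.keys n"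
  have "mdeg (m + n) = (\<Sum>i\<in>?A. coef (m + n) i)"
    by (rule mdeg_superset) (simp_all add: keys_add)
  then show ?thesis by (simp add: lookup_add sum.distrib mdeg_superset [of ?A])
qed

lemma mdeg_tpow [simp]: "mdeg (tpow i n) = n"
  by (cases "n = 0") (auto simp: mdeg_def)

lemma mdeg_eq_0_iff [simp]: "mdeg m = 0 \<longleftrightarrow> m = 0"
  by (auto simp: mdeg_def in_keys_iff intro!: poly_mapping_eqI)

lemma mdeg_zero [simp]: "mdeg 0 = 0"
  by simp

lemma exponent_ge_imp_factor: "coef m i \<ge> n \<Longrightarrow> \<exists>m'. m = m' + tpow i n"
  by (intro exI [of _ "m - tpow i n"] poly_mapping_eqI)
     (auto simp: lookup_add lookup_minus lookup_single when_def)

lemma mdeg_eq_1: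
  assumes "mdeg m = 1"
  obtains i where "m = tpow i 1"
proof -
  from assms have "m \<noteq> 0" using mdeg_eq_0_iff [of m] by simp
  then obtain i where "coef m i \<noteq> 0" by (metis lookup_zero poly_mapping_eqI)
  then obtain m' where "m = m' + tpow i 1" using exponent_ge_imp_factor [of 1 m i] by auto
  with assms have "m = tpow i 1" by (simp add: mdeg_add)
  then show ?thesis by (rule that)
qed

lemma in_monomials_iff: "m \<in> monomials r \<longleftrightarrow> (\<forall>i\<ge>r. coef m i = 0)"
  unfolding monomials_def by (auto simp: subset_iff in_keys_iff) (metis leI not_gr_zero)

lemma monomials_add_iff: "m + n \<in> monomials r \<longleftrightarrow> m \<in> monomials r \<and> n \<in> monomials r"
  by (auto simp: in_monomials_iff lookup_add)

lemma zero_in_monomials [simp]: "0 \<in> monomials r"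
  by (simp add: in_monomials_iff)

lemma tpow_in_monomials: "i < r \<Longrightarrow> tpow i n \<in> monomials r"
  by (auto simp: in_monomials_iff lookup_single)

lemma coef_shift_0: "coef (shift m f) 0 = (if m = 0 then coef f 0 else 0)"
proof (cases "m = 0")
  case False
  have "0 \<noteq> m + n" for n
    using False by (metis add_eq_0_iff_both_eq_0 mdeg_add mdeg_eq_0_iff)
  then have "coef (shift m f) 0 = 0" by (rule coef_shift_other)
  with False show ?thesis by simp
qed simp

lemma coef_lift_0:
  assumes \<beta>: "additive \<beta>"
  shows "coef (lift \<beta> f) 0 = coef (\<beta> (coef f 0)) 0"
  by (auto simp: coef_lift coef_shift_0 in_keys_iff additive.zero [OF \<beta>])

lemma tens_UNIV_iff: "f \<in> tens r UNIV \<longleftrightarrow> Poly_Mapping.keys f \<subseteq> monomials r"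
  by (simp add: tens_def)

lemma zero_in_tens: "0 \<in> tens r UNIV"
  by (simp add: tens_UNIV_iff)

lemma tens_add: "f \<in> tens r UNIV \<Longrightarrow> g \<in> tens r UNIV \<Longrightarrow> f + g \<in> tens r UNIV"
  using keys_add [of f g] by (auto simp: tens_UNIV_iff)

lemma tens_minus: "f \<in> tens r UNIV \<Longrightarrow> - f \<in> tens r UNIV"
  by (simp add: tens_UNIV_iff subset_iff in_keys_iff)

lemma tens_kscale: "vector_space s \<Longrightarrow> f \<in> tens r UNIV \<Longrightarrow> kscale s a f \<in> tens r UNIV"
  unfolding tens_UNIV_iff subset_iff in_keys_iff by (metis coef_kscale vector_space_simps(1))

lemma tens_shift: "m \<in> monomials r \<Longrightarrow> f \<in> tens r UNIV \<Longrightarrow> shift m f \<in> tens r UNIV"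
  by (auto simp: tens_UNIV_iff keys_shift monomials_add_iff)

lemma emb_in_tens: "emb x \<in> tens r UNIV"
  by (auto simp: tens_UNIV_iff in_keys_iff coef_emb split: if_splits)

section \<open>Minimal complexes and graded subcomplexes\<close>

text \<open>
A free cochain complex whose boundary has vanishing constant part, given by the values
$D(x)$ of the boundary on the generators.  The boundary itself is \<open>lift D\<close>, on polynomials in all
variables; on \<open>tens r UNIV\<close> it is the boundary of the complex.
\<close>

locale minimal_complex = vector_space s
  for s :: "'k::field \<Rightarrow> 'h::ab_group_add \<Rightarrow> 'h" +
  fixes r :: nat and H :: "int \<Rightarrow> 'h set" and D :: "'h \<Rightarrow> (mono \<Rightarrow>\<^sub>0 'h)"
  assumes graded: "graded_space s H"
    and D_additive: "additive D"
    and D_scale: "D (s a x) = kscale s a (D x)"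
    and D_monomials: "Poly_Mapping.keys (D x) \<subseteq> monomials r"
    and D_deg: "x \<in> H q \<Longrightarrow> coef (D x) m \<in> H (q + 1 - int (mdeg m))"
    and D_minimal: "coef (D x) 0 = 0"
    and D_square: "lift D (D x) = 0"
begin

abbreviation d :: "(mono \<Rightarrow>\<^sub>0 'h) \<Rightarrow> (mono \<Rightarrow>\<^sub>0 'h)" where
  "d \<equiv> lift D"

lemmas d_add = lift_add [OF D_additive]
  and d_diff = lift_diff [OF D_additive]
  and d_zero [simp] = lift_zero [OF D_additive]

lemma d_emb: "d (emb x) = D x"
  by (simp add: lift_emb D_additive)

lemma d_d [simp]: "d (d f) = 0"
  by (simp add: lift_lift D_additive D_square) (simp add: lift_def)

lemma d_kscale: "d (kscale s a f) = kscale s a (d f)"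
  by (rule lift_kscale) (auto simp: D_additive D_scale vector_space_axioms)

lemma subspace_H: "subspace (H q)"
  using graded by (simp add: graded_space_def)

text \<open>
The condition on $D$ says that $\bigoplus_q V^q \otimes R$ is closed under the boundary.  Apart
from $V = H$, the case of interest is $V = H^{\le p}$.
\<close>

definition subcomplex :: "(int \<Rightarrow> 'h set) \<Rightarrow> bool" where
  "subcomplex V \<longleftrightarrow> (\<forall>q. subspace (V q)) \<and>
     (\<forall>q x m. x \<in> V q \<longrightarrow> coef (D x) m \<in> V (q + 1 - int (mdeg m)))"

lemma subcomplex_H: "subcomplex H"
  by (simp add: subcomplex_def subspace_H D_deg)

lemma subcomplex_subspace: "subcomplex V \<Longrightarrow> subspace (V q)"
  by (simp add: subcomplex_def)

lemma tens_deg_iff: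
  "f \<in> tens_deg r V q \<longleftrightarrow>
     Poly_Mapping.keys f \<subseteq> monomials r \<and> (\<forall>m. coef f m \<in> V (q - int (mdeg m)))"
  by (auto simp: tens_deg_def tens_def)

lemma tens_deg_zero: "subcomplex V \<Longrightarrow> 0 \<in> tens_deg r V q"
  by (simp add: tens_deg_iff subspace_0 subcomplex_subspace)

lemma tens_deg_diff:
  assumes "subcomplex V" "f \<in> tens_deg r V q" "g \<in> tens_deg r V q"
  shows "f - g \<in> tens_deg r V q"
proof -
  have "Poly_Mapping.keys (f - g) \<subseteq> monomials r"
    using assms(2,3) keys_diff [of f g] by (auto simp: tens_deg_iff)
  then show ?thesis
    using assms by (auto simp: tens_deg_iff lookup_minus intro!: subspace_diff subcomplex_subspace)
qed

lemma tens_deg_add: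
  assumes "subcomplex V" "f \<in> tens_deg r V q" "g \<in> tens_deg r V q"
  shows "f + g \<in> tens_deg r V q"
  using tens_deg_diff [OF assms(1,2) tens_deg_diff [OF assms(1) tens_deg_zero [OF assms(1)] assms(3)]]
  by simp

lemma tens_deg_shift:
  assumes V: "subcomplex V" and "m \<in> monomials r" "f \<in> tens_deg r V q"
  shows "shift m f \<in> tens_deg r V (q + int (mdeg m))"
  unfolding tens_deg_iff
proof
  show "Poly_Mapping.keys (shift m f) \<subseteq> monomials r"
    using assms by (auto simp: tens_deg_iff keys_shift monomials_add_iff)
  show "\<forall>l. coef (shift m f) l \<in> V (q + int (mdeg m) - int (mdeg l))"
  proof
    fix l
    show "coef (shift m f) l \<in> V (q + int (mdeg m) - int (mdeg l))"
    proof (cases "\<exists>n. l = m + n")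
      case True
      then show ?thesis using assms(3) by (auto simp: tens_deg_iff mdeg_add)
    next
      case False
      then show ?thesis by (simp add: coef_shift_other subspace_0 subcomplex_subspace V)
    qed
  qed
qed

lemma emb_tens_deg: "subcomplex V \<Longrightarrow> x \<in> V q \<Longrightarrow> emb x \<in> tens_deg r V q"
  by (auto simp: tens_deg_iff coef_emb subspace_0 subcomplex_subspace in_keys_iff split: if_splits)

lemma tens_deg_d:
  assumes V: "subcomplex V" and f: "f \<in> tens_deg r V q"
  shows "d f \<in> tens_deg r V (q + 1)"
  unfolding tens_deg_iff
proof
  have "Poly_Mapping.keys (shift m (D (coef f m))) \<subseteq> monomials r"
    if "m \<in> Poly_Mapping.keys f" for m
    using f that D_monomials by (force simp: keys_shift monomials_add_iff tens_deg_iff)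
  then show "Poly_Mapping.keys (d f) \<subseteq> monomials r"
    unfolding lift_def using keys_sum by fast
  show "\<forall>l. coef (d f) l \<in> V (q + 1 - int (mdeg l))"
  proof
    fix l
    have "coef (shift m (D (coef f m))) l \<in> V (q + 1 - int (mdeg l))" for m
    proof (cases "\<exists>n. l = m + n")
      case True
      then obtain n where l: "l = m + n" by blast
      have "coef f m \<in> V (q - int (mdeg m))" using f by (simp add: tens_deg_iff)
      then have "coef (D (coef f m)) n \<in> V (q - int (mdeg m) + 1 - int (mdeg n))"
        using V by (simp add: subcomplex_def)
      then show ?thesis by (simp add: l mdeg_add algebra_simps)
    qed (simp add: coef_shift_other subspace_0 subcomplex_subspace V)
    then show "coef (d f) l \<in> V (q + 1 - int (mdeg l))"
      unfolding coef_lift by (intro subspace_sum subcomplex_subspace V)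
  qed
qed

end


section \<open>The ideals generated by powers of the variables\<close>

text \<open>
The submodule $(t_0^N, \dots, t_{n-1}^N) \tilde H$.  Being generated by monomials, it is described by the
vanishing of coefficients, and membership can be tested one coefficient at a time.
\<close>

definition pow_ideal :: "nat \<Rightarrow> nat \<Rightarrow> (mono \<Rightarrow>\<^sub>0 'a::ab_group_add) set" where
  "pow_ideal N n = {f. \<forall>m. (\<forall>i<n. coef m i < N) \<longrightarrow> coef f m = 0}"

lemma pow_ideal_0: "pow_ideal N 0 = {0}"
  by (auto simp: pow_ideal_def intro: poly_mapping_eqI)

lemma zero_in_pow_ideal [simp]: "0 \<in> pow_ideal N n"
  by (simp add: pow_ideal_def)

lemma pow_ideal_add: "f \<in> pow_ideal N n \<Longrightarrow> g \<in> pow_ideal N n \<Longrightarrow> f + g \<in> pow_ideal N n"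
  by (simp add: pow_ideal_def lookup_add)

lemma pow_ideal_diff: "f \<in> pow_ideal N n \<Longrightarrow> g \<in> pow_ideal N n \<Longrightarrow> f - g \<in> pow_ideal N n"
  by (simp add: pow_ideal_def lookup_minus)

lemma pow_ideal_mono: "f \<in> pow_ideal N n \<Longrightarrow> n \<le> n' \<Longrightarrow> f \<in> pow_ideal N n'"
  by (simp add: pow_ideal_def)

lemma pow_ideal_shift:
  assumes "f \<in> pow_ideal N n" shows "shift m f \<in> pow_ideal N n"
  unfolding pow_ideal_def mem_Collect_eq
proof (intro allI impI)
  fix l assume l: "\<forall>i<n. coef l i < N"
  show "coef (shift m f) l = 0"
  proof (cases "\<exists>k. l = m + k")
    case True
    then obtain k where k: "l = m + k" by blast
    then have "\<forall>i<n. coef k i < N" using l by (auto simp: lookup_add)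
    then show ?thesis using assms by (simp add: k pow_ideal_def)
  qed (auto intro: coef_shift_other)
qed

text \<open>
An \<open>R\<close>-linear map preserves the submodules: a monomial that is divisible by none of the
$t_i^N$ has no divisor that is divisible by one of them.
\<close>

lemma pow_ideal_lift:
  assumes "f \<in> pow_ideal N n" shows "lift \<beta> f \<in> pow_ideal N n"
  unfolding pow_ideal_def mem_Collect_eq
proof (intro allI impI)
  fix l assume l: "\<forall>i<n. coef l i < N"
  have "coef (shift m (\<beta> (coef f m))) l = 0" if m: "m \<in> Poly_Mapping.keys f" for m
  proof (rule coef_shift_other)
    fix k show "l \<noteq> m + k"
    proof
      assume "l = m + k"
      then have "\<forall>i<n. coef m i < N" using l by (auto simp: lookup_add)
      then show False using assms m by (simp add: pow_ideal_def in_keys_iff)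
    qed
  qed
  then show "coef (lift \<beta> f) l = 0" by (simp add: coef_lift)
qed

lemma shift_tpow_in_pow_ideal: "shift (tpow n N) f \<in> pow_ideal N (Suc n)"
  unfolding pow_ideal_def mem_Collect_eq
proof (intro allI impI)
  fix l assume l: "\<forall>i<Suc n. coef l i < N"
  show "coef (shift (tpow n N) f) l = 0"
    by (rule coef_shift_other) (use l in \<open>auto simp: lookup_add dest!: spec [of _ n]\<close>)
qed

text \<open>
The powers of the variables form a regular sequence.
\<close>

lemma shift_tpow_in_pow_ideal_iff:
  "shift (tpow n N) f \<in> pow_ideal N n \<longleftrightarrow> f \<in> pow_ideal N n"
proof
  assume *: "shift (tpow n N) f \<in> pow_ideal N n"
  show "f \<in> pow_ideal N n"
    unfolding pow_ideal_def mem_Collect_eq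
  proof (intro allI impI)
    fix m assume "\<forall>i<n. coef m i < N"
    then have "\<forall>i<n. coef (tpow n N + m) i < N" by (simp add: lookup_add lookup_single)
    then show "coef f m = 0" using * coef_shift_add unfolding pow_ideal_def by fastforce
  qed
qed (rule pow_ideal_shift)

text \<open>
All monomials divisible by $t_n^N$ can be put into \<open>y\<close>.  This choice is natural enough that \<open>y\<close>
inherits every condition on the coefficients of \<open>f\<close>.
\<close>

lemma pow_ideal_Suc_decomp:
  assumes "f \<in> pow_ideal N (Suc n)"
  obtains y where "f - shift (tpow n N) y \<in> pow_ideal N n"
    and "\<And>m. coef y m = coef f (tpow n N + m)"
proof -
  define y where "y = Poly_Mapping.map_key (\<lambda>m. tpow n N + m) f"
  have y: "coef y m = coef f (tpow n N + m)" for m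
    by (simp add: y_def map_key.rep_eq inj_on_def)
  have "f - shift (tpow n N) y \<in> pow_ideal N n"
    unfolding pow_ideal_def mem_Collect_eq
  proof (intro allI impI)
    fix l assume l: "\<forall>i<n. coef l i < N"
    show "coef (f - shift (tpow n N) y) l = 0"
    proof (cases "\<exists>k. l = tpow n N + k")
      case True
      then show ?thesis by (auto simp: lookup_minus y)
    next
      case False
      have "\<not> N \<le> coef l n"
        using exponent_ge_imp_factor [of N l n] False by (auto simp: add.commute)
      with l have "\<forall>i<Suc n. coef l i < N" by (auto simp: less_Suc_eq)
      then have "coef f l = 0" using assms by (simp add: pow_ideal_def)
      then show ?thesis using False by (simp add: lookup_minus coef_shift_other)
    qed
  qed
  with y show ?thesis by (intro that)
qed


section \<open>Vanishing of cohomology modulo powers of the variables\<close>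

context minimal_complex begin

text \<open>
$H^q(M / (t_0^N, \dots, t_{n-1}^N) M) = 0$ for $M = \bigoplus_p V^p \otimes R$, spelled out with
representatives in \<open>M\<close>.
\<close>

definition acyclic_mod :: "(int \<Rightarrow> 'h set) \<Rightarrow> nat \<Rightarrow> nat \<Rightarrow> int \<Rightarrow> bool" where
  "acyclic_mod V N n q \<longleftrightarrow> (\<forall>f \<in> tens_deg r V q. d f \<in> pow_ideal N n \<longrightarrow>
     (\<exists>w \<in> tens_deg r V (q - 1). f - d w \<in> pow_ideal N n))"

lemma tens_deg_decomp:
  assumes V: "subcomplex V" and n: "n < r"
    and f: "f \<in> tens_deg r V q" "f \<in> pow_ideal N (Suc n)"
  obtains y where "y \<in> tens_deg r V (q - int N)" "f - shift (tpow n N) y \<in> pow_ideal N n"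
proof -
  obtain y where y: "f - shift (tpow n N) y \<in> pow_ideal N n"
    "\<And>m. coef y m = coef f (tpow n N + m)"
    using pow_ideal_Suc_decomp [OF f(2)] by blast
  have "y \<in> tens_deg r V (q - int N)"
    unfolding tens_deg_iff
  proof (intro conjI allI subsetI)
    fix m
    have "coef f (tpow n N + m) \<in> V (q - int (mdeg (tpow n N + m)))"
      using f by (simp add: tens_deg_iff)
    then show "coef y m \<in> V (q - int N - int (mdeg m))"
      by (simp add: y mdeg_add algebra_simps)
  next
    fix m assume "m \<in> Poly_Mapping.keys y"
    then have "tpow n N + m \<in> monomials r" using f by (auto simp: y in_keys_iff tens_deg_iff)
    then show "m \<in> monomials r" by (simp add: monomials_add_iff)
  qed
  with y show ?thesis by (intro that)
qed

text \<open>
With $M_n = M / (t_0^N, \dots, t_{n-1}^N) M$ this is the exactness of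
$H^q(M_n) \to H^q(M_{n+1}) \to H^{q+1-N}(M_n)$, which comes from multiplication by $t_n^N$ on $M_n$.
\<close>

lemma acyclic_mod_Suc:
  assumes V: "subcomplex V" and n: "n < r"
    and A: "acyclic_mod V N n q" "acyclic_mod V N n (q + 1 - int N)"
  shows "acyclic_mod V N (Suc n) q"
  unfolding acyclic_mod_def
proof (intro ballI impI)
  let ?u = "shift (tpow n N)"
  fix f assume f: "f \<in> tens_deg r V q" and df: "d f \<in> pow_ideal N (Suc n)"
  obtain y where y: "y \<in> tens_deg r V (q + 1 - int N)" and a: "d f - ?u y \<in> pow_ideal N n"
    using tens_deg_decomp [OF V n tens_deg_d [OF V f] df] by blast
  have "?u (d y) = - d (d f - ?u y)"
    by (simp add: d_diff lift_shift)
  also have "\<dots> \<in> pow_ideal N n"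
    using pow_ideal_diff [OF zero_in_pow_ideal pow_ideal_lift [OF a]] by simp
  finally have "d y \<in> pow_ideal N n" by (simp only: shift_tpow_in_pow_ideal_iff)
  then obtain w where w: "w \<in> tens_deg r V (q + 1 - int N - 1)" "y - d w \<in> pow_ideal N n"
    using A(2) y by (auto simp: acyclic_mod_def)
  have uw: "?u w \<in> tens_deg r V q"
    using tens_deg_shift [OF V tpow_in_monomials [OF n] w(1), of N] by simp
  have "d (f - ?u w) = (d f - ?u y) + ?u (y - d w)"
    by (simp add: d_diff lift_shift shift_diff)
  then have "d (f - ?u w) \<in> pow_ideal N n"
    using pow_ideal_add [OF a pow_ideal_shift [OF w(2)]] by simp
  then obtain v where v: "v \<in> tens_deg r V (q - 1)" "(f - ?u w) - d v \<in> pow_ideal N n"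
    using A(1) tens_deg_diff [OF V f uw] by (auto simp: acyclic_mod_def)
  have "f - d v = ((f - ?u w) - d v) + ?u w" by simp
  also have "\<dots> \<in> pow_ideal N (Suc n)"
    by (intro pow_ideal_add pow_ideal_mono [OF v(2)] shift_tpow_in_pow_ideal) simp
  finally show "\<exists>w\<in>tens_deg r V (q - 1). f - d w \<in> pow_ideal N (Suc n)" using v(1) by blast
qed

text \<open>
Each division by $t_n^N$ raises the bound by $N - 1$, the shift in the connecting map above.
\<close>

lemma acyclic_mod_above:
  assumes V: "subcomplex V" and A: "\<And>q. q > P \<Longrightarrow> acyclic_mod V N 0 q" and N: "N \<ge> 1"
  shows "n \<le> r \<Longrightarrow> q > P + int n * (int N - 1) \<Longrightarrow> acyclic_mod V N n q"
proof (induction n arbitrary: q)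
  case 0
  then show ?case by (simp add: A)
next
  case (Suc n)
  have q: "q + 1 - int N > P + int n * (int N - 1)" using Suc.prems by (simp add: algebra_simps)
  moreover have "q \<ge> q + 1 - int N" using N by simp
  ultimately have "q > P + int n * (int N - 1)" by linarith
  with q show ?case using Suc by (intro acyclic_mod_Suc [OF V]) auto
qed

text \<open>
A gap in the cohomology just above the generators makes all the cohomology above it vanish.  Modulo all
variables only the generators are left, which have degree at most \<open>p\<close>.  Going back from
\<open>n + 1\<close> to \<open>n\<close> variables, multiplication by $t_n$ maps $H^{q-1}(M_n)$ onto $H^q(M_n)$ for $q > p$, so
vanishing propagates upwards from degree \<open>p + 1\<close>, where it is known for all \<open>n\<close>.
\<close>

lemma acyclic_above_generators:
  assumes V: "subcomplex V" and top: "\<And>q. q > p \<Longrightarrow> V q = {0}"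
    and A: "acyclic_mod V 1 0 (p + 1)" and q: "q > p"
  shows "acyclic_mod V 1 0 q"
proof -
  \<comment> \<open>Since the variables have degree 1, no degree is lost when a variable is divided out.\<close>
  have base: "acyclic_mod V 1 n (p + 1)" if "n \<le> r" for n
    using that
  proof (induction n)
    case 0
    show ?case by (rule A)
  next
    case (Suc n)
    then have IH: "acyclic_mod V 1 n (p + 1)" by linarith
    moreover have "p + 1 + 1 - int 1 = p + 1" by simp
    ultimately show ?case using Suc.prems by (intro acyclic_mod_Suc [OF V]) (simp_all only: Suc_le_eq)
  qed
  have "\<forall>q>p. acyclic_mod V 1 (r - k) q" if "k \<le> r" for k
    using that
  proof (induction k)
    case 0
    have "f \<in> pow_ideal 1 r" if q: "q > p" and f: "f \<in> tens_deg r V q" for q f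
      unfolding pow_ideal_def mem_Collect_eq
    proof (intro allI impI)
      fix m :: mono assume m: "\<forall>i<r. coef m i < 1"
      show "coef f m = 0"
      proof (cases "m \<in> monomials r")
        case True
        then have "m = 0" using m by (intro poly_mapping_eqI) (auto simp: in_monomials_iff not_less dest: leI)
        then have "coef f m \<in> V q" using f by (auto simp: tens_deg_iff dest: spec [of _ 0])
        then show ?thesis using top q by auto
      next
        case False
        then show ?thesis using f by (auto simp: tens_deg_iff in_keys_iff)
      qed
    qed
    then show ?case
      by (auto simp: acyclic_mod_def intro!: bexI [of _ 0] tens_deg_zero V)
  next
    case (Suc k)
    define n where "n = r - Suc k"
    have n: "n < r" "r - k = Suc n" using Suc.prems by (auto simp: n_def)
    have IH: "acyclic_mod V 1 (Suc n) q" if "q > p" for q using Suc n that by simp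
    have "acyclic_mod V 1 n (p + 1 + int j)" for j
    proof (induction j)
      case 0
      then show ?case using base [of n] n by simp
    next
      case (Suc j)
      show ?case
        unfolding acyclic_mod_def
      proof (intro ballI impI)
        let ?q = "p + 1 + int (Suc j)" and ?u = "shift (tpow n 1)"
        fix f assume f: "f \<in> tens_deg r V ?q" and df: "d f \<in> pow_ideal 1 n"
        obtain w where w: "w \<in> tens_deg r V (?q - 1)" "f - d w \<in> pow_ideal 1 (Suc n)"
          using IH [of ?q] f pow_ideal_mono [OF df, of "Suc n"] by (auto simp: acyclic_mod_def)
        have "d w \<in> tens_deg r V ?q" using tens_deg_d [OF V w(1)] by simp
        then obtain y where y: "y \<in> tens_deg r V (?q - int 1)" "f - d w - ?u y \<in> pow_ideal 1 n"
          using tens_deg_decomp [OF V n(1) tens_deg_diff [OF V f] w(2)] by metis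
        have "?q - int 1 = p + 1 + int j" by simp
        with y(1) have y': "y \<in> tens_deg r V (p + 1 + int j)" by metis
        have "?u (d y) = d f - d (f - d w - ?u y)"
          by (simp add: d_diff lift_shift)
        also have "\<dots> \<in> pow_ideal 1 n"
          by (rule pow_ideal_diff [OF df pow_ideal_lift [OF y(2)]])
        finally have "d y \<in> pow_ideal 1 n" by (simp only: shift_tpow_in_pow_ideal_iff)
        then obtain v where v: "v \<in> tens_deg r V (?q - 1 - 1)" "y - d v \<in> pow_ideal 1 n"
          using bspec [OF Suc [unfolded acyclic_mod_def] y'] by auto
        have "?u v \<in> tens_deg r V (?q - 1)"
          using tens_deg_shift [OF V tpow_in_monomials [OF n(1)] v(1), of 1]
          by (simp add: algebra_simps)
        then have "w + ?u v \<in> tens_deg r V (?q - 1)" by (rule tens_deg_add [OF V w(1)])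
        moreover have "f - d (w + ?u v) = (f - d w - ?u y) + ?u (y - d v)"
          by (simp add: d_add lift_shift shift_diff)
        then have "f - d (w + ?u v) \<in> pow_ideal 1 n"
          using pow_ideal_add [OF y(2) pow_ideal_shift [OF v(2)]] by metis
        ultimately show "\<exists>w\<in>tens_deg r V (?q - 1). f - d w \<in> pow_ideal 1 n" by blast
      qed
    qed
    then have "acyclic_mod V 1 n q" if "q > p" for q
      using that by (metis add.commute add.left_commute zle_iff_zadd zless_imp_add1_zle)
    then show ?case by (simp add: n_def)
  qed
  from this [of r] q show ?thesis by simp
qed

end

section \<open>Bockstein operators and the filtration\<close>

text \<open>
Division by $t_j$.  The set \<open>A\<close> of monomials discards, in the construction of the Bockstein operators,
the multiples of the later variables; in the decomposition of a polynomial by its variables it selects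
the monomials that are assigned to $t_j$.
\<close>

definition divide_var :: "mono set \<Rightarrow> nat \<Rightarrow> (mono \<Rightarrow>\<^sub>0 'k::ab_group_add) \<Rightarrow> (mono \<Rightarrow>\<^sub>0 'k)" where
  "divide_var A j g = Poly_Mapping.Abs_poly_mapping (\<lambda>m. if m \<in> A then coef g (tpow j 1 + m) else 0)"

lemma coef_divide_var: "coef (divide_var A j g) m = (if m \<in> A then coef g (tpow j 1 + m) else 0)"
proof -
  have "finite ((\<lambda>m. tpow j 1 + m) -` Poly_Mapping.keys g)"
    by (rule finite_vimageI) (auto simp: inj_on_def)
  then have "finite {m. (if m \<in> A then coef g (tpow j 1 + m) else 0) \<noteq> 0}"
    by (rule rev_finite_subset) (auto simp: in_keys_iff)
  then show ?thesis unfolding divide_var_def by (simp add: Abs_poly_mapping_inverse)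
qed

lemma divide_var_add: "divide_var A j (f + g) = divide_var A j f + divide_var A j g"
  by (rule poly_mapping_eqI) (simp add: coef_divide_var lookup_add)

lemma divide_var_zero [simp]: "divide_var A j 0 = 0"
  by (rule poly_mapping_eqI) (simp add: coef_divide_var)

lemma divide_var_kscale:
  "divide_var A j (kscale (*) a f) = kscale (*) a (divide_var A j (f :: mono \<Rightarrow>\<^sub>0 'k::field))"
  by (rule poly_mapping_eqI) (simp add: coef_divide_var coef_kscale vector_space_times)

text \<open>
The monomial $(t_0 \cdots t_{n-1})^{N-1}$, which generates the socle modulo the \<open>N\<close>-th powers.
\<close>

definition staircase :: "nat \<Rightarrow> nat \<Rightarrow> mono" where
  "staircase N n = (\<Sum>i<n. tpow i (N - 1))"

lemma coef_staircase: "coef (staircase N n) i = (if i < n then N - 1 else 0)"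
  by (simp add: staircase_def lookup_sum lookup_single when_def)

context minimal_complex begin

definition functional :: "('h \<Rightarrow> 'k) \<Rightarrow> bool" where
  "functional \<phi> \<longleftrightarrow> additive \<phi> \<and> (\<forall>a x. \<phi> (s a x) = a * \<phi> x)"

lemma ex_functional:
  assumes "x \<noteq> 0"
  obtains \<phi> where "functional \<phi>" "\<phi> x = 1"
proof -
  define B where "B = extend_basis {x}"
  have ind: "independent {x}" using assms by simp
  have B: "independent B" "span B = UNIV" "x \<in> B"
    using independent_extend_basis [OF ind] span_extend_basis [OF ind] extend_basis_superset [OF ind]
    by (auto simp: B_def)
  have "functional (\<lambda>v. representation B v x)"
    by (simp add: functional_def additive_def representation_add representation_scale B)
  moreover have "representation B x x = 1"
    using representation_basis [OF B(1,3)] by simp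
  ultimately show ?thesis by (rule that)
qed

text \<open>
The values on the generators of maps $\beta_n$ from $\tilde H$ to $k[t_0, \dots, t_{n-1}]$: the first
one is \<open>\<phi>\<close>, extended by 0 on multiples of the variables, and each one arises from its predecessor by the connecting homomorphism
of multiplication by $t_n$ on $k[t_0, \dots, t_n]$.
\<close>

primrec bockstein :: "('h \<Rightarrow> 'k) \<Rightarrow> nat \<Rightarrow> 'h \<Rightarrow> (mono \<Rightarrow>\<^sub>0 'k)" where
  "bockstein \<phi> 0 x = emb (\<phi> x)"
| "bockstein \<phi> (Suc n) x = divide_var (monomials (Suc n)) n (lift (bockstein \<phi> n) (D x))"

lemma additive_bockstein: "additive \<phi> \<Longrightarrow> additive (bockstein \<phi> n)"
  by (induction n)
     (simp_all add: additive_def emb_add lift_add divide_var_add additive.add [OF D_additive])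

text \<open>
Modulo the variables $t_n, t_{n+1}, \dots$ the map $\beta_n$ vanishes on boundaries, that is, it is a
cochain map to $k[t_0, \dots, t_{n-1}]$.  Therefore $\beta_n d$ is divisible by $t_n$ modulo the later
variables, and the quotient is $\beta_{n+1}$.  That $\beta_{n+1}$ vanishes on boundaries again
follows from $t_n \beta_{n+1} d = \beta_n d d = 0$.
\<close>

lemma bockstein_d:
  assumes \<phi>: "additive \<phi>"
  shows "(\<forall>f. \<forall>l\<in>monomials n. coef (lift (bockstein \<phi> n) (d f)) l = 0) \<and>
    (\<forall>f. \<forall>l\<in>monomials (Suc n). coef (lift (bockstein \<phi> n) (d f)) (tpow n 1 + l)
        = coef (lift (bockstein \<phi> (Suc n)) f) l)"
proof (induction n)
  have *: "\<forall>f. \<forall>l\<in>monomials (Suc n). coef (lift (bockstein \<phi> n) (d f)) (tpow n 1 + l)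
        = coef (lift (bockstein \<phi> (Suc n)) f) l"
    if IH: "\<forall>f. \<forall>l\<in>monomials n. coef (lift (bockstein \<phi> n) (d f)) l = 0" for n
  proof (intro allI ballI)
    fix f and l :: mono assume l: "l \<in> monomials (Suc n)"
    let ?g = "\<lambda>x. lift (bockstein \<phi> n) (D x)"
    have "coef (shift m (?g x)) (tpow n 1 + l)
        = coef (shift m (bockstein \<phi> (Suc n) x)) l" for m x
    proof (cases "\<exists>k. l = m + k")
      case True
      then obtain k where k: "l = m + k" by blast
      then have "k \<in> monomials (Suc n)" using l by (simp add: monomials_add_iff)
      moreover have "tpow n 1 + l = m + (tpow n 1 + k)" by (simp add: k ac_simps)
      then have "coef (shift m (?g x)) (tpow n 1 + l) = coef (?g x) (tpow n 1 + k)"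
        by (simp only: coef_shift_add)
      ultimately show ?thesis by (simp add: k coef_divide_var)
    next
      case l_m: False
      have "coef (shift m (?g x)) (tpow n 1 + l) = 0"
      proof (cases "\<exists>k. tpow n 1 + l = m + k")
        case True
        then obtain k where k: "tpow n 1 + l = m + k" by blast
        have "coef k n = 0"
        proof (rule ccontr)
          assume "coef k n \<noteq> 0"
          then obtain k' where k': "k = k' + tpow n 1"
            using exponent_ge_imp_factor [of 1 k n] by auto
          have "tpow n 1 + l = m + (k' + tpow n 1)" unfolding k k' ..
          also have "\<dots> = tpow n 1 + (m + k')" by (metis add.assoc add.commute)
          finally have "tpow n 1 + l = tpow n 1 + (m + k')" .
          then show False using l_m by simp
        qed
        moreover have "k \<in> monomials (Suc n)"
          using l tpow_in_monomials [of n "Suc n" 1] k by (metis lessI monomials_add_iff)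
        ultimately have "k \<in> monomials n"
          unfolding in_monomials_iff by (metis Suc_leI le_neq_implies_less)
        then have "coef (?g x) k = 0" using IH by (metis d_emb)
        then show ?thesis by (simp only: k coef_shift_add)
      qed (auto intro: coef_shift_other)
      then show ?thesis using l_m by (simp add: coef_shift_other)
    qed
    then show "coef (lift (bockstein \<phi> n) (d f)) (tpow n 1 + l)
        = coef (lift (bockstein \<phi> (Suc n)) f) l"
      by (simp add: lift_lift additive_bockstein \<phi> D_additive coef_lift [of _ f])
  qed
  {
    case 0
    have "coef (lift (bockstein \<phi> 0) (d f)) l = 0" if l: "l \<in> monomials 0" for f l
    proof -
      have "l = 0" using l by (auto simp: in_monomials_iff intro!: poly_mapping_eqI)
      moreover have "coef (lift (bockstein \<phi> 0) (D x)) 0 = 0" for x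
        using D_minimal [of x]
        by (auto simp: coef_lift shift_emb lookup_single when_def in_keys_iff intro!: sum.neutral)
      then have "coef (shift m (lift (bockstein \<phi> 0) (D x))) 0 = 0" for m x
        by (simp add: coef_shift_0 del: bockstein.simps)
      ultimately show ?thesis
        by (simp add: lift_lift additive_bockstein \<phi> D_additive coef_lift [of _ f] del: bockstein.simps)
    qed
    then show ?case using *[of 0] by blast
  next
    case (Suc n)
    have "coef (lift (bockstein \<phi> (Suc n)) (d f)) l = 0" if "l \<in> monomials (Suc n)" for f l
    proof -
      have "coef (lift (bockstein \<phi> n) (d (d f))) (tpow n 1 + l)
          = coef (lift (bockstein \<phi> (Suc n)) (d f)) l"
        by (rule Suc [THEN conjunct2, THEN spec, THEN bspec, OF that])
      then show ?thesis by (simp add: lift_zero additive_bockstein \<phi> del: bockstein.simps)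
    qed
    then show ?case using *[of "Suc n"] by blast
  }
qed

text \<open>
Each Bockstein operator involves one more application of the boundary, which lowers the filtration by
one.
\<close>

lemma bockstein_filt: "x \<in> filt r d n \<Longrightarrow> additive \<phi> \<Longrightarrow> bockstein \<phi> n x = 0"
proof (induction n arbitrary: x)
  case 0
  then show ?case by (simp add: additive.zero)
next
  case (Suc n)
  then have "bockstein \<phi> n (coef (D x) m) = 0" for m by (simp add: d_emb tens_def)
  then show ?case by (simp add: lift_def)
qed

text \<open>
The cocycle $t_n^N y_n$ of the complex modulo $(t_0^N, \dots, t_{n-1}^N)$ has degree above the bound of
\<open>acyclic_mod_above\<close>, and $y_{n+1}$ is an element that it is the boundary of.  In
$t_n \beta_{n+1}(y_{n+1}) = \beta_n(d y_{n+1})$ the multiples of $t_i^N$ with $i < n$ do not contribute to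
the coefficient of $(t_0 \cdots t_{n-1})^{N-1} t_n^N$, so this coefficient is the one of
$(t_0 \cdots t_{n-1})^{N-1}$ in $\beta_n(y_n)$.
\<close>

lemma ex_bockstein_chain:
  assumes V: "subcomplex V" and A: "\<And>q. q > P \<Longrightarrow> acyclic_mod V N 0 q" and N: "N \<ge> 1"
    and x: "x \<in> V q0" "D x = 0" and q0: "q0 + int N > P"
    and \<phi>: "additive \<phi>" "\<phi> x = 1"
  shows "n \<le> r \<Longrightarrow> \<exists>y \<in> tens_deg r V (q0 + int n * (int N - 1)). d y \<in> pow_ideal N n \<and>
    coef (lift (bockstein \<phi> n) y) (staircase N n) = 1"
proof (induction n)
  case 0
  then show ?case
    by (intro bexI [of _ "emb x"] emb_tens_deg V)
       (auto simp: x d_emb staircase_def lift_emb additive_bockstein \<phi> simp del: bockstein.simps,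
        simp add: \<phi> coef_emb)
next
  case (Suc n)
  let ?q = "q0 + int n * (int N - 1)" and ?b = "\<lambda>n. lift (bockstein \<phi> n)"
  from Suc obtain y where y: "y \<in> tens_deg r V ?q" "d y \<in> pow_ideal N n"
    "coef (?b n y) (staircase N n) = 1" by auto
  have n: "n < r" using Suc.prems by simp
  have "acyclic_mod V N n (?q + int N)"
    using q0 n by (intro acyclic_mod_above [OF V A N]) auto
  moreover have "shift (tpow n N) y \<in> tens_deg r V (?q + int N)"
    using tens_deg_shift [OF V tpow_in_monomials [OF n] y(1), of N] by simp
  moreover have "d (shift (tpow n N) y) \<in> pow_ideal N n"
    by (simp add: lift_shift pow_ideal_shift y)
  ultimately obtain w where w: "w \<in> tens_deg r V (?q + int N - 1)"
    "shift (tpow n N) y - d w \<in> pow_ideal N n" unfolding acyclic_mod_def by blast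
  have "d w = shift (tpow n N) y - (shift (tpow n N) y - d w)" by simp
  also have "\<dots> \<in> pow_ideal N (Suc n)"
    by (intro pow_ideal_diff shift_tpow_in_pow_ideal pow_ideal_mono [OF w(2)]) simp
  finally have dw: "d w \<in> pow_ideal N (Suc n)" .
  have l: "tpow n 1 + staircase N (Suc n) = tpow n N + staircase N n"
    using N by (intro poly_mapping_eqI) (auto simp: lookup_add coef_staircase lookup_single when_def)
  have "staircase N (Suc n) \<in> monomials (Suc n)"
    by (simp add: in_monomials_iff coef_staircase)
  then have "coef (?b (Suc n) w) (staircase N (Suc n))
      = coef (?b n (d w)) (tpow n N + staircase N n)"
    using bockstein_d [OF \<phi>(1), of n] unfolding l [symmetric] by simp
  also have "\<dots> = coef (?b n (shift (tpow n N) y)) (tpow n N + staircase N n)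
      - coef (?b n (shift (tpow n N) y - d w)) (tpow n N + staircase N n)"
    by (simp add: lift_diff additive_bockstein \<phi> lookup_minus)
  also have "coef (?b n (shift (tpow n N) y - d w)) (tpow n N + staircase N n) = 0"
  proof -
    have "\<forall>i<n. coef (tpow n N + staircase N n) i < N"
      using N by (simp add: lookup_add coef_staircase lookup_single)
    then show ?thesis
      using pow_ideal_lift [OF w(2), of "bockstein \<phi> n"] unfolding pow_ideal_def by blast
  qed
  also have "coef (?b n (shift (tpow n N) y)) (tpow n N + staircase N n) = 1"
    by (simp add: lift_shift y)
  finally have "coef (?b (Suc n) w) (staircase N (Suc n)) = 1"
    by (simp del: bockstein.simps)
  moreover have "?q + int N - 1 = q0 + int (Suc n) * (int N - 1)" by (simp add: algebra_simps)
  ultimately show ?case using w(1) dw by metis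
qed

text \<open>
The map $\beta_r$ kills the \<open>r\<close>-th step of the filtration, but not the element $y_r$ of the
subcomplex.
\<close>

theorem filt_not_exhausted:
  assumes V: "subcomplex V" and A: "\<And>q. q > P \<Longrightarrow> acyclic_mod V 1 0 q"
    and x: "x \<in> V q0" "D x = 0" "x \<noteq> 0"
  shows "\<exists>q. \<not> V q \<subseteq> filt r d r"
proof -
  \<comment> \<open>Any \<open>N\<close> with $q_0 + N > P$ puts all obstructions above the bound \<open>P\<close>.\<close>
  define N where "N = Suc (nat (P - q0))"
  have N: "N \<ge> 1" "q0 + int N > P" by (auto simp: N_def)
  obtain \<phi> where \<phi>: "functional \<phi>" "\<phi> x = 1" by (rule ex_functional [OF x(3)])
  then have \<phi>': "additive \<phi>" by (simp add: functional_def)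
  have A': "acyclic_mod V N 0 q" if "q > P" for q
    using A [OF that] by (simp add: acyclic_mod_def pow_ideal_0)
  obtain y where y: "y \<in> tens_deg r V (q0 + int r * (int N - 1))"
      "coef (lift (bockstein \<phi> r) y) (staircase N r) = 1"
    using ex_bockstein_chain [OF V A' N(1) x(1,2) N(2) \<phi>' \<phi>(2), of r] by auto
  have "\<exists>m. bockstein \<phi> r (coef y m) \<noteq> 0"
  proof (rule ccontr)
    assume "\<nexists>m. bockstein \<phi> r (coef y m) \<noteq> 0"
    then have "lift (bockstein \<phi> r) y = 0" by (auto simp add: lift_def intro!: sum.neutral)
    then show False using y(2) by simp
  qed
  then obtain m where "coef y m \<notin> filt r d r"
    using bockstein_filt \<phi>' by blast
  moreover have "coef y m \<in> V (q0 + int r * (int N - 1) - int (mdeg m))"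
    using y(1) by (simp add: tens_deg_iff)
  ultimately show ?thesis by blast
qed

end

section \<open>The action of the exterior algebra\<close>

context minimal_complex begin

lemma lam_eq: "lam d i x = coef (D x) (tpow i 1)"
  by (simp add: lam_def d_emb)

lemma additive_lam: "additive (lam d i)"
  by (simp add: additive_def lam_eq additive.add [OF D_additive] lookup_add)

lemma lam_H: "x \<in> H q \<Longrightarrow> lam d i x \<in> H q"
  using D_deg [of x q "tpow i 1"] by (simp add: lam_eq)

text \<open>
The coefficient of $t_i t_j$ in $d(d(x)) = 0$.  By minimality only the linear part of the boundary
contributes to it; the set on the right has one element if $i = j$, which yields
$\lambda_i^2 = 0$ in every characteristic.
\<close>

lemma lam_lam_aux:
  "0 = (\<Sum>m\<in>{tpow i 1, tpow j 1}. coef (shift m (D (coef (D x) m))) (tpow i 1 + tpow j 1))"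
proof -
  let ?l = "tpow i 1 + tpow j 1"
  let ?t = "\<lambda>m. coef (shift m (D (coef (D x) m))) ?l"
  have other: "?t m = 0" if m: "m \<notin> {tpow i 1, tpow j 1}" for m
  proof (cases "\<exists>n. ?l = m + n")
    case True
    then obtain n where n: "?l = m + n" by blast
    consider "m = 0" | "n = 0" | "mdeg m \<ge> 1" "mdeg n \<ge> 1"
      using mdeg_eq_0_iff [of m] mdeg_eq_0_iff [of n] by linarith
    then show ?thesis
    proof cases
      case 1
      then show ?thesis by (simp add: D_minimal additive.zero [OF D_additive])
    next
      case 2
      then show ?thesis unfolding n coef_shift_add by (simp add: D_minimal)
    next
      case 3
      have "mdeg m + mdeg n = 2" using arg_cong [OF n, of mdeg] by (simp add: mdeg_add)
      with 3 have "mdeg m = 1" by linarith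
      then obtain k where k: "m = tpow k 1" by (rule mdeg_eq_1)
      have "coef ?l k \<ge> 1" unfolding n k by (simp add: lookup_add)
      then have "k = i \<or> k = j" by (auto simp: lookup_add lookup_single when_def split: if_splits)
      with k m show ?thesis by blast
    qed
  qed (auto intro: coef_shift_other)
  have "0 = coef (lift D (D x)) ?l" by (simp add: D_square)
  also have "\<dots> = (\<Sum>m\<in>Poly_Mapping.keys (D x) \<union> {tpow i 1, tpow j 1}. ?t m)"
    unfolding coef_lift
    by (rule sum.mono_neutral_left) (auto simp: in_keys_iff additive.zero [OF D_additive])
  also have "\<dots> = (\<Sum>m\<in>{tpow i 1, tpow j 1}. ?t m)"
    by (rule sum.mono_neutral_right) (use other in auto)
  finally show ?thesis .
qed

lemma lam_square: "lam d i (lam d i x) = 0"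
  using lam_lam_aux [where i = i and j = i and x = x] by (simp add: lam_eq)

lemma lam_anticommute: "lam d i (lam d j x) = - lam d j (lam d i x)"
proof (cases "i = j")
  case True
  then show ?thesis by (simp add: lam_square)
next
  case False
  then have "tpow i 1 \<noteq> tpow j 1"
    by (metis lookup_single_eq lookup_single_not_eq zero_neq_one)
  then have "0 = coef (shift (tpow i 1) (D (coef (D x) (tpow i 1)))) (tpow i 1 + tpow j 1)
      + coef (shift (tpow j 1) (D (coef (D x) (tpow j 1)))) (tpow j 1 + tpow i 1)"
    using lam_lam_aux [where i = i and j = j and x = x] by (simp add: add.commute)
  then have "0 = lam d j (lam d i x) + lam d i (lam d j x)"
    unfolding coef_shift_add lam_eq .
  then show ?thesis by (simp add: eq_neg_iff_add_eq_0 add.commute)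
qed

lemma foldr_lam_zero: "foldr (lam d) js 0 = 0"
  by (induction js) (simp_all add: additive.zero [OF additive_lam])

lemma foldr_lam_not_distinct:
  assumes "\<not> distinct js" shows "foldr (lam d) js x = 0"
proof -
  obtain xs ys zs a where js: "js = xs @ [a] @ ys @ [a] @ zs"
    using not_distinct_decomp [OF assms] by blast
  have "lam d a (foldr (lam d) ys (lam d a z)) = 0" for z
  proof (induction ys)
    case Nil
    then show ?case by (simp add: lam_square)
  next
    case (Cons b ys)
    then show ?case
      by (simp add: lam_anticommute [of a b] additive.zero [OF additive_lam])
  qed
  then show ?thesis by (simp add: js foldr_lam_zero)
qed

lemma foldr_lam_long:
  assumes "set js \<subseteq> {..<r}" "length js > r" shows "foldr (lam d) js x = 0"
proof (rule foldr_lam_not_distinct)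
  have "card (set js) \<le> r" using card_mono [OF _ assms(1)] by simp
  then show "\<not> distinct js" using assms(2) distinct_card [of js] by linarith
qed

lemma foldr_lam_H: "x \<in> H q \<Longrightarrow> foldr (lam d) js x \<in> H q"
  by (induction js) (simp_all add: lam_H)

text \<open>
Minimality and the linear part rule out the monomials of degree 0 and 1, and the coefficients of the
other monomials have degree below \<open>q\<close>.
\<close>

lemma D_eq_0I:
  assumes x: "x \<in> H q" and low: "\<And>p. p < q \<Longrightarrow> H p = {0}"
    and lam: "\<And>i. i < r \<Longrightarrow> lam d i x = 0"
  shows "D x = 0"
proof (rule poly_mapping_eqI)
  fix m
  consider "m = 0" | "mdeg m = 1" | "mdeg m \<ge> 2"
    using mdeg_eq_0_iff [of m] by linarith
  then show "coef (D x) m = coef 0 m"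
  proof cases
    case 1
    then show ?thesis by (simp add: D_minimal)
  next
    case 2
    then obtain i where m: "m = tpow i 1" by (rule mdeg_eq_1)
    show ?thesis
    proof (cases "i < r")
      case True
      then show ?thesis using lam by (simp add: m lam_eq)
    next
      case False
      then have "m \<notin> monomials r" by (auto simp: m in_monomials_iff intro!: exI [of _ i])
      then show ?thesis using D_monomials [of x] by (auto simp: in_keys_iff)
    qed
  next
    case 3
    then show ?thesis using D_deg [OF x, of m] low [of "q + 1 - int (mdeg m)"] by simp
  qed
qed

text \<open>
Apply a longest product of the $\lambda_i$ that does not vanish on $H^q$: its values are killed by all
$\lambda_i$.
\<close>

lemma ex_constant_cocycle:
  assumes low: "\<And>p. p < q \<Longrightarrow> H p = {0}" and q: "H q \<noteq> {0}"
  obtains x where "x \<in> H q" "x \<noteq> 0" "D x = 0"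
proof -
  \<comment> \<open>The lengths of the products that are nonzero at some element of $H^q$; they are at most \<open>r\<close>.\<close>
  let ?P = "\<lambda>n. \<exists>js y. length js = n \<and> set js \<subseteq> {..<r} \<and> y \<in> H q \<and> foldr (lam d) js y \<noteq> 0"
  obtain z where z: "z \<in> H q" "z \<noteq> 0" using q subspace_0 [OF subspace_H [of q]] by blast
  then have "?P 0" by auto
  have bound: "n \<le> r" if "?P n" for n
  proof (rule ccontr)
    assume "\<not> n \<le> r"
    then show False using that foldr_lam_long by auto
  qed
  define n where "n = Greatest ?P"
  have n: "?P n" unfolding n_def by (rule GreatestI_nat [of ?P, OF \<open>?P 0\<close> bound])
  have max: "n' \<le> n" if "?P n'" for n'
    unfolding n_def by (rule Greatest_le_nat [of ?P, OF that bound])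
  from n obtain js y where js: "length js = n" "set js \<subseteq> {..<r}" "y \<in> H q" "foldr (lam d) js y \<noteq> 0"
    by blast
  have "D (foldr (lam d) js y) = 0"
  proof (rule D_eq_0I [OF foldr_lam_H [OF js(3)] low])
    fix i assume i: "i < r"
    show "lam d i (foldr (lam d) js y) = 0"
    proof (rule ccontr)
      assume "lam d i (foldr (lam d) js y) \<noteq> 0"
      then have "?P (Suc n)" using i js by (intro exI [of _ "i # js"] exI [of _ y]) auto
      then show False using max [of "Suc n"] by simp
    qed
  qed
  then show ?thesis using that foldr_lam_H js by blast
qed

section \<open>The filtration is bounded by the lengths over the exterior algebra\<close>

lemma filt_Suc_iff: "x \<in> filt r d (Suc n) \<longleftrightarrow> (\<forall>m. coef (D x) m \<in> filt r d n)"
  using D_monomials by (auto simp: d_emb tens_def)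

lemma subspace_filt: "subspace (filt r d n)"
proof (induction n)
  case 0
  then show ?case by (simp add: subspace_single_0)
next
  case (Suc n)
  then show ?case
    unfolding subspace_def
    by (auto simp: filt_Suc_iff additive.zero [OF D_additive] additive.add [OF D_additive] lookup_add
      D_scale coef_kscale vector_space_axioms simp del: filt.simps)
qed

lemma filt_mono_Suc: "filt r d n \<subseteq> filt r d (Suc n)"
proof (induction n)
  case 0
  show ?case using subspace_0 [OF subspace_filt [of "Suc 0"]] by (simp del: filt.simps(2))
next
  case (Suc n)
  then show ?case unfolding subset_iff filt_Suc_iff by blast
qed

lemma filt_mono: "n \<le> n' \<Longrightarrow> filt r d n \<subseteq> filt r d n'"
  by (rule lift_Suc_mono_le [of "filt r d"]) (rule filt_mono_Suc)

text \<open>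
Of the coefficients of $d(x)$, those of monomials of degree at least 2 lie in $H^{<q}$, and those of the
variables are the $\lambda_i(x)$, on which products of length $j - 1$ vanish.
\<close>

lemma H_filt_step:
  assumes low: "\<And>p. p < q \<Longrightarrow> H p \<subseteq> filt r d n"
  shows "x \<in> H q \<Longrightarrow> (\<And>js. set js \<subseteq> {..<r} \<Longrightarrow> length js = j \<Longrightarrow> foldr (lam d) js x = 0)
    \<Longrightarrow> x \<in> filt r d (n + j)"
proof (induction j arbitrary: x)
  case 0
  from "0.prems"(2) [of "[]"] have "x = 0" by simp
  then show ?case by (simp only: subspace_0 [OF subspace_filt])
next
  case (Suc j)
  have "coef (D x) m \<in> filt r d (n + j)" for m
  proof -
    consider "m = 0" | "mdeg m = 1" | "mdeg m \<ge> 2"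
      using mdeg_eq_0_iff [of m] by linarith
    then show ?thesis
    proof cases
      case 1
      then show ?thesis by (simp add: D_minimal subspace_0 [OF subspace_filt])
    next
      case 2
      then obtain i where m: "m = tpow i 1" by (rule mdeg_eq_1)
      show ?thesis
      proof (cases "i < r")
        case True
        have "lam d i x \<in> filt r d (n + j)"
        proof (rule Suc.IH [OF lam_H [OF Suc.prems(1)]])
          fix js assume "set js \<subseteq> {..<r}" "length js = j"
          then show "foldr (lam d) js (lam d i x) = 0"
            using Suc.prems(2) [of "js @ [i]"] True by simp
        qed
        then show ?thesis by (simp add: m lam_eq)
      next
        case False
        then have "m \<notin> monomials r" by (auto simp: m in_monomials_iff intro!: exI [of _ i])
        then have "coef (D x) m = 0" using D_monomials [of x] by (auto simp: in_keys_iff)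
        then show ?thesis by (simp only: subspace_0 [OF subspace_filt])
      qed
    next
      case 3
      then have "coef (D x) m \<in> filt r d n"
        using D_deg [OF Suc.prems(1), of m] low [of "q + 1 - int (mdeg m)"] by auto
      then show ?thesis using filt_mono [of n "n + j"] by auto
    qed
  qed
  then show ?case by (simp only: filt_Suc_iff add_Suc_right) simp
qed

text \<open>
The lengths \<open>len\<close> are arbitrary bounds for the nonvanishing products, so that the statement covers both
the lengths over the exterior algebra and, if the linear part vanishes, the constant 1.
\<close>

lemma H_subset_filt:
  assumes Q: "finite {q. H q \<noteq> {0}}"
    and len: "\<And>q x js. x \<in> H q \<Longrightarrow> set js \<subseteq> {..<r} \<Longrightarrow> length js = len q \<Longrightarrow> foldr (lam d) js x = 0"
  shows "H q \<subseteq> filt r d (\<Sum>p | H p \<noteq> {0} \<and> p \<le> q. len p)"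
proof (induction "card {p. H p \<noteq> {0} \<and> p \<le> q}" arbitrary: q rule: less_induct)
  case less
  have fin: "finite {p. H p \<noteq> {0} \<and> p \<le> q}" for q
    using Q by (rule rev_finite_subset) auto
  show ?case
  proof (cases "H q = {0}")
    case True
    then show ?thesis using subspace_0 [OF subspace_filt] by simp
  next
    case q: False
    let ?n = "\<Sum>p | H p \<noteq> {0} \<and> p < q. len p"
    have low: "H p \<subseteq> filt r d ?n" if p: "p < q" for p
    proof -
      have "q \<in> {p. H p \<noteq> {0} \<and> p \<le> q}" "q \<notin> {p'. H p' \<noteq> {0} \<and> p' \<le> p}" using p q by auto
      moreover have "{p'. H p' \<noteq> {0} \<and> p' \<le> p} \<subseteq> {p. H p \<noteq> {0} \<and> p \<le> q}"
        using p by auto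
      ultimately have "{p'. H p' \<noteq> {0} \<and> p' \<le> p} \<subset> {p. H p \<noteq> {0} \<and> p \<le> q}"
        by blast
      then have 1: "H p \<subseteq> filt r d (\<Sum>p' | H p' \<noteq> {0} \<and> p' \<le> p. len p')"
        by (intro less psubset_card_mono fin)
      have "(\<Sum>p' | H p' \<noteq> {0} \<and> p' \<le> p. len p') \<le> ?n"
        by (rule sum_mono2) (use p in \<open>auto intro: finite_subset [OF _ fin [of q]]\<close>)
      from filt_mono [OF this] 1 show ?thesis by blast
    qed
    have "H q \<subseteq> filt r d (?n + len q)"
    proof
      fix x assume x: "x \<in> H q"
      show "x \<in> filt r d (?n + len q)"
        by (rule H_filt_step [OF low x]) (assumption, rule len [OF x])
    qed
    moreover have "{p. H p \<noteq> {0} \<and> p \<le> q} = insert q {p. H p \<noteq> {0} \<and> p < q}"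
      using q order_le_less by blast
    then have "(\<Sum>p | H p \<noteq> {0} \<and> p \<le> q. len p) = ?n + len q"
      using fin [of q] by simp
    ultimately show ?thesis by simp
  qed
qed

lemma lam_power_eq_0D:
  assumes "lam_power r s d j V = {0}" "x \<in> V" "set js \<subseteq> {..<r}" "j \<le> length js"
  shows "foldr (lam d) js x = 0"
proof -
  have "foldr (lam d) js x \<in> lam_power r s d j V"
    unfolding lam_power_def by (rule span_base) (use assms in blast)
  with assms(1) show ?thesis by simp
qed

text \<open>
Every product of more than \<open>r\<close> factors repeats one of them, so the minimum that defines the length exists.
\<close>

lemma lam_power_long: "lam_power r s d (Suc r) V = {0}"
proof -
  have "{foldr (lam d) js x | js x. set js \<subseteq> {..<r} \<and> Suc r \<le> length js \<and> x \<in> V} \<subseteq> {0}"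
    using foldr_lam_long by (auto simp: Suc_le_eq)
  then have "lam_power r s d (Suc r) V \<subseteq> span {0}"
    unfolding lam_power_def by (rule span_mono)
  moreover have "0 \<in> lam_power r s d (Suc r) V"
    unfolding lam_power_def by (rule span_zero)
  ultimately show ?thesis by auto
qed

lemma lam_power_lam_length: "lam_power r s d (lam_length r s d (H q)) (H q) = {0}"
  unfolding lam_length_def by (rule LeastI) (rule lam_power_long)

lemma lam_length_0: "lam_length r s d {0} = 0"
proof -
  have "{foldr (lam d) js x | js x. set js \<subseteq> {..<r} \<and> 0 \<le> length js \<and> x \<in> {0}} = {0}"
    by (auto simp: foldr_lam_zero intro!: exI [of _ "[]"])
  then have "lam_power r s d 0 {0} = {0}"
    unfolding lam_power_def by simp
  then show ?thesis unfolding lam_length_def by (intro Least_equality) auto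
qed

end

section \<open>Homogeneous components\<close>

text \<open>
In a sequence $K \to A \to Q$ that is exact in the middle, \<open>A\<close> is finite-dimensional if \<open>K\<close> and \<open>Q\<close>
are.  The second map is given by a linear relation \<open>T\<close> between representatives, \<open>Q\<close> is a quotient by
\<open>B\<close>, and finite-dimensionality is meant modulo \<open>B'\<close>.
\<close>

lemma (in vector_space) finite_mod_extension:
  assumes A: "subspace A" and B: "subspace B" and X: "finite X"
    and tot: "\<And>f. f \<in> A \<Longrightarrow> \<exists>y. T f y \<and> y \<in> span (X \<union> B)"
    and T_add: "\<And>f y f' y'. T f y \<Longrightarrow> T f' y' \<Longrightarrow> T (f + f') (y + y')"
    and T_scale: "\<And>a f y. T f y \<Longrightarrow> T (scale a f) (scale a y)"
    and ker: "\<And>f y. f \<in> A \<Longrightarrow> T f y \<Longrightarrow> y \<in> B \<Longrightarrow> f \<in> span (X' \<union> B')" and X': "finite X'"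
  shows "\<exists>X''. finite X'' \<and> A \<subseteq> span (X'' \<union> B')"
proof -
  \<comment> \<open>The image in \<open>Q\<close>, seen among the representatives in the span of \<open>X\<close>.\<close>
  define W where "W = {g \<in> span X. \<exists>f\<in>A. \<exists>y. T f y \<and> y - g \<in> B}"
  obtain G where G: "G \<subseteq> W" "independent G" "W \<subseteq> span G"
    using basis_exists [of W] by metis
  have "G \<subseteq> span X" using G(1) by (auto simp: W_def)
  then have finG: "finite G" using independent_span_bound [OF X G(2)] by simp
  have "\<forall>g\<in>G. \<exists>f. f \<in> A \<and> (\<exists>y. T f y \<and> y - g \<in> B)"
    using G(1) unfolding W_def by blast
  then obtain F where F: "\<forall>g\<in>G. F g \<in> A \<and> (\<exists>y. T (F g) y \<and> y - g \<in> B)" by metis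
  then obtain Y where Y: "\<forall>g\<in>G. T (F g) (Y g) \<and> Y g - g \<in> B" by metis
  have "f \<in> span (F ` G \<union> X' \<union> B')" if f: "f \<in> A" for f
  proof -
    obtain y where y: "T f y" "y \<in> span (X \<union> B)" using tot [OF f] by blast
    then obtain g b where gb: "y = g + b" "g \<in> span X" "b \<in> B"
      using B by (auto simp: span_Un span_eq_iff [THEN iffD2, OF B])
    then have "y - g \<in> B" by simp
    then have "g \<in> W" using f y(1) gb(2) unfolding W_def by blast
    then have "g \<in> span G" using G(3) by blast
    then obtain u where u: "g = (\<Sum>v\<in>G. scale (u v) v)"
      unfolding span_finite [OF finG] by blast
    define f' where "f' = f + (\<Sum>v\<in>G. scale (- u v) (F v))"
    define y' where "y' = y + (\<Sum>v\<in>G. scale (- u v) (Y v))"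
    have sums: "T (f + (\<Sum>v\<in>G'. scale (- u v) (F v))) (y + (\<Sum>v\<in>G'. scale (- u v) (Y v)))"
      if "finite G'" "G' \<subseteq> G" for G'
      using that
    proof (induction G' rule: finite_induct)
      case empty
      then show ?case using y by simp
    next
      case (insert v G')
      have "T (scale (- u v) (F v) + (f + (\<Sum>v\<in>G'. scale (- u v) (F v))))
          (scale (- u v) (Y v) + (y + (\<Sum>v\<in>G'. scale (- u v) (Y v))))"
        by (rule T_add [OF T_scale insert.IH]) (use insert.prems Y in auto)
      then show ?case using insert.hyps by (simp add: algebra_simps)
    qed
    have "T f' y'" unfolding f'_def y'_def by (rule sums [OF finG]) simp
    moreover have "f' \<in> A" unfolding f'_def
      using F by (intro subspace_add subspace_sum subspace_scale A f) auto
    moreover have "y' \<in> B"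
    proof -
      have "y' = b + (\<Sum>v\<in>G. scale (- u v) (Y v - v))"
        unfolding y'_def gb(1) u
        by (simp add: scale_right_diff_distrib sum_subtractf sum_negf)
      then show ?thesis using gb Y by (auto simp del: scale_minus_left intro!: subspace_add subspace_sum subspace_scale B)
    qed
    ultimately have "f' \<in> span (X' \<union> B')" by (intro ker)
    then have "f' \<in> span (F ` G \<union> X' \<union> B')" using span_mono [of "X' \<union> B'" "F ` G \<union> X' \<union> B'"] by auto
    moreover have "(\<Sum>v\<in>G. scale (- u v) (F v)) \<in> span (F ` G \<union> X' \<union> B')"
      by (intro span_sum span_scale span_base) auto
    ultimately show ?thesis unfolding f'_def by (metis add_diff_cancel_right' span_diff)
  qed
  then show ?thesis using finG X' by (intro exI [of _ "F ` G \<union> X'"]) auto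
qed

context minimal_complex begin

sublocale poly: vector_space "kscale s"
  by (rule vector_space_kscale) (rule vector_space_axioms)

definition homog_parts :: "'h \<Rightarrow> (int \<Rightarrow>\<^sub>0 'h)" where
  "homog_parts x = (THE f. (\<forall>q. coef f q \<in> H q) \<and> x = (\<Sum>q\<in>Poly_Mapping.keys f. coef f q))"

definition component :: "int \<Rightarrow> 'h \<Rightarrow> 'h" where
  "component q x = coef (homog_parts x) q"

lemma homog_parts_ex1:
  "\<exists>!f. (\<forall>q. coef f q \<in> H q) \<and> x = (\<Sum>q\<in>Poly_Mapping.keys f. coef f q)"
  using graded by (simp add: graded_space_def)

lemma component_H: "component q x \<in> H q"
  using theI' [OF homog_parts_ex1 [of x]] by (simp add: component_def homog_parts_def)

lemma sum_component:
  assumes "finite A" "Poly_Mapping.keys (homog_parts x) \<subseteq> A"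
  shows "x = (\<Sum>q\<in>A. component q x)"
proof -
  have "x = (\<Sum>q\<in>Poly_Mapping.keys (homog_parts x). component q x)"
    using theI' [OF homog_parts_ex1 [of x]] by (simp add: component_def homog_parts_def)
  also have "\<dots> = (\<Sum>q\<in>A. component q x)"
    by (rule sum.mono_neutral_left) (use assms in \<open>auto simp: component_def in_keys_iff\<close>)
  finally show ?thesis .
qed

lemma component_eqI:
  assumes f: "\<And>q. coef f q \<in> H q" and A: "finite A" "Poly_Mapping.keys f \<subseteq> A"
    and x: "x = (\<Sum>q\<in>A. coef f q)"
  shows "component q x = coef f q"
proof -
  have "(\<Sum>q\<in>A. coef f q) = (\<Sum>q\<in>Poly_Mapping.keys f. coef f q)"
    by (rule sum.mono_neutral_right) (use A in \<open>auto simp: in_keys_iff\<close>)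
  with f x have "homog_parts x = f"
    unfolding homog_parts_def by (intro the1_equality homog_parts_ex1) auto
  then show ?thesis by (simp add: component_def)
qed

lemma component_of_H: "x \<in> H p \<Longrightarrow> component q x = (if q = p then x else 0)"
proof -
  assume x: "x \<in> H p"
  have "component q x = coef (Poly_Mapping.single p x) q"
  proof (rule component_eqI [where A = "{p}"])
    show "coef (Poly_Mapping.single p x) q \<in> H q" for q
      using x subspace_0 [OF subspace_H] by (cases "p = q") (simp_all add: lookup_single)
    show "Poly_Mapping.keys (Poly_Mapping.single p x) \<subseteq> {p}" by simp
    show "x = (\<Sum>q\<in>{p}. coef (Poly_Mapping.single p x) q)" by simp
  qed simp
  then show ?thesis by (auto simp: lookup_single when_def)
qed

lemma component_add: "component q (x + y) = component q x + component q y"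
proof -
  let ?A = "Poly_Mapping.keys (homog_parts x) \<union> Poly_Mapping.keys (homog_parts y)"
  have "component q (x + y) = coef (homog_parts x + homog_parts y) q"
  proof (rule component_eqI [where A = ?A])
    show "x + y = (\<Sum>q\<in>?A. coef (homog_parts x + homog_parts y) q)"
      using sum_component [of ?A x] sum_component [of ?A y]
      by (simp add: lookup_add sum.distrib component_def)
    show "coef (homog_parts x + homog_parts y) q \<in> H q" for q
      using component_H [of q x] component_H [of q y]
      by (simp add: lookup_add component_def subspace_add [OF subspace_H])
  qed (simp_all add: keys_add)
  then show ?thesis by (simp add: lookup_add component_def)
qed

lemma additive_component: "additive (component q)"
  by (simp add: additive_def component_add)

lemma component_scale: "component q (s a x) = s a (component q x)"
proof -
  let ?f = "Poly_Mapping.map (s a) (homog_parts x)"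
  have f: "coef ?f q = s a (component q x)" for q
    by (auto simp: map.rep_eq component_def when_def)
  have "component q (s a x) = coef ?f q"
  proof (rule component_eqI [where A = "Poly_Mapping.keys (homog_parts x)"])
    show "s a x = (\<Sum>q\<in>Poly_Mapping.keys (homog_parts x). coef ?f q)"
      using sum_component [of "Poly_Mapping.keys (homog_parts x)" x]
      by (simp add: f flip: scale_sum_right)
    show "coef ?f q \<in> H q" for q
      unfolding f by (intro subspace_scale [OF subspace_H] component_H)
    show "Poly_Mapping.keys ?f \<subseteq> Poly_Mapping.keys (homog_parts x)"
      by (auto simp: in_keys_iff f component_def)
  qed simp
  then show ?thesis by (simp add: f)
qed

lemma finite_component: "finite {q. component q x \<noteq> 0}"
  unfolding component_def by (rule finite_lookup)

text \<open>
The component of total degree \<open>n\<close>.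
\<close>

definition part :: "int \<Rightarrow> (mono \<Rightarrow>\<^sub>0 'h) \<Rightarrow> (mono \<Rightarrow>\<^sub>0 'h)" where
  "part n f = Poly_Mapping.mapp (\<lambda>m. component (n - int (mdeg m))) f"

lemma coef_part: "coef (part n f) m = component (n - int (mdeg m)) (coef f m)"
  by (simp add: part_def lookup_mapp when_def in_keys_iff additive.zero [OF additive_component])

lemma additive_part: "additive (part n)"
  by (simp add: additive_def poly_mapping_eq_iff fun_eq_iff coef_part lookup_add component_add)

lemma part_kscale: "part n (kscale s a f) = kscale s a (part n f)"
  by (simp add: poly_mapping_eq_iff fun_eq_iff coef_part coef_kscale vector_space_axioms component_scale)

lemma part_tens_deg: "f \<in> tens_deg r H q \<Longrightarrow> part n f = (if n = q then f else 0)"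
proof (rule poly_mapping_eqI)
  fix m assume "f \<in> tens_deg r H q"
  then have "coef f m \<in> H (q - int (mdeg m))" by (simp add: tens_deg_iff)
  from component_of_H [OF this]
  show "coef (part n f) m = coef (if n = q then f else 0) m" by (simp add: coef_part)
qed

lemma tens_deg_subset_tens: "tens_deg r H q \<subseteq> tens r UNIV"
  by (auto simp: tens_deg_def)

lemma part_in_tens_deg: "f \<in> tens r UNIV \<Longrightarrow> part n f \<in> tens_deg r H n"
proof -
  assume f: "f \<in> tens r UNIV"
  have "Poly_Mapping.keys (part n f) \<subseteq> Poly_Mapping.keys f"
    by (auto simp: in_keys_iff coef_part additive.zero [OF additive_component])
  with f show ?thesis by (auto simp: tens_deg_iff tens_UNIV_iff coef_part component_H)
qed

lemma part_shift: "part n (shift m f) = shift m (part (n - int (mdeg m)) f)"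
proof (rule shift_eqI)
  fix k
  have "coef (part n (shift m f)) (m + k) = component (n - int (mdeg (m + k))) (coef f k)"
    by (simp only: coef_part coef_shift_add)
  also have "n - int (mdeg (m + k)) = n - int (mdeg m) - int (mdeg k)" by (simp add: mdeg_add)
  finally show "coef (part n (shift m f)) (m + k) = coef (part (n - int (mdeg m)) f) k"
    by (simp only: coef_part)
next
  fix l assume "\<And>k. l \<noteq> m + k"
  then have "coef (shift m f) l = 0" by (rule coef_shift_other)
  then show "coef (part n (shift m f)) l = 0"
    by (simp only: coef_part additive.zero [OF additive_component])
qed

lemma part_D: "part (n + 1) (D x) = D (component n x)"
proof -
  let ?A = "insert n (Poly_Mapping.keys (homog_parts x))"
  have D: "part (n + 1) (D (component q x)) = (if q = n then D (component q x) else 0)" for q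
    using tens_deg_d [OF subcomplex_H emb_tens_deg [OF subcomplex_H component_H [of q x]]]
    by (auto simp: d_emb part_tens_deg)
  have "part (n + 1) (D x) = part (n + 1) (D (\<Sum>q\<in>?A. component q x))"
    by (subst sum_component [of ?A x]) auto
  also have "\<dots> = (\<Sum>q\<in>?A. part (n + 1) (D (component q x)))"
    by (simp add: additive.sum [OF additive_part] additive.sum [OF D_additive]
        additive.add [OF additive_part] additive.add [OF D_additive])
  also have "\<dots> = D (component n x)"
    unfolding D by (subst sum.delta) auto
  finally show ?thesis .
qed

lemma part_d: "part (n + 1) (d f) = d (part n f)"
proof -
  have "part (n + 1) (d f) = (\<Sum>m\<in>Poly_Mapping.keys f. part (n + 1) (shift m (D (coef f m))))"
    by (simp add: lift_def additive.sum [OF additive_part])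
  also have "\<dots> = (\<Sum>m\<in>Poly_Mapping.keys f. shift m (D (coef (part n f) m)))"
  proof (rule sum.cong [OF refl])
    fix m
    show "part (n + 1) (shift m (D (coef f m))) = shift m (D (coef (part n f) m))"
      using part_D [of "n - int (mdeg m)" "coef f m"]
      by (simp add: part_shift coef_part algebra_simps)
  qed
  also have "\<dots> = d (part n f)"
    by (rule lift_superset [symmetric])
       (auto simp: D_additive in_keys_iff coef_part additive.zero [OF additive_component])
  finally show ?thesis .
qed

lemma finite_part: "finite {n. part n f \<noteq> 0}"
proof -
  have "{n. part n f \<noteq> 0} \<subseteq> (\<Union>m\<in>Poly_Mapping.keys f. (\<lambda>q. q + int (mdeg m)) ` {q. component q (coef f m) \<noteq> 0})"
  proof
    fix n assume "n \<in> {n. part n f \<noteq> 0}"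
    then have "Poly_Mapping.keys (part n f) \<noteq> {}" by simp
    then obtain m where m: "coef (part n f) m \<noteq> 0" unfolding in_keys_iff [symmetric] by blast
    then have "m \<in> Poly_Mapping.keys f"
      by (auto simp: coef_part in_keys_iff additive.zero [OF additive_component])
    moreover have "n = (n - int (mdeg m)) + int (mdeg m)" by simp
    ultimately show "n \<in> (\<Union>m\<in>Poly_Mapping.keys f. (\<lambda>q. q + int (mdeg m)) ` {q. component q (coef f m) \<noteq> 0})"
      using m unfolding coef_part by (intro UN_I [of m] image_eqI [of n _ "n - int (mdeg m)"]) auto
  qed
  then show ?thesis by (rule finite_subset) (auto intro: finite_component)
qed

end

section \<open>Finiteness\<close>

context minimal_complex begin

definition finite_cohomology :: bool where
  "finite_cohomology \<longleftrightarrow> (\<exists>X. finite X \<and>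
     (\<forall>z \<in> tens r UNIV. d z = 0 \<longrightarrow> z \<in> poly.span (X \<union> d ` tens r UNIV)))"

lemma subspace_tens: "poly.subspace (tens r UNIV)"
  by (simp add: poly.subspace_def zero_in_tens tens_add tens_kscale vector_space_axioms)

lemma tens_d: "f \<in> tens r UNIV \<Longrightarrow> d f \<in> tens r UNIV"
proof -
  assume f: "f \<in> tens r UNIV"
  have "Poly_Mapping.keys (shift m (D (coef f m))) \<subseteq> monomials r"
    if "m \<in> Poly_Mapping.keys f" for m
    using f that D_monomials by (force simp: keys_shift monomials_add_iff tens_UNIV_iff)
  then show "d f \<in> tens r UNIV"
    unfolding lift_def tens_UNIV_iff using keys_sum by fast
qed

lemma subspace_boundaries: "poly.subspace (d ` tens r UNIV)"
  unfolding poly.subspace_def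
proof (intro conjI ballI allI)
  show "0 \<in> d ` tens r UNIV"
    using poly.subspace_0 [OF subspace_tens] by (intro image_eqI [of _ _ 0]) auto
next
  fix f g assume "f \<in> d ` tens r UNIV" "g \<in> d ` tens r UNIV"
  then obtain v w where vw: "f = d v" "g = d w" "v \<in> tens r UNIV" "w \<in> tens r UNIV" by blast
  then have "f + g = d (v + w)" by (simp only: d_add)
  with vw show "f + g \<in> d ` tens r UNIV"
    using poly.subspace_add [OF subspace_tens] by blast
next
  fix a f assume "f \<in> d ` tens r UNIV"
  then obtain w where w: "f = d w" "w \<in> tens r UNIV" by blast
  then have "kscale s a f = d (kscale s a w)" by (simp only: d_kscale)
  with w show "kscale s a f \<in> d ` tens r UNIV"
    using poly.subspace_scale [OF subspace_tens] by blast
qed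

lemma acyclic_mod_0_iff:
  "acyclic_mod V N 0 q \<longleftrightarrow> (\<forall>f\<in>tens_deg r V q. d f = 0 \<longrightarrow> f \<in> d ` tens_deg r V (q - 1))"
  by (auto simp: acyclic_mod_def pow_ideal_0)

text \<open>
Finitely many polynomials have components in finitely many degrees only, and in all higher degrees a
cocycle is the component of a boundary.
\<close>

lemma acyclic_above:
  assumes "finite_cohomology"
  obtains P where "\<And>q. q > P \<Longrightarrow> acyclic_mod H N 0 q"
proof -
  obtain X where X: "finite X"
    "\<And>z. z \<in> tens r UNIV \<Longrightarrow> d z = 0 \<Longrightarrow> z \<in> poly.span (X \<union> d ` tens r UNIV)"
    using assms by (auto simp: finite_cohomology_def)
  have fin: "finite (\<Union>x\<in>X. {n. part n x \<noteq> 0})" using X finite_part by auto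
  define P where "P = Max (insert 0 (\<Union>x\<in>X. {n. part n x \<noteq> 0}))"
  have P: "part n x = 0" if "x \<in> X" "n > P" for x n
  proof (rule ccontr)
    assume "part n x \<noteq> 0"
    then have "n \<le> P" unfolding P_def using that fin by (intro Max_ge) auto
    with that show False by simp
  qed
  have "acyclic_mod H N 0 q" if q: "q > P" for q
    unfolding acyclic_mod_0_iff
  proof (intro ballI impI)
    fix z assume z: "z \<in> tens_deg r H q" "d z = 0"
    then have "z \<in> poly.span (X \<union> d ` tens r UNIV)" using X tens_deg_subset_tens by blast
    then obtain g b where g: "z = g + b" "g \<in> poly.span X" "b \<in> d ` tens r UNIV"
      by (auto simp: poly.span_Un poly.span_eq_iff [THEN iffD2, OF subspace_boundaries])
    then obtain w where w: "b = d w" "w \<in> tens r UNIV" by blast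
    have "part q g = 0" using g(2)
    proof (induction rule: poly.span_induct)
      case base
      show "poly.subspace {g. part q g = 0}"
        by (simp add: poly.subspace_def additive.zero [OF additive_part] additive.add [OF additive_part] part_kscale)
    qed (use P q in auto)
    moreover have "z = part q z" using part_tens_deg [OF z(1), of q] by simp
    ultimately have "z = part q (d w)" unfolding g(1) w(1) by (simp add: additive.add [OF additive_part])
    also have "\<dots> = d (part (q - 1) w)" using part_d [of "q - 1" w] by simp
    finally show "z \<in> d ` tens_deg r H (q - 1)" using part_in_tens_deg [OF w(2)] by blast
  qed
  then show ?thesis by (rule that)
qed

text \<open>
$d(\tilde H) + (t_0, \dots, t_{n-1}) \tilde H$.
\<close>

definition boundaries_mod :: "nat \<Rightarrow> (mono \<Rightarrow>\<^sub>0 'h) set" where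
  "boundaries_mod n = {d w + j | w j. w \<in> tens r UNIV \<and> j \<in> tens r UNIV \<and> j \<in> pow_ideal 1 n}"

lemma boundaries_mod_Suc: "boundaries_mod n \<subseteq> boundaries_mod (Suc n)"
proof
  fix f assume "f \<in> boundaries_mod n"
  then obtain w j where "f = d w + j" "w \<in> tens r UNIV" "j \<in> tens r UNIV" "j \<in> pow_ideal 1 n"
    by (auto simp: boundaries_mod_def)
  moreover from this(4) have "j \<in> pow_ideal 1 (Suc n)" by (rule pow_ideal_mono) simp
  ultimately show "f \<in> boundaries_mod (Suc n)" unfolding boundaries_mod_def by blast
qed

lemma pow_ideal_kscale: "f \<in> pow_ideal N n \<Longrightarrow> kscale s a f \<in> pow_ideal N n"
  by (simp add: pow_ideal_def coef_kscale vector_space_axioms)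

lemma subspace_boundaries_mod: "poly.subspace (boundaries_mod n)"
proof -
  have j: "poly.subspace (tens r UNIV \<inter> pow_ideal 1 n)"
    by (intro poly.subspace_inter subspace_tens)
       (auto simp: poly.subspace_def intro: pow_ideal_add pow_ideal_kscale)
  have "boundaries_mod n = {x + y | x y. x \<in> d ` tens r UNIV \<and> y \<in> tens r UNIV \<inter> pow_ideal 1 n}"
    by (auto simp: boundaries_mod_def)
  then show ?thesis using poly.subspace_sums [OF subspace_boundaries j] by simp
qed

text \<open>
The cohomology of $\tilde H / (t_0, \dots, t_{n-1}) \tilde H$ is finite-dimensional, by induction along the
long exact sequences of multiplication by $t_n$.  The relation \<open>T\<close> is the connecting homomorphism.
\<close>

lemma finite_cocycles_mod:
  assumes "finite_cohomology"
  shows "n \<le> r \<Longrightarrow> \<exists>X. finite X \<and>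
    {f \<in> tens r UNIV. d f \<in> pow_ideal 1 n} \<subseteq> poly.span (X \<union> boundaries_mod n)"
proof (induction n)
  case 0
  have "boundaries_mod 0 = d ` tens r UNIV"
    using poly.subspace_0 [OF subspace_tens] by (auto simp: boundaries_mod_def pow_ideal_0)
  then show ?case using assms by (auto simp: finite_cohomology_def pow_ideal_0 subset_iff)
next
  case (Suc n)
  let ?A = "\<lambda>n. {f \<in> tens r UNIV. d f \<in> pow_ideal 1 n}"
  let ?u = "shift (tpow n 1)"
  have n: "n < r" using Suc.prems by simp
  obtain X where X: "finite X" "?A n \<subseteq> poly.span (X \<union> boundaries_mod n)" using Suc by auto
  have A: "poly.subspace (?A (Suc n))"
    using subspace_tens
    by (auto simp: poly.subspace_def d_add d_kscale intro: pow_ideal_add pow_ideal_kscale)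
  have uy: "?u f \<in> tens r UNIV \<longleftrightarrow> f \<in> tens r UNIV" for f
    using tpow_in_monomials [OF n, of 1] by (auto simp: tens_UNIV_iff keys_shift monomials_add_iff)
  define T where "T f y \<longleftrightarrow> y \<in> tens r UNIV \<and> d f - ?u y \<in> pow_ideal 1 n" for f y
  show ?case
  proof (rule poly.finite_mod_extension [OF A subspace_boundaries_mod [of n] X(1), where T = T])
    fix f assume f: "f \<in> ?A (Suc n)"
    then obtain y where y: "d f - ?u y \<in> pow_ideal 1 n" "\<And>m. coef y m = coef (d f) (tpow n 1 + m)"
      using pow_ideal_Suc_decomp [of "d f" 1 n] by auto
    have "Poly_Mapping.keys y \<subseteq> monomials r"
    proof
      fix m assume "m \<in> Poly_Mapping.keys y"
      then have "tpow n 1 + m \<in> Poly_Mapping.keys (d f)" by (simp add: in_keys_iff y)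
      then show "m \<in> monomials r" using tens_d f by (force simp: tens_UNIV_iff monomials_add_iff)
    qed
    then have yt: "y \<in> tens r UNIV" by (simp add: tens_UNIV_iff)
    have "?u (d y) = - d (d f - ?u y)" by (simp add: d_diff lift_shift)
    also have "\<dots> \<in> pow_ideal 1 n"
      using pow_ideal_diff [OF zero_in_pow_ideal pow_ideal_lift [OF y(1)]] by simp
    finally have "d y \<in> pow_ideal 1 n" by (simp only: shift_tpow_in_pow_ideal_iff)
    with yt have "y \<in> poly.span (X \<union> boundaries_mod n)" using X(2) by blast
    with yt y show "\<exists>y. T f y \<and> y \<in> poly.span (X \<union> boundaries_mod n)" by (auto simp: T_def)
  next
    fix f y f' y' assume T: "T f y" "T f' y'"
    have "d (f + f') - ?u (y + y') = (d f - ?u y) + (d f' - ?u y')" by (simp add: d_add shift_add)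
    with T show "T (f + f') (y + y')"
      unfolding T_def by (metis pow_ideal_add poly.subspace_add subspace_tens)
  next
    fix a f y assume T: "T f y"
    have "d (kscale s a f) - ?u (kscale s a y) = kscale s a (d f - ?u y)"
      by (simp add: d_kscale shift_kscale vector_space_axioms poly.scale_right_diff_distrib)
    with T show "T (kscale s a f) (kscale s a y)"
      unfolding T_def by (metis pow_ideal_kscale poly.subspace_scale subspace_tens)
  next
    fix f y assume f: "f \<in> ?A (Suc n)" and T: "T f y" and "y \<in> boundaries_mod n"
    then obtain w j where w: "y = d w + j" "w \<in> tens r UNIV" "j \<in> pow_ideal 1 n"
      by (auto simp: boundaries_mod_def)
    have "d (f - ?u w) = (d f - ?u y) + ?u j"
      by (simp add: d_diff lift_shift w shift_add)
    also have "\<dots> \<in> pow_ideal 1 n" using T w by (intro pow_ideal_add pow_ideal_shift) (auto simp: T_def)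
    finally have "d (f - ?u w) \<in> pow_ideal 1 n" .
    moreover have "?u w \<in> tens r UNIV" using w(2) uy by blast
    with f have "f - ?u w \<in> tens r UNIV" by (blast intro: poly.subspace_diff [OF subspace_tens])
    ultimately have "f - ?u w \<in> ?A n" by blast
    then have "f - ?u w \<in> poly.span (X \<union> boundaries_mod n)" using X(2) by blast
    also have "\<dots> \<subseteq> poly.span (X \<union> boundaries_mod (Suc n))"
      using boundaries_mod_Suc [of n] by (intro poly.span_mono) blast
    finally have 1: "f - ?u w \<in> poly.span (X \<union> boundaries_mod (Suc n))" .
    have "?u w = d 0 + ?u w" by simp
    moreover have "(0 :: mono \<Rightarrow>\<^sub>0 'h) \<in> tens r UNIV" by (rule poly.subspace_0 [OF subspace_tens])
    ultimately have "?u w \<in> boundaries_mod (Suc n)"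
      unfolding boundaries_mod_def using \<open>?u w \<in> tens r UNIV\<close> shift_tpow_in_pow_ideal [of n 1 w] by blast
    then have "?u w \<in> poly.span (X \<union> boundaries_mod (Suc n))" by (auto intro: poly.span_base)
    from poly.span_add [OF 1 this] show "f \<in> poly.span (X \<union> boundaries_mod (Suc n))" by simp
  qed (rule X)
qed

text \<open>
Modulo all variables every generator is a cocycle and no nonzero generator is a boundary, so that
$H$ itself is the cohomology.
\<close>

theorem finite_dimensional_generators:
  assumes "finite_cohomology"
  obtains X where "finite X" "span X = UNIV"
proof -
  obtain X where X: "finite X"
    "{f \<in> tens r UNIV. d f \<in> pow_ideal 1 r} \<subseteq> poly.span (X \<union> boundaries_mod r)"
    using finite_cocycles_mod [OF assms, of r] by auto
  let ?e = "\<lambda>f. coef f 0"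
  have "x \<in> span (?e ` X)" for x
  proof -
    have "coef (D x) m = 0" if "\<forall>i<r. coef m i < 1" for m
    proof (cases "m \<in> monomials r")
      case True
      then have "m = 0" using that by (intro poly_mapping_eqI) (metis in_monomials_iff leI less_one lookup_zero)
      then show ?thesis by (simp add: D_minimal)
    next
      case False
      then show ?thesis using D_monomials [of x] by (auto simp: in_keys_iff)
    qed
    then have "emb x \<in> {f \<in> tens r UNIV. d f \<in> pow_ideal 1 r}"
      by (auto simp: d_emb pow_ideal_def tens_UNIV_iff in_keys_iff coef_emb split: if_splits)
    then have "emb x \<in> poly.span (X \<union> boundaries_mod r)" using X by blast
    then have "?e (emb x) \<in> span (?e ` X)"
    proof (induction rule: poly.span_induct)
      case base
      show "poly.subspace {f. ?e f \<in> span (?e ` X)}"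
        by (auto simp: poly.subspace_def lookup_add coef_kscale vector_space_axioms
            intro: span_zero span_add span_scale)
    next
      case (step f)
      then consider "f \<in> X" | "f \<in> boundaries_mod r" by blast
      then show ?case
      proof cases
        case 1
        then show ?thesis by (auto intro: span_base)
      next
        case 2
        have "coef (d w) 0 = 0" for w
          by (simp add: coef_lift_0 D_additive D_minimal)
        with 2 have "?e f = 0" by (auto simp: boundaries_mod_def lookup_add pow_ideal_def)
        then show ?thesis by (simp add: span_zero)
      qed
    qed
    then show ?thesis by (simp add: coef_emb)
  qed
  then show ?thesis using that [of "?e ` X"] X by auto
qed

end

section \<open>The length of the filtration and the degrees of the cohomology\<close>

context minimal_complex begin

lemma graded_induct:
  assumes W: "subspace W" and H: "\<And>q. H q \<subseteq> W" shows "W = UNIV"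
proof -
  have "x \<in> W" for x
  proof -
    have "(\<Sum>q\<in>Poly_Mapping.keys (homog_parts x). component q x) \<in> W"
      using H component_H by (intro subspace_sum W) blast
    then show ?thesis using sum_component [of "Poly_Mapping.keys (homog_parts x)" x] by simp
  qed
  then show ?thesis by blast
qed

lemma finite_support:
  assumes X: "finite X" "span X = UNIV"
  shows "finite {q. H q \<noteq> {0}}"
proof (rule finite_subset)
  show "{q. H q \<noteq> {0}} \<subseteq> (\<Union>x\<in>X. {q. component q x \<noteq> 0})"
  proof (rule ccontr)
    assume "\<not> {q. H q \<noteq> {0}} \<subseteq> (\<Union>x\<in>X. {q. component q x \<noteq> 0})"
    then obtain q where q: "H q \<noteq> {0}" "\<And>x. x \<in> X \<Longrightarrow> component q x = 0" by blast
    have "subspace {x. component q x = 0}"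
      by (simp add: subspace_def additive.zero [OF additive_component] component_add component_scale)
    then have "span X \<subseteq> {x. component q x = 0}" using q(2) by (intro span_minimal) auto
    then have "component q x = 0" for x using X by blast
    then have "H q \<subseteq> {0}" using component_of_H [of _ q q] by auto
    then show False using q(1) subspace_0 [OF subspace_H [of q]] by blast
  qed
  show "finite (\<Union>x\<in>X. {q. component q x \<noteq> 0})"
    using X finite_component by blast
qed

lemma dim_graded:
  assumes X: "finite X" "span X = UNIV"
  shows "dim UNIV = (\<Sum>q | H q \<noteq> {0}. dim (H q))"
proof -
  let ?Q = "{q. H q \<noteq> {0}}"
  have "\<exists>B. B \<subseteq> H q \<and> independent B \<and> H q \<subseteq> span B \<and> card B = dim (H q)" for q
    using basis_exists [of "H q"] by metis
  then obtain B where B: "\<And>q. B q \<subseteq> H q" "\<And>q. independent (B q)" "\<And>q. H q \<subseteq> span (B q)"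
    "\<And>q. card (B q) = dim (H q)" by metis
  have finB: "finite (B q)" for q
    using independent_span_bound [OF X(1) B(2)] X(2) by auto
  let ?B = "\<Union>q\<in>?Q. B q"
  have fin: "finite ?B" using finite_support [OF X] finB by blast
  have disj: "v \<notin> B q" if "v \<in> B p" "p \<noteq> q" for v p q
  proof
    assume "v \<in> B q"
    then have "v \<in> H p" "v \<in> H q" using that(1) B(1) by blast+
    then have "v = 0"
      using component_of_H [of v p p] component_of_H [of v q p] that(2) by simp
    then show False using B(2) [of p] that(1) dependent_zero [of "B p"] by simp
  qed
  have "independent ?B"
  proof
    assume "dependent ?B"
    then obtain u v where u: "v \<in> ?B" "u v \<noteq> 0" "(\<Sum>w\<in>?B. s (u w) w) = 0"
      unfolding dependent_finite [OF fin] by blast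
    then obtain q where q: "v \<in> B q" "q \<in> ?Q" by blast
    have "0 = component q (\<Sum>w\<in>?B. s (u w) w)"
      by (simp add: u additive.zero [OF additive_component])
    also have "\<dots> = (\<Sum>w\<in>?B. s (u w) (component q w))"
      by (simp add: additive.sum [OF additive_component] component_scale)
    also have "\<dots> = (\<Sum>w\<in>B q. s (u w) (component q w))"
    proof (rule sum.mono_neutral_right [OF fin])
      show "B q \<subseteq> ?B" using q by blast
      show "\<forall>w\<in>?B - B q. s (u w) (component q w) = 0"
      proof
        fix w assume "w \<in> ?B - B q"
        then obtain p where "w \<in> B p" "p \<noteq> q" by blast
        then have "component q w = 0" using B(1) [of p] component_of_H [of w p q] by auto
        then show "s (u w) (component q w) = 0" by simp
      qed
    qed
    also have "\<dots> = (\<Sum>w\<in>B q. s (u w) w)"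
    proof (rule sum.cong [OF refl])
      fix w assume "w \<in> B q"
      then have "component q w = w" using B(1) [of q] component_of_H [of w q q] by auto
      then show "s (u w) (component q w) = s (u w) w" by simp
    qed
    finally have "dependent (B q)"
      unfolding dependent_finite [OF finB] using q u(2) by (intro exI [of _ u]) auto
    then show False using B(2) by blast
  qed
  moreover have span_B: "H q \<subseteq> span ?B" for q
  proof (cases "q \<in> ?Q")
    case True
    then have "span (B q) \<subseteq> span ?B" by (intro span_mono) blast
    then show ?thesis using B(3) by blast
  next
    case False
    then show ?thesis by (simp add: span_zero)
  qed
  have "span ?B = UNIV" by (rule graded_induct [OF subspace_span span_B])
  ultimately have "dim UNIV = card ?B"
    using dim_eq_card [of ?B UNIV] by simp
  also have "\<dots> = (\<Sum>q\<in>?Q. card (B q))"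
    by (rule card_UN_disjoint) (use finite_support [OF X] finB disj in auto)
  finally show ?thesis by (simp add: B(4))
qed

lemma finite_support_cohomology: "finite_cohomology \<Longrightarrow> finite {q. H q \<noteq> {0}}"
  using finite_support finite_dimensional_generators by metis

lemma filt_lam_length:
  assumes "finite_cohomology"
  shows "filt r d (\<Sum>q | H q \<noteq> {0}. lam_length r s d (H q)) = UNIV"
proof (rule graded_induct [OF subspace_filt])
  fix q
  note fin = finite_support_cohomology [OF assms]
  have "H q \<subseteq> filt r d (\<Sum>p | H p \<noteq> {0} \<and> p \<le> q. lam_length r s d (H p))"
    by (rule H_subset_filt [OF fin]) (auto intro: lam_power_eq_0D [OF lam_power_lam_length])
  moreover have "(\<Sum>p | H p \<noteq> {0} \<and> p \<le> q. lam_length r s d (H p))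
      \<le> (\<Sum>p | H p \<noteq> {0}. lam_length r s d (H p))"
    by (rule sum_mono2 [OF fin]) auto
  ultimately show "H q \<subseteq> filt r d (\<Sum>q | H q \<noteq> {0}. lam_length r s d (H q))"
    using filt_mono by blast
qed

lemma filt_UNIV_Suc: "filt r d n = UNIV \<Longrightarrow> filt r d (Suc n) = UNIV"
  using filt_mono_Suc [of n] by blast

theorem filt_length_le:
  assumes "finite_cohomology"
  shows "filt_length r d \<le> Sum_any (\<lambda>q. lam_length r s d (H q))"
proof -
  have "filt_length r d \<le> (\<Sum>q | H q \<noteq> {0}. lam_length r s d (H q))"
    unfolding filt_length_def
    by (rule Least_le) (simp only: filt_lam_length [OF assms] filt_UNIV_Suc)
  also have "\<dots> = Sum_any (\<lambda>q. lam_length r s d (H q))"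
  proof (rule Sum_any.expand_superset [symmetric, OF finite_support_cohomology [OF assms]])
    show "{a. lam_length r s d (H a) \<noteq> 0} \<subseteq> {q. H q \<noteq> {0}}"
      using lam_length_0 by auto
  qed
  finally show ?thesis .
qed

lemma ex_lowest_cocycle:
  assumes fin: "finite {q. H q \<noteq> {0}}" and x0: "(x0 :: 'h) \<noteq> 0"
  obtains x q0 where "x \<in> H q0" "x \<noteq> 0" "D x = 0" "\<forall>q<q0. H q = {0}"
proof -
  have ne: "{q. H q \<noteq> {0}} \<noteq> {}"
  proof
    assume "{q. H q \<noteq> {0}} = {}"
    then have "{0} = (UNIV :: 'h set)" by (intro graded_induct subspace_single_0) blast
    then show False using x0 by blast
  qed
  define q0 where "q0 = Min {q. H q \<noteq> {0}}"
  have q0: "H q0 \<noteq> {0}" using Min_in [OF fin ne] by (simp add: q0_def)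
  have low: "H q = {0}" if "q < q0" for q
  proof (rule ccontr)
    assume "H q \<noteq> {0}"
    then have "q0 \<le> q" unfolding q0_def by (intro Min_le fin) simp
    with that show False by simp
  qed
  show ?thesis by (rule ex_constant_cocycle [OF low q0]) (use that low in blast)+
qed

text \<open>
Each step of the filtration is determined by the preceding one.
\<close>

lemma filt_stable:
  assumes "filt r d n = filt r d (Suc n)"
  shows "n \<le> k \<Longrightarrow> filt r d k = filt r d n"
proof (induction k rule: dec_induct)
  case (step k)
  have "filt r d (Suc k) = filt r d (Suc n)" using step by simp
  also have "\<dots> = filt r d n" by (rule assms [symmetric])
  finally show ?case .
qed simp

lemma tens_eq_imp_eq:
  assumes "tens r V = tens r W" and "0 \<in> V" "0 \<in> W"
  shows "V = (W :: 'h set)"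
proof -
  have "x \<in> V \<longleftrightarrow> emb x \<in> tens r V" if "0 \<in> V" for x :: 'h and V
    using that by (auto simp: tens_def coef_emb in_keys_iff split: if_splits)
  with assms show ?thesis by blast
qed

text \<open>
Once the filtration stops growing it is everything, since it becomes everything eventually.
\<close>

theorem filt_length_ge:
  assumes fc: "finite_cohomology" and x0: "(x0 :: 'h) \<noteq> 0"
  shows "r + 1 \<le> filt_length r d"
proof (rule ccontr)
  assume "\<not> r + 1 \<le> filt_length r d"
  then have L: "filt_length r d \<le> r" by simp
  define M where "M = (\<Sum>q | H q \<noteq> {0}. lam_length r s d (H q))"
  have M: "filt r d M = UNIV" unfolding M_def by (rule filt_lam_length [OF fc])
  have "tens r (filt r d (filt_length r d)) = tens r (filt r d (Suc (filt_length r d)))"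
    unfolding filt_length_def by (rule LeastI [of _ M]) (simp only: M filt_UNIV_Suc)
  then have "filt r d (filt_length r d) = filt r d (Suc (filt_length r d))"
    by (rule tens_eq_imp_eq) (rule subspace_0 [OF subspace_filt])+
  from filt_stable [OF this, of "max (filt_length r d) M"]
  have "filt r d (filt_length r d) = UNIV"
    using M filt_mono [of M "max (filt_length r d) M"] by auto
  then have full: "filt r d r = UNIV" using filt_mono [OF L] by auto
  obtain q0 x where x: "x \<in> H q0" "x \<noteq> 0" "D x = 0"
    using ex_lowest_cocycle [OF finite_support_cohomology [OF fc] x0] by blast
  obtain P where P: "\<And>q. q > P \<Longrightarrow> acyclic_mod H 1 0 q" using acyclic_above [OF fc] by blast
  have "\<exists>q. \<not> H q \<subseteq> filt r d r"
    by (rule filt_not_exhausted [OF subcomplex_H P x(1,3,2)])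
  then show False using full by simp
qed

text \<open>
The subcomplex $V = H^{\le p}$ belongs to the longest interval of degrees $q_0, \dots, p$ in the support
of the cohomology that starts at the lowest degree $q_0$ of \<open>H\<close>.
\<close>

theorem cohomology_degrees_ge:
  assumes fc: "finite_cohomology" and x0: "(x0 :: 'h) \<noteq> 0"
    and lam0: "\<And>i x. i < r \<Longrightarrow> lam d i x = 0"
  shows "r + 1 \<le> card {q. \<not> acyclic_mod H 1 0 q}"
proof -
  let ?S = "{q. \<not> acyclic_mod H 1 0 q}"
  note fin = finite_support_cohomology [OF fc]
  obtain x q0 where x: "x \<in> H q0" "x \<noteq> 0" "D x = 0" and "\<forall>q<q0. H q = {0}"
    using ex_lowest_cocycle [OF fin x0] by metis
  then have low: "H q = {0}" if "q < q0" for q using that by blast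
  obtain P where P: "\<And>q. q > P \<Longrightarrow> acyclic_mod H 1 0 q" using acyclic_above [OF fc] by blast
  have "q0 \<le> q \<and> q \<le> P" if "q \<in> ?S" for q
  proof (rule ccontr)
    assume *: "\<not> (q0 \<le> q \<and> q \<le> P)"
    have "acyclic_mod H 1 0 q" if q: "q < q0"
      unfolding acyclic_mod_0_iff
    proof (intro ballI impI)
      fix f assume f: "f \<in> tens_deg r H q"
      have "coef f m = 0" for m
        using f low [of "q - int (mdeg m)"] q by (auto simp: tens_deg_iff)
      then have "f = d 0" by (simp add: poly_mapping_eqI)
      then show "f \<in> d ` tens_deg r H (q - 1)" using tens_deg_zero [OF subcomplex_H] by blast
    qed
    with P that * show False by force
  qed
  then have S: "?S \<subseteq> {q0..P}" by auto
  then have finS: "finite ?S" by (rule finite_subset) simp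
  have q0S: "q0 \<in> ?S"
  proof -
    have "emb x \<notin> d ` tens_deg r H (q0 - 1)"
    proof
      assume "emb x \<in> d ` tens_deg r H (q0 - 1)"
      then obtain w where w: "w \<in> tens_deg r H (q0 - 1)" "emb x = d w" by blast
      have "coef w m = 0" for m
        using w(1) low [of "q0 - 1 - int (mdeg m)"] by (auto simp: tens_deg_iff)
      then have "w = 0" by (simp add: poly_mapping_eqI)
      then have "coef (emb x) 0 = 0" using w by simp
      then show False using x by (simp add: coef_emb)
    qed
    moreover have "d (emb x) = 0" using x(3) by (simp add: d_emb)
    ultimately show ?thesis
      using emb_tens_deg [OF subcomplex_H x(1)] unfolding acyclic_mod_0_iff by blast
  qed
  \<comment> \<open>The interval has $n$ elements; it is nonempty because $x$ is a cocycle that is no boundary.\<close>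
  define n where "n = (LEAST n. q0 + int n \<notin> ?S)"
  have "q0 + int (nat (P - q0) + 1) \<notin> ?S" using S by auto
  then have n: "q0 + int n \<notin> ?S" unfolding n_def by (rule LeastI)
  have below: "q0 + int i \<in> ?S" if "i < n" for i
    using not_less_Least [of i "\<lambda>n. q0 + int n \<notin> ?S"] that by (auto simp: n_def)
  define p where "p = q0 + int n - 1"
  have "n \<noteq> 0" using n q0S by (cases n) auto
  then have q0p: "q0 \<le> p" by (simp add: p_def)
  define V where "V q = (if q \<le> p then H q else {0})" for q
  have V: "subcomplex V"
    unfolding subcomplex_def
  proof (intro conjI allI impI)
    show "subspace (V q)" for q by (simp add: V_def subspace_H subspace_single_0)
    fix q x m assume x: "x \<in> V q"
    show "coef (D x) m \<in> V (q + 1 - int (mdeg m))"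
    proof (cases "m = 0 \<or> q > p")
      case True
      then have "coef (D x) m = 0"
        using x by (auto simp: V_def D_minimal additive.zero [OF D_additive])
      then show ?thesis by (simp add: V_def subspace_0 [OF subspace_H])
    next
      case False
      then have "mdeg m \<ge> 1" using mdeg_eq_0_iff [of m] by linarith
      then show ?thesis using False x D_deg [of x q m] by (auto simp: V_def)
    qed
  qed
  \<comment> \<open>The two complexes agree in degree \<open>p\<close>, which is all that matters for the cohomology in degree \<open>p + 1\<close>.\<close>
  have VH: "tens_deg r V q \<subseteq> tens_deg r H q" for q
    using subspace_0 [OF subspace_H] by (auto simp: tens_deg_iff V_def split: if_splits) (metis singletonD)
  have HV: "tens_deg r H q \<subseteq> tens_deg r V q" if "q \<le> p" for q
    using that by (auto simp: tens_deg_iff V_def)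
  have "acyclic_mod H 1 0 (p + 1)" using n by (simp add: p_def)
  moreover have "tens_deg r H (p + 1 - 1) \<subseteq> tens_deg r V (p + 1 - 1)" by (rule HV) simp
  ultimately have A0: "acyclic_mod V 1 0 (p + 1)"
    using VH [of "p + 1"] unfolding acyclic_mod_0_iff by blast
  have A: "acyclic_mod V 1 0 q" if "q > p" for q
    by (rule acyclic_above_generators [OF V _ A0 that]) (simp add: V_def)
  have "x \<in> V q0" using x q0p by (simp add: V_def)
  from filt_not_exhausted [OF V A this x(3,2)]
  obtain q where q: "\<not> V q \<subseteq> filt r d r" by blast
  have "q \<le> p"
  proof (rule ccontr)
    assume "\<not> q \<le> p"
    then show False using q subspace_0 [OF subspace_filt] by (simp add: V_def)
  qed
  have "H q \<subseteq> filt r d (\<Sum>p | H p \<noteq> {0} \<and> p \<le> q. 1)"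
  proof (rule H_subset_filt [OF fin])
    fix q x js assume "set js \<subseteq> {..<r}" "length js = (1 :: nat)"
    then obtain i where "js = [i]" "i < r" by (cases js) auto
    then show "foldr (lam d) js x = 0" by (simp add: lam0)
  qed
  moreover have "(\<Sum>p | H p \<noteq> {0} \<and> p \<le> q. 1) \<le> n"
  proof -
    have "{p. H p \<noteq> {0} \<and> p \<le> q} \<subseteq> {q0..p}"
    proof
      fix p' assume "p' \<in> {p. H p \<noteq> {0} \<and> p \<le> q}"
      then have "\<not> p' < q0" "p' \<le> q" using low by blast+
      then show "p' \<in> {q0..p}" using \<open>q \<le> p\<close> by simp
    qed
    then have "card {p. H p \<noteq> {0} \<and> p \<le> q} \<le> card {q0..p}" by (intro card_mono) auto
    then show ?thesis by (simp add: p_def)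
  qed
  ultimately have "H q \<subseteq> filt r d n" using filt_mono by blast
  moreover have "V q = H q" using \<open>q \<le> p\<close> by (simp add: V_def)
  ultimately have "n > r" using q filt_mono [of n r] by (metis leI subset_trans)
  moreover have "(\<lambda>i. q0 + int i) ` {..<n} \<subseteq> ?S" using below by auto
  then have "card ((\<lambda>i. q0 + int i) ` {..<n}) \<le> card ?S" by (intro card_mono finS)
  then have "n \<le> card ?S" by (simp add: card_image inj_on_def)
  ultimately show ?thesis by simp
qed

end

section \<open>A nonsingular system of power equations\<close>

text \<open>
The cofactors along the last column do not depend on the entries \<open>w\<close> of that column, so the determinant
is linear in it.
\<close>

lemma det_bordered_expansion:
  fixes G :: "nat \<Rightarrow> nat \<Rightarrow> 'a::idom"
  defines "A \<equiv> \<lambda>n w. mat (Suc n) (Suc n) (\<lambda>(i, j). if j < n then G i j else w i)"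
  obtains C where "\<And>w. det (A n w) = (\<Sum>i<Suc n. w i * C i)"
    and "C n = det (mat n n (\<lambda>(i, j). G i j))"
proof -
  define C where "C i = cofactor (A n (\<lambda>_. 0)) i n" for i
  have C: "cofactor (A n w) i n = C i" for w i
  proof -
    have "mat_delete (A n w) i n = mat_delete (A n (\<lambda>_. 0)) i n"
      by (rule eq_matI) (auto simp: mat_delete_def A_def)
    then show ?thesis by (simp add: C_def cofactor_def)
  qed
  have "det (A n w) = (\<Sum>i<Suc n. w i * C i)" for w
  proof -
    have "det (A n w) = (\<Sum>i<Suc n. A n w $$ (i, n) * cofactor (A n w) i n)"
      by (rule laplace_expansion_column) (auto simp: A_def)
    also have "\<dots> = (\<Sum>i<Suc n. w i * C i)"
    proof (rule sum.cong [OF refl])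
      fix i assume "i \<in> {..<Suc n}"
      then have "A n w $$ (i, n) = w i" by (simp add: A_def)
      then show "A n w $$ (i, n) * cofactor (A n w) i n = w i * C i" by (simp only: C)
    qed
    finally show ?thesis .
  qed
  moreover have "mat_delete (A n (\<lambda>_. 0)) n n = mat n n (\<lambda>(i, j). G i j)"
    by (rule eq_matI) (auto simp: mat_delete_def A_def)
  then have "C n = det (mat n n (\<lambda>(i, j). G i j))"
    by (simp add: C_def cofactor_def)
  ultimately show ?thesis by (rule that)
qed

abbreviation tvar :: "nat \<Rightarrow> nat \<Rightarrow> (mono \<Rightarrow>\<^sub>0 'k::field)" where
  "tvar i n \<equiv> Poly_Mapping.single (tpow i n) 1"

text \<open>
Put the vector $(t_i^N)_i$ into column \<open>n\<close>, next to the columns $0, \dots, n - 1$ of \<open>G\<close>.  By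
hypothesis it is $\sum_j t_j G_{\cdot j}$, and the terms with $j < n$ give determinants with two equal
columns.  Compare the coefficients of $(t_0 \cdots t_{n-1})^{N-1} t_n^N$: in the expansion along the
last column, which has the entries $t_i^N$, only $i = n$ contributes; on the other side,
only $j = n$ does, since no variable with index above \<open>n\<close> occurs in the monomial.  So the
coefficient passes unchanged from the leading minor of size \<open>n\<close> to that of size $n + 1$.
\<close>

lemma coef_det_power_system:
  fixes G :: "nat \<Rightarrow> nat \<Rightarrow> (mono \<Rightarrow>\<^sub>0 'k::field)"
  assumes N: "N \<ge> 1" and G: "\<And>i. i < r \<Longrightarrow> (\<Sum>j<r. tvar j 1 * G i j) = tvar i N"
  shows "n \<le> r \<Longrightarrow> coef (det (mat n n (\<lambda>(i, j). G i j))) (staircase N n) = 1"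
proof (induction n)
  case 0
  then show ?case by (simp add: staircase_def lookup_one)
next
  case (Suc n)
  let ?A = "\<lambda>w. mat (Suc n) (Suc n) (\<lambda>(i, j). if j < n then G i j else w i)"
  let ?\<mu> = "tpow n N + staircase N n"
  obtain C where C: "\<And>w. det (?A w) = (\<Sum>i<Suc n. w i * C i)"
    "C n = det (mat n n (\<lambda>(i, j). G i j))"
    by (rule det_bordered_expansion [of n G]) blast
  have "(\<Sum>i<Suc n. tvar i N * C i) = (\<Sum>i<Suc n. (\<Sum>j<r. tvar j 1 * G i j) * C i)"
  proof (rule sum.cong [OF refl])
    fix i assume "i \<in> {..<Suc n}"
    then have "i < r" using Suc.prems by simp
    from G [OF this] show "tvar i N * C i = (\<Sum>j<r. tvar j 1 * G i j) * C i" by (simp only:)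
  qed
  also have "\<dots> = (\<Sum>j<r. tvar j 1 * (\<Sum>i<Suc n. G i j * C i))"
    unfolding sum_distrib_right sum_distrib_left by (subst sum.swap) (simp add: mult.assoc)
  also have "\<dots> = (\<Sum>j<r. tvar j 1 * det (?A (\<lambda>i. G i j)))"
    by (simp only: C)
  finally have "(\<Sum>i<Suc n. coef (shift (tpow i N) (C i)) ?\<mu>)
      = (\<Sum>j<r. coef (shift (tpow j 1) (det (?A (\<lambda>i. G i j)))) ?\<mu>)"
    unfolding shift_times lookup_sum [symmetric] by (rule arg_cong)
  moreover have "(\<Sum>i<Suc n. coef (shift (tpow i N) (C i)) ?\<mu>)
      = coef (shift (tpow n N) (C n)) ?\<mu>"
  proof -
    have "coef (shift (tpow i N) (C i)) ?\<mu> = 0" if "i < n" for i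
    proof (rule coef_shift_other)
      fix k show "?\<mu> \<noteq> tpow i N + k"
      proof
        assume "?\<mu> = tpow i N + k"
        then have "coef ?\<mu> i \<ge> N" by (simp add: lookup_add)
        then show False using that N by (simp add: lookup_add coef_staircase lookup_single)
      qed
    qed
    then show ?thesis by simp
  qed
  moreover have "coef (shift (tpow n N) (C n)) ?\<mu> = 1"
    using Suc by (simp add: C)
  moreover have "(\<Sum>j<r. coef (shift (tpow j 1) (det (?A (\<lambda>i. G i j)))) ?\<mu>)
      = (\<Sum>j\<in>{n}. coef (shift (tpow j 1) (det (?A (\<lambda>i. G i j)))) ?\<mu>)"
  proof (rule sum.mono_neutral_right)
    show "\<forall>j\<in>{..<r} - {n}. coef (shift (tpow j 1) (det (?A (\<lambda>i. G i j)))) ?\<mu> = 0"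
    proof
      fix j assume "j \<in> {..<r} - {n}"
      then consider "j < n" | "j > n" by force
      then show "coef (shift (tpow j 1) (det (?A (\<lambda>i. G i j)))) ?\<mu> = 0"
      proof cases
        case 1
        have "det (?A (\<lambda>i. G i j)) = 0"
          by (rule det_identical_columns [of _ "Suc n" j n]) (use 1 in \<open>auto intro!: eq_vecI\<close>)
        then show ?thesis by simp
      next
        case 2
        show ?thesis
        proof (rule coef_shift_other)
          fix k show "?\<mu> \<noteq> tpow j 1 + k"
          proof
            assume "?\<mu> = tpow j 1 + k"
            then have "coef ?\<mu> j \<ge> 1" by (simp add: lookup_add)
            then show False using 2 by (simp add: lookup_add coef_staircase lookup_single)
          qed
        qed
      qed
    qed
  qed (use Suc.prems in auto)
  moreover have "?\<mu> = tpow n 1 + staircase N (Suc n)"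
    using N by (intro poly_mapping_eqI) (auto simp: lookup_add coef_staircase lookup_single when_def)
  then have "coef (shift (tpow n 1) (det (?A (\<lambda>i. G i n)))) ?\<mu>
      = coef (det (?A (\<lambda>i. G i n))) (staircase N (Suc n))"
    by (simp only: coef_shift_add)
  moreover have "?A (\<lambda>i. G i n) = mat (Suc n) (Suc n) (\<lambda>(i, j). G i j)"
    by (rule eq_matI) (auto simp: less_Suc_eq)
  ultimately show ?case by simp
qed

lemma power_system_nonsingular:
  fixes G :: "nat \<Rightarrow> nat \<Rightarrow> (mono \<Rightarrow>\<^sub>0 'k::field)"
  assumes N: "N \<ge> 1" and G: "\<And>i. i < r \<Longrightarrow> (\<Sum>j<r. tvar j 1 * G i j) = tvar i N"
    and c: "\<And>j. j < r \<Longrightarrow> (\<Sum>i<r. c i * G i j) = 0"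
  shows "i < r \<Longrightarrow> c i = 0"
proof (rule ccontr)
  assume i: "i < r" "c i \<noteq> 0"
  let ?A = "mat r r (\<lambda>(i, j). G i j)"
  have "vec r c \<noteq> 0\<^sub>v r" using i by (metis index_vec index_zero_vec(1))
  moreover have "transpose_mat ?A *\<^sub>v vec r c = 0\<^sub>v r"
    using c by (intro eq_vecI) (auto simp: scalar_prod_def mult.commute lessThan_atLeast0)
  ultimately have "det (transpose_mat ?A) = 0"
    by (subst det_0_iff_vec_prod_zero [of _ r]) (auto intro!: exI [of _ "vec r c"])
  then have "det ?A = 0" by (simp add: det_transpose [of _ r])
  then show False using coef_det_power_system [OF N G, of r] by simp
qed

text \<open>
Every monomial of a polynomial without constant term is assigned to the first variable that divides it.
\<close>

lemma sum_shift_divide_var: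
  fixes E :: "mono \<Rightarrow>\<^sub>0 'k::ab_group_add"
  assumes E: "Poly_Mapping.keys E \<subseteq> monomials r" "coef E 0 = 0"
  shows "(\<Sum>j<r. shift (tpow j 1) (divide_var {m. \<forall>i<j. coef m i = 0} j E)) = E"
proof (rule poly_mapping_eqI)
  fix l
  let ?t = "\<lambda>j. coef (shift (tpow j 1) (divide_var {m. \<forall>i<j. coef m i = 0} j E)) l"
  have t: "?t j = (if coef l j \<noteq> 0 \<and> (\<forall>i<j. coef l i = 0) then coef E l else 0)" for j
  proof (cases "coef l j = 0")
    case True
    have "?t j = 0"
      by (rule coef_shift_other) (use True in \<open>auto simp: lookup_add\<close>)
    then show ?thesis using True by simp
  next
    case False
    then obtain k where k: "l = tpow j 1 + k"
      using exponent_ge_imp_factor [of 1 l j] by (auto simp: add.commute)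
    have "\<forall>i<j. coef k i = coef l i" by (simp add: k lookup_add lookup_single)
    then show ?thesis using False unfolding k coef_shift_add coef_divide_var by auto
  qed
  show "coef (\<Sum>j<r. shift (tpow j 1) (divide_var {m. \<forall>i<j. coef m i = 0} j E)) l = coef E l"
  proof (cases "coef E l = 0")
    case True
    then have "?t j = 0" for j by (simp only: t if_cancel)
    then show ?thesis unfolding lookup_sum by (simp only: True sum.neutral_const)
  next
    case False
    then have l: "l \<in> monomials r" "l \<noteq> 0" using E by (auto simp: in_keys_iff)
    then obtain i where i: "coef l i \<noteq> 0" by (metis lookup_zero poly_mapping_eqI)
    define j where "j = (LEAST i. coef l i \<noteq> 0)"
    have j: "coef l j \<noteq> 0" unfolding j_def by (rule LeastI [of _ i]) (rule i)
    have below: "coef l i = 0" if "i < j" for i using not_less_Least that unfolding j_def by blast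
    have "j < r" using j l by (metis in_monomials_iff leI)
    have "(\<Sum>j<r. ?t j) = (\<Sum>j'\<in>{j}. ?t j')"
    proof (rule sum.mono_neutral_right)
      show "\<forall>j'\<in>{..<r} - {j}. ?t j' = 0"
      proof
        fix j' assume "j' \<in> {..<r} - {j}"
        then consider "j' < j" | "j < j'" by force
        then show "?t j' = 0" unfolding t using j below by cases auto
      qed
    qed (use \<open>j < r\<close> in auto)
    also have "\<dots> = coef E l" unfolding t using j below by simp
    finally show ?thesis unfolding lookup_sum .
  qed
qed

section \<open>The dimension of the space of generators\<close>

context minimal_complex begin

text \<open>
The generator values of an \<open>R\<close>-linear map to the polynomial ring.
\<close>

definition linear_form :: "('h \<Rightarrow> (mono \<Rightarrow>\<^sub>0 'k)) \<Rightarrow> bool" where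
  "linear_form \<psi> \<longleftrightarrow> additive \<psi> \<and> (\<forall>a x. \<psi> (s a x) = kscale (*) a (\<psi> x))"

lemma linear_form_pact: "linear_form \<psi> \<Longrightarrow> lift \<psi> (pact s p f) = p * lift \<psi> f"
  unfolding linear_form_def pact_times [symmetric]
  by (rule lift_pact) (auto simp: vector_space_axioms vector_space_times)

lemma linear_form_shift: "lift (\<psi> :: 'h \<Rightarrow> (mono \<Rightarrow>\<^sub>0 'k)) (shift m f) = Poly_Mapping.single m 1 * lift \<psi> f"
  by (simp add: lift_shift shift_times)

lemma linear_form_D:
  assumes "linear_form \<psi>" shows "linear_form (\<lambda>x. lift \<psi> (D x))"
  using assms unfolding linear_form_def
  by (auto simp: additive_def additive.add [OF D_additive] lift_add D_scale
      intro!: lift_kscale vector_space_axioms vector_space_times)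

lemma linear_form_functional: "functional \<phi> \<Longrightarrow> linear_form (\<lambda>x. emb (\<phi> x))"
  by (auto simp: functional_def linear_form_def additive_def emb_add poly_mapping_eq_iff fun_eq_iff
      coef_kscale vector_space_times coef_emb)

lemma coef_lift_functional:
  assumes "additive \<phi>" shows "coef (lift (\<lambda>x. emb (\<phi> x)) f) l = \<phi> (coef f l)"
proof -
  have "coef (lift (\<lambda>x. emb (\<phi> x)) f) l
      = (\<Sum>m\<in>Poly_Mapping.keys f. if m = l then \<phi> (coef f m) else 0)"
    unfolding coef_lift shift_emb by (rule sum.cong) (auto simp: lookup_single)
  then show ?thesis by (auto simp: in_keys_iff additive.zero [OF assms])
qed

text \<open>
More than $\dim H$ elements of $H \otimes R$ are linearly dependent over the polynomial ring: their
matrix of coordinates can be filled up with zero rows to a singular square matrix, which has a nonzero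
vector in its kernel because the polynomial ring is an integral domain.  Independence is expressed
through the values of linear forms, as this is how the elements at hand are known.
\<close>

lemma card_independent_le_dim:
  assumes X: "finite X" "span X = UNIV"
    and v: "\<And>p. (\<And>\<psi>. linear_form \<psi> \<Longrightarrow> (\<Sum>i<k. p i * lift \<psi> (v i)) = 0) \<Longrightarrow> \<forall>i<k. p i = 0"
  shows "k \<le> dim UNIV"
proof (rule ccontr)
  assume k: "\<not> k \<le> dim UNIV"
  obtain B where B: "independent B" "UNIV \<subseteq> span B" "card B = dim UNIV"
    using basis_exists [of UNIV] by blast
  then have span_B: "v \<in> span B" for v by blast
  have finB: "finite B" using independent_span_bound [OF X(1) B(1)] X(2) by simp
  then obtain bs where bs: "set bs = B" "distinct bs" using finite_distinct_list by blast
  then have len: "length bs < k" using k B distinct_card [of bs] by simp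
  define \<kappa> where "\<kappa> b x = emb (representation B x b)" for b x
  have repr: "functional (\<lambda>x. representation B x b)" for b
    using B(1) span_B by (simp add: functional_def additive_def representation_add representation_scale)
  then have \<kappa>: "linear_form (\<kappa> b)" for b
    unfolding \<kappa>_def by (rule linear_form_functional)
  define A where "A = mat k k (\<lambda>(i, j). if i < length bs then lift (\<kappa> (bs ! i)) (v j) else 0)"
  have A: "A \<in> carrier_mat k k" by (simp add: A_def)
  have "det A = (\<Sum>j<k. A $$ (k - 1, j) * cofactor A (k - 1) j)"
    by (rule laplace_expansion_row [OF A]) (use len in simp)
  also have "\<dots> = 0"
    by (rule sum.neutral) (use len in \<open>auto simp: A_def\<close>)
  finally obtain p where p: "p \<in> carrier_vec k" "p \<noteq> 0\<^sub>v k" "A *\<^sub>v p = 0\<^sub>v k"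
    using det_0_iff_vec_prod_zero [OF A] by auto
  define f where "f = (\<Sum>j<k. pact s (p $ j) (v j))"
  have lift_f: "lift \<psi> f = (\<Sum>j<k. p $ j * lift \<psi> (v j))" if "linear_form \<psi>" for \<psi>
    using that unfolding f_def
    by (simp add: linear_form_pact lift_sum linear_form_def)
  have "lift (\<kappa> b) f = 0" if "b \<in> B" for b
  proof -
    have "b \<in> set bs" using that bs by simp
    then obtain i where i: "i < length bs" "b = bs ! i" unfolding in_set_conv_nth by blast
    have "(\<Sum>j<k. p $ j * lift (\<kappa> b) (v j)) = (A *\<^sub>v p) $ i"
      using i len p(1) by (simp add: A_def scalar_prod_def mult.commute lessThan_atLeast0)
    also have "\<dots> = 0" using i len by (simp add: p)
    finally show ?thesis by (simp add: lift_f \<kappa>)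
  qed
  then have "representation B (coef f m) b = 0" if "b \<in> B" for b m
    using that coef_lift_functional [of "\<lambda>x. representation B x b" f m] repr [of b]
    unfolding \<kappa>_def by (simp add: functional_def)
  then have "coef f m = 0" for m
    using sum_representation_eq [OF B(1), of "coef f m" B] B(2) finB by auto
  then have "f = 0" by (simp add: poly_mapping_eqI)
  then have "\<forall>j<k. p $ j = 0"
    using lift_f by (intro v) (simp add: lift_def)
  then show False using p by (metis carrier_vecD eq_vecI index_zero_vec)
qed

text \<open>
The independent elements are $u_0 = x$ and $u_i = z_i$ for $1 \le i < r$, together with
$w_0 = y_0$ and $w_i$ with $d w_i = z_i$.  They satisfy $d u_i = 0$ and $d w_i = e_i u_i$ with
$e_0 = t_0^N$ and $e_i = 1$ otherwise.  So a relation between all of them gives, by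
applying $d$, a relation between the $u_i$, and the $w_i$ drop out.
\<close>

theorem dim_ge:
  assumes fc: "finite_cohomology" and x0: "(x0 :: 'h) \<noteq> 0"
  shows "2 * r \<le> dim UNIV"
proof (cases "r = 0")
  case r: False
  obtain X where X: "finite X" "span X = UNIV" using finite_dimensional_generators [OF fc] by blast
  obtain x q0 where x: "x \<in> H q0" "x \<noteq> 0" "D x = 0"
    using ex_lowest_cocycle [OF finite_support_cohomology [OF fc] x0] by blast
  obtain P where P: "\<And>q. q > P \<Longrightarrow> acyclic_mod H 1 0 q" using acyclic_above [OF fc] by blast
  have exact: "\<exists>w\<in>tens_deg r H (q - 1). d w = f" if "q > P" "f \<in> tens_deg r H q" "d f = 0" for q f
    using P [OF that(1)] that(2,3) unfolding acyclic_mod_0_iff by blast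
  define N where "N = Suc (nat (P - q0))"
  have N: "N \<ge> 1" "q0 + int N > P" by (auto simp: N_def)
  obtain \<phi> where \<phi>: "functional \<phi>" "\<phi> x = 1" by (rule ex_functional [OF x(2)])
  then have \<phi>_add: "additive \<phi>" by (simp add: functional_def)
  define \<phi>' where "\<phi>' = (\<lambda>x. emb (\<phi> x))"
  have \<phi>': "linear_form \<phi>'" unfolding \<phi>'_def by (rule linear_form_functional [OF \<phi>(1)])
  define \<beta> where "\<beta> j x = divide_var {m. \<forall>i<j. coef m i = 0} j (lift \<phi>' (D x))" for j x
  have \<beta>: "linear_form (\<beta> j)" for j
    using linear_form_D [OF \<phi>'] unfolding linear_form_def \<beta>_def
    by (auto simp: additive_def divide_var_add divide_var_kscale)
  have \<beta>_d: "(\<Sum>j<r. tvar j 1 * lift (\<beta> j) f) = lift \<phi>' (d f)" for f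
  proof -
    have D: "lift \<phi>' (D y) = (\<Sum>j<r. shift (tpow j 1) (\<beta> j y))" for y
      unfolding \<beta>_def
    proof (rule sum_shift_divide_var [symmetric])
      have coef_\<phi>': "coef (lift \<phi>' (D y)) m = \<phi> (coef (D y) m)" for m
        by (simp add: \<phi>'_def coef_lift_functional [OF \<phi>_add])
      have "Poly_Mapping.keys (lift \<phi>' (D y)) \<subseteq> Poly_Mapping.keys (D y)"
        by (auto simp: coef_\<phi>' in_keys_iff additive.zero [OF \<phi>_add])
      then show "Poly_Mapping.keys (lift \<phi>' (D y)) \<subseteq> monomials r"
        using D_monomials [of y] by blast
      show "coef (lift \<phi>' (D y)) 0 = 0"
        by (simp add: coef_\<phi>' D_minimal additive.zero [OF \<phi>_add])
    qed
    have "lift \<phi>' (d f) = lift (\<lambda>y. lift \<phi>' (D y)) f"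
      using \<phi>' by (simp add: lift_lift D_additive linear_form_def)
    also have "\<dots> = (\<Sum>m\<in>Poly_Mapping.keys f. \<Sum>j<r. shift (m + tpow j 1) (\<beta> j (coef f m)))"
      unfolding lift_def [of _ f] by (simp add: D shift_sum shift_shift)
    also have "\<dots> = (\<Sum>j<r. \<Sum>m\<in>Poly_Mapping.keys f. shift (tpow j 1 + m) (\<beta> j (coef f m)))"
      by (subst sum.swap) (simp only: add.commute)
    also have "\<dots> = (\<Sum>j<r. shift (tpow j 1) (lift (\<beta> j) f))"
      by (simp add: lift_def shift_sum shift_shift)
    finally show ?thesis by (simp add: shift_times)
  qed
  have "\<exists>y\<in>tens_deg r H (q0 + int N - 1). d y = shift (tpow i N) (emb x)" if "i < r" for i
    using tens_deg_shift [OF subcomplex_H tpow_in_monomials [OF that] emb_tens_deg [OF subcomplex_H x(1)], of N]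
    by (intro exact N) (simp_all add: lift_shift d_emb x)
  then obtain y where y: "\<And>i. i < r \<Longrightarrow> y i \<in> tens_deg r H (q0 + int N - 1)"
    "\<And>i. i < r \<Longrightarrow> d (y i) = shift (tpow i N) (emb x)" by metis
  define G where "G i j = lift (\<beta> j) (y i)" for i j
  have G: "(\<Sum>j<r. tvar j 1 * G i j) = tvar i N" if "i < r" for i
  proof -
    have "(\<Sum>j<r. tvar j 1 * G i j) = shift (tpow i N) (lift \<phi>' (emb x))"
      unfolding G_def \<beta>_d y(2) [OF that] by (rule lift_shift)
    also have "lift \<phi>' (emb x) = emb 1"
      using \<phi>' \<phi>(2) by (simp add: lift_emb linear_form_def) (simp add: \<phi>'_def)
    finally show ?thesis by (simp add: shift_emb)
  qed
  define z where "z i = shift (tpow 0 N) (y i) - shift (tpow i N) (y 0)" for i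
  have "\<exists>w. d w = z i" if i: "i < r" for i
  proof -
    have "shift (tpow 0 N) (y i) \<in> tens_deg r H (q0 + int N - 1 + int N)"
      "shift (tpow i N) (y 0) \<in> tens_deg r H (q0 + int N - 1 + int N)"
      using tens_deg_shift [OF subcomplex_H tpow_in_monomials, of _ _ _ N] y i r by fastforce+
    then have "z i \<in> tens_deg r H (q0 + int N - 1 + int N)"
      unfolding z_def by (rule tens_deg_diff [OF subcomplex_H])
    moreover have "d (z i) = 0"
      using y i r by (simp add: z_def d_diff lift_shift shift_shift add.commute)
    moreover have "q0 + int N - 1 + int N > P" using N by linarith
    ultimately show ?thesis using exact by blast
  qed
  then obtain w' where w': "\<And>i. i < r \<Longrightarrow> d (w' i) = z i" by metis
  define u where "u i = (if i = 0 then emb x else z i)" for i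
  define w where "w i = (if i = 0 then y 0 else w' i)" for i
  define e where "e i = (if i = 0 then tvar 0 N else (1 :: mono \<Rightarrow>\<^sub>0 'k))" for i :: nat
  have tvar_nz: "tvar i N \<noteq> (0 :: mono \<Rightarrow>\<^sub>0 'k)" for i
    by (metis lookup_single_eq lookup_zero zero_neq_one)
  have du: "d (u i) = 0" if "i < r" for i
    using that w' [of i, symmetric] by (simp add: u_def d_emb x)
  have dw: "lift \<psi> (d (w i)) = e i * lift \<psi> (u i)" if "i < r" for i and \<psi> :: "'h \<Rightarrow> (mono \<Rightarrow>\<^sub>0 'k)"
    using that by (simp add: w_def u_def e_def y w' linear_form_shift)
  have indep: "\<forall>i<r. c i = 0"
    if c: "\<And>\<psi>. linear_form \<psi> \<Longrightarrow> (\<Sum>i<r. c i * lift \<psi> (u i)) = 0" for c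
  proof -
    have split: "(\<Sum>i<r. c i * lift \<psi> (u i)) = c 0 * \<psi> x +
        (\<Sum>i\<in>{1..<r}. c i * (tvar 0 N * lift \<psi> (y i) - tvar i N * lift \<psi> (y 0)))"
      if "linear_form \<psi>" for \<psi>
    proof -
      have "{..<r} = insert 0 {1..<r}" using r by auto
      then have "(\<Sum>i<r. c i * lift \<psi> (u i))
          = c 0 * lift \<psi> (u 0) + (\<Sum>i\<in>{1..<r}. c i * lift \<psi> (u i))" by simp
      also have "(\<Sum>i\<in>{1..<r}. c i * lift \<psi> (u i))
          = (\<Sum>i\<in>{1..<r}. c i * (tvar 0 N * lift \<psi> (y i) - tvar i N * lift \<psi> (y 0)))"
        using that by (intro sum.cong) (auto simp: u_def z_def lift_diff linear_form_def shift_times lift_shift)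
      finally show ?thesis using that by (simp add: u_def lift_emb linear_form_def)
    qed
    \<comment> \<open>A relation between the $u_i$, rewritten in terms of $x$ and the $y_i$.\<close>
    define c' where "c' i = (if i = 0 then - (\<Sum>i\<in>{1..<r}. c i * tvar i N) else c i * tvar 0 N)" for i
    have "c' i = 0" if "i < r" for i
    proof (rule power_system_nonsingular [OF N(1) G _ that])
      fix j assume "j < r"
      have "{..<r} = insert 0 {1..<r}" using r by auto
      then have "(\<Sum>i<r. c' i * G i j) = c' 0 * G 0 j + (\<Sum>i\<in>{1..<r}. c' i * G i j)" by simp
      also have "\<dots> = (\<Sum>i\<in>{1..<r}. c i * (tvar 0 N * G i j - tvar i N * G 0 j))"
        by (simp add: c'_def sum_distrib_right sum_distrib_left sum_subtractf algebra_simps)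
      also have "\<dots> = 0"
      proof -
        have "\<beta> j x = 0" by (simp add: \<beta>_def x lift_def)
        then show ?thesis using split [OF \<beta>, of j] c [OF \<beta>, of j] by (simp add: G_def)
      qed
      finally show "(\<Sum>i<r. c' i * G i j) = 0" .
    qed
    then have pos: "c i = 0" if "i < r" "i \<noteq> 0" for i
      using that tvar_nz [of 0] by (fastforce simp: c'_def)
    \<comment> \<open>The form \<open>\<phi>'\<close> detects the remaining coefficient because $\phi(x) = 1$.\<close>
    have "c 0 * \<phi>' x = 0"
      using split [OF \<phi>'] c [OF \<phi>'] pos by simp
    then have "c 0 = 0" by (simp add: \<phi>'_def \<phi> emb_def)
    then show ?thesis using pos by metis
  qed
  show ?thesis
  proof (rule card_independent_le_dim [OF X, where v = "\<lambda>i. if i < r then u i else w (i - r)"])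
    fix p :: "nat \<Rightarrow> (mono \<Rightarrow>\<^sub>0 'k)"
    assume "(\<Sum>i<2 * r. p i * lift \<psi> (if i < r then u i else w (i - r))) = 0"
      if "linear_form \<psi>" for \<psi>
    moreover have "(\<Sum>i<r + n. g i) = (\<Sum>i<r. g i) + (\<Sum>i<n. g (i + r))"
      for g :: "nat \<Rightarrow> (mono \<Rightarrow>\<^sub>0 'k)" and n
      by (induction n) (simp_all add: add.assoc add.commute)
    ultimately have p: "(\<Sum>i<r. p i * lift \<psi> (u i)) + (\<Sum>i<r. p (i + r) * lift \<psi> (w i)) = 0"
      if "linear_form \<psi>" for \<psi> using that by (simp add: mult_2)
    have "\<forall>i<r. p (i + r) * e i = 0"
    proof (rule indep)
      fix \<psi> :: "'h \<Rightarrow> (mono \<Rightarrow>\<^sub>0 'k)" assume \<psi>: "linear_form \<psi>"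
      have "lift (\<lambda>x. lift \<psi> (D x)) f = lift \<psi> (d f)" for f
        using \<psi> by (simp add: lift_lift D_additive linear_form_def)
      then have "(\<Sum>i<r. p i * lift \<psi> (d (u i))) + (\<Sum>i<r. p (i + r) * lift \<psi> (d (w i))) = 0"
        using p [OF linear_form_D [OF \<psi>]] by simp
      moreover have "(\<Sum>i<r. p i * lift \<psi> (d (u i))) = 0"
      proof -
        have "lift \<psi> 0 = 0" by (simp add: lift_def)
        then show ?thesis by (simp add: du)
      qed
      moreover have "(\<Sum>i<r. p (i + r) * lift \<psi> (d (w i))) = (\<Sum>i<r. p (i + r) * e i * lift \<psi> (u i))"
        by (rule sum.cong) (simp_all add: dw mult.assoc)
      ultimately show "(\<Sum>i<r. p (i + r) * e i * lift \<psi> (u i)) = 0" by simp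
    qed
    moreover have "e i \<noteq> 0" for i using tvar_nz by (simp add: e_def)
    ultimately have pw: "p (i + r) = 0" if "i < r" for i using that by fastforce
    then have pu: "\<forall>i<r. p i = 0" using p by (intro indep) simp
    show "\<forall>i<2 * r. p i = 0"
    proof (intro allI impI)
      fix i assume "i < 2 * r"
      then show "p i = 0" using pu pw [of "i - r"] by (cases "i < r") auto
    qed
  qed
qed simp

end

section \<open>Transfer along homotopy equivalences\<close>

lemma graded_space_vector_space: "graded_space s C \<Longrightarrow> vector_space s"
  by (simp add: graded_space_def)

lemma graded_space_zero: "graded_space s C \<Longrightarrow> 0 \<in> C q"
proof -
  assume g: "graded_space s C"
  interpret vector_space s by (rule graded_space_vector_space [OF g])
  show "0 \<in> C q" using g by (auto simp: graded_space_def intro: subspace_0)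
qed

lemma graded_space_diff: "graded_space s C \<Longrightarrow> x \<in> C q \<Longrightarrow> y \<in> C q \<Longrightarrow> x - y \<in> C q"
proof -
  assume g: "graded_space s C" and xy: "x \<in> C q" "y \<in> C q"
  interpret vector_space s by (rule graded_space_vector_space [OF g])
  show "x - y \<in> C q" using g xy by (auto simp: graded_space_def intro: subspace_diff)
qed

lemma emb_in_tens_deg: "graded_space s C \<Longrightarrow> x \<in> C q \<Longrightarrow> emb x \<in> tens_deg r C q"
  by (auto simp: tens_deg_def emb_in_tens coef_emb graded_space_zero)

lemma tens_deg_imp_tens: "f \<in> tens_deg r C q \<Longrightarrow> f \<in> tens r UNIV"
  by (simp add: tens_deg_def)

lemma graded_tens_deg_diff:
  "graded_space s C \<Longrightarrow> f \<in> tens_deg r C q \<Longrightarrow> g \<in> tens_deg r C q \<Longrightarrow> f - g \<in> tens_deg r C q"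
  using tens_add [OF _ tens_minus, of f r g]
  by (auto simp: tens_deg_def lookup_minus intro: graded_space_diff)

text \<open>
Maps as in \<open>R_hom\<close>; they are controlled on the polynomials in the first \<open>r\<close> variables only.
\<close>

locale graded_hom =
  fixes r :: nat
    and s :: "'k::field \<Rightarrow> 'c::ab_group_add \<Rightarrow> 'c" and C :: "int \<Rightarrow> 'c set"
    and s' :: "'k \<Rightarrow> 'e::ab_group_add \<Rightarrow> 'e" and C' :: "int \<Rightarrow> 'e set"
    and n :: int and T :: "(mono \<Rightarrow>\<^sub>0 'c) \<Rightarrow> (mono \<Rightarrow>\<^sub>0 'e)"
  assumes grC: "graded_space s C" and grC': "graded_space s' C'" and hom: "R_hom r s C s' C' n T"
begin

lemma vs: "vector_space s" "vector_space s'"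
  using grC grC' by (simp_all add: graded_space_vector_space)

lemma T_tens: "f \<in> tens r UNIV \<Longrightarrow> T f \<in> tens r UNIV"
  and T_add: "f \<in> tens r UNIV \<Longrightarrow> g \<in> tens r UNIV \<Longrightarrow> T (f + g) = T f + T g"
  and T_pact: "p \<in> polys r \<Longrightarrow> f \<in> tens r UNIV \<Longrightarrow> T (pact s p f) = pact s' p (T f)"
  and T_deg: "f \<in> tens_deg r C q \<Longrightarrow> T f \<in> tens_deg r C' (q + n)"
  using hom by (simp_all add: R_hom_def)

lemma T_shift: "m \<in> monomials r \<Longrightarrow> f \<in> tens r UNIV \<Longrightarrow> T (shift m f) = shift m (T f)"
  using T_pact [of "Poly_Mapping.single m 1" f] by (simp add: pact_single vs polys_def)

lemma T_kscale: "f \<in> tens r UNIV \<Longrightarrow> T (kscale s a f) = kscale s' a (T f)"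
  unfolding kscale_def by (rule T_pact) (auto simp: polys_def)

lemma T_zero: "T 0 = 0"
  using T_add [OF zero_in_tens zero_in_tens] by simp

lemma T_minus: "f \<in> tens r UNIV \<Longrightarrow> T (- f) = - T f"
  using T_add [of f "- f"] by (simp add: tens_minus T_zero eq_neg_iff_add_eq_0 add.commute)

lemma T_diff: "f \<in> tens r UNIV \<Longrightarrow> g \<in> tens r UNIV \<Longrightarrow> T (f - g) = T f - T g"
  using T_add [of f "- g"] by (simp add: tens_minus T_minus)

lemma additive_T_emb: "additive (\<lambda>x. T (emb x))"
  by (simp add: additive_def emb_add T_add emb_in_tens)

lemma T_eq_lift: "f \<in> tens r UNIV \<Longrightarrow> T f = lift (\<lambda>x. T (emb x)) f"
proof -
  assume f: "f \<in> tens r UNIV"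
  let ?g = "\<lambda>m. shift m (emb (coef f m))"
  have "T (\<Sum>m\<in>A. ?g m) = (\<Sum>m\<in>A. shift m (T (emb (coef f m)))) \<and> (\<Sum>m\<in>A. ?g m) \<in> tens r UNIV"
    if "finite A" "A \<subseteq> monomials r" for A
    using that
  proof (induction A rule: finite_induct)
    case empty
    then show ?case by (simp add: T_zero zero_in_tens)
  next
    case (insert m A)
    then have "?g m \<in> tens r UNIV" by (intro tens_shift emb_in_tens) auto
    then show ?case using insert by (simp add: T_add T_shift emb_in_tens tens_add)
  qed
  from this [of "Poly_Mapping.keys f"] f show ?thesis
    by (simp add: sum_shift_emb lift_def tens_UNIV_iff)
qed

text \<open>
The map that $T$ induces on $C = \tilde C \otimes_R k$.
\<close>

definition reduced :: "'c \<Rightarrow> 'e" where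
  "reduced x = coef (T (emb x)) 0"

lemma coef_T_0: "f \<in> tens r UNIV \<Longrightarrow> coef (T f) 0 = reduced (coef f 0)"
  by (simp add: T_eq_lift coef_lift_0 additive_T_emb reduced_def)

lemma reduced_add: "reduced (x + y) = reduced x + reduced y"
  by (simp add: reduced_def emb_add T_add emb_in_tens lookup_add)

lemma reduced_scale: "reduced (s a x) = s' a (reduced x)"
proof -
  have "emb (s a x) = kscale s a (emb x)"
    by (rule poly_mapping_eqI) (simp add: coef_emb coef_kscale vs vector_space_simps)
  then show ?thesis by (simp add: reduced_def T_kscale emb_in_tens coef_kscale vs)
qed

lemma reduced_zero: "reduced 0 = 0"
  by (simp add: reduced_def T_zero)

lemma reduced_deg: "x \<in> C q \<Longrightarrow> reduced x \<in> C' (q + n)"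
proof -
  assume "x \<in> C q"
  then have "T (emb x) \<in> tens_deg r C' (q + n)" by (intro T_deg emb_in_tens_deg [OF grC])
  then have "coef (T (emb x)) 0 \<in> C' (q + n - int (mdeg 0))"
    unfolding tens_deg_def by blast
  then show ?thesis by (simp add: reduced_def)
qed

end

text \<open>
A linear map from \<open>Z\<close> onto \<open>W\<close> with kernel \<open>B\<close> takes every basis of $Z / B$ to a basis of \<open>W\<close>, and a
basis of \<open>W\<close> lifts to one of $Z / B$.  The second part matters because \<open>quot_dim\<close> chooses some basis.
\<close>

lemma quot_dim_eq_dim:
  fixes s :: "'k::field \<Rightarrow> 'v::ab_group_add \<Rightarrow> 'v" and s' :: "'k \<Rightarrow> 'w::ab_group_add \<Rightarrow> 'w"
  assumes vs: "vector_space s" "vector_space s'"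
    and Z: "module.subspace s Z"
    and p_add: "\<And>x y. p (x + y) = p x + p y" and p_scale: "\<And>a x. p (s a x) = s' a (p x)"
    and W: "p ` Z = W" and ker: "\<And>x. x \<in> Z \<Longrightarrow> p x = 0 \<longleftrightarrow> x \<in> B" and BZ: "B \<subseteq> Z"
  shows "quot_dim s Z B = vector_space.dim s' W"
proof -
  interpret V: vector_space s by (rule vs)
  interpret V': vector_space s' by (rule vs)
  have p: "additive p" by (simp add: additive_def p_add)
  have p_comb: "p (\<Sum>x\<in>F. s (a x) x) = (\<Sum>x\<in>F. s' (a x) (p x))" for F a
    by (simp add: additive.sum [OF p] p_scale)
  have comb_Z: "(\<Sum>x\<in>F. s (a x) x) \<in> Z" if "F \<subseteq> Z" for F a
    using that by (intro V.subspace_sum [OF Z] V.subspace_scale [OF Z]) auto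
  have card: "card X = V'.dim W" if X: "quot_basis s Z B X" for X
  proof -
    have XZ: "X \<subseteq> Z" and ind: "\<And>F a. finite F \<Longrightarrow> F \<subseteq> X \<Longrightarrow> (\<Sum>x\<in>F. s (a x) x) \<in> B \<Longrightarrow> \<forall>x\<in>F. a x = 0"
      and sp: "Z \<subseteq> V.span (X \<union> B)"
      using X by (auto simp: quot_basis_def)
    have ind': "\<forall>x\<in>F. a x = 0" if F: "finite F" "F \<subseteq> X" and 0: "(\<Sum>x\<in>F. s' (a x) (p x)) = 0" for F a
    proof (rule ind [OF F])
      have "F \<subseteq> Z" using F XZ by blast
      then show "(\<Sum>x\<in>F. s (a x) x) \<in> B" using ker [OF comb_Z, of F a] 0 by (simp add: p_comb)
    qed
    have inj: "inj_on p X"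
    proof (rule inj_onI, rule ccontr)
      fix x y assume xy: "x \<in> X" "y \<in> X" "p x = p y" "x \<noteq> y"
      let ?a = "\<lambda>z. if z = x then 1 else - 1"
      have "\<forall>z\<in>{x, y}. ?a z = (0 :: 'k)"
        by (rule ind') (use xy in auto)
      then show False by simp
    qed
    have "V'.independent (p ` X)"
      unfolding V'.independent_explicit_finite_subsets
    proof (intro allI impI ballI)
      fix S u v assume S: "S \<subseteq> p ` X" "finite S" and u: "(\<Sum>v\<in>S. s' (u v) v) = 0" and v: "v \<in> S"
      obtain F where F: "F \<subseteq> X" "finite F" "S = p ` F" using finite_subset_image [OF S(2,1)] by metis
      have "(\<Sum>x\<in>F. s' (u (p x)) (p x)) = 0"
        using u unfolding F(3) by (subst (asm) sum.reindex) (use inj F inj_on_subset in auto)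
      then have "\<forall>x\<in>F. u (p x) = 0" using ind' [of F "\<lambda>x. u (p x)"] F by simp
      then show "u v = 0" using v F by blast
    qed
    moreover have "V'.span (p ` X) = V'.span W"
    proof (rule V'.span_eq [THEN iffD2], intro conjI subsetI)
      show "w \<in> V'.span W" if "w \<in> p ` X" for w
        using that XZ W by (auto intro: V'.span_base)
      fix w assume "w \<in> W"
      then obtain z where z: "z \<in> Z" "w = p z" using W by blast
      then have "z \<in> V.span (X \<union> B)" using sp by blast
      then have "p z \<in> V'.span (p ` X)"
      proof (induction rule: V.span_induct)
        case base
        show "V.subspace {z. p z \<in> V'.span (p ` X)}"
          by (auto simp: V.subspace_def additive.zero [OF p] p_add p_scale
              intro: V'.span_zero V'.span_add V'.span_scale)
      next
        case (step x)
        then consider "x \<in> X" | "x \<in> B" by blast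
        then show ?case
        proof cases
          case 1
          then show ?thesis by (auto intro: V'.span_base)
        next
          case 2
          then have "p x = 0" using ker BZ by blast
          then show ?thesis by (simp add: V'.span_zero)
        qed
      qed
      with z show "w \<in> V'.span (p ` X)" by simp
    qed
    ultimately have "V'.dim W = card (p ` X)" by (intro V'.dim_eq_card) auto
    then show ?thesis using card_image [OF inj] by simp
  qed
  have "\<exists>X. quot_basis s Z B X"
  proof -
    obtain Y where Y: "Y \<subseteq> W" "V'.independent Y" "W \<subseteq> V'.span Y"
      using V'.basis_exists [of W] by metis
    have "\<forall>y\<in>Y. \<exists>z\<in>Z. p z = y" using Y(1) W by blast
    then obtain g where g: "\<And>y. y \<in> Y \<Longrightarrow> g y \<in> Z \<and> p (g y) = y" by metis
    have "quot_basis s Z B (g ` Y)"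
      unfolding quot_basis_def
    proof (intro conjI allI impI)
      show "g ` Y \<subseteq> Z" using g by blast
      fix F and a :: "'v \<Rightarrow> 'k" assume *: "finite F \<and> F \<subseteq> g ` Y \<and> (\<Sum>x\<in>F. s (a x) x) \<in> B"
      then obtain Y' where Y': "Y' \<subseteq> Y" "finite Y'" "F = g ` Y'" using finite_subset_image [of F g Y] by metis
      have inj: "inj_on g Y'" using g Y'(1) by (metis inj_on_inverseI subsetD)
      have "p (\<Sum>x\<in>F. s (a x) x) = 0" using * ker BZ by blast
      then have "(\<Sum>y\<in>Y'. s' (a (g y)) (p (g y))) = 0"
        unfolding p_comb Y'(3) by (simp add: sum.reindex [OF inj])
      then have "(\<Sum>y\<in>Y'. s' (a (g y)) y) = 0" using g Y'(1) by (simp add: subset_iff)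
      then have "\<forall>y\<in>Y'. a (g y) = 0"
        using V'.independent_explicit_finite_subsets [THEN iffD1, OF Y(2), rule_format, of Y' "\<lambda>y. a (g y)"] Y'
        by simp
      then show "\<forall>x\<in>F. a x = 0" using Y'(3) by blast
    next
      show "Z \<subseteq> V.span (g ` Y \<union> B)"
      proof
        fix z assume z: "z \<in> Z"
        then have "p z \<in> V'.span Y" using W Y(3) by blast
        then obtain Y' u where Y': "finite Y'" "Y' \<subseteq> Y" "p z = (\<Sum>y\<in>Y'. s' (u y) y)"
          unfolding V'.span_explicit by blast
        define x where "x = (\<Sum>y\<in>Y'. s (u y) (g y))"
        have xZ: "x \<in> Z" unfolding x_def
          using g Y'(2) by (intro V.subspace_sum [OF Z] V.subspace_scale [OF Z]) auto
        have "p x = p z"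
          unfolding x_def Y'(3) additive.sum [OF p] p_scale
          by (rule sum.cong) (use g Y'(2) in auto)
        then have "p (z - x) = 0" by (simp add: additive.diff [OF p])
        then have "z - x \<in> B" using ker [OF V.subspace_diff [OF Z z xZ]] by simp
        moreover have "x \<in> V.span (g ` Y \<union> B)" unfolding x_def
          using Y'(2) by (intro V.span_sum V.span_scale V.span_base) auto
        ultimately show "z \<in> V.span (g ` Y \<union> B)"
          using V.span_add [of "z - x" "g ` Y \<union> B" x] by (auto intro: V.span_base)
      qed
    qed
    then show ?thesis ..
  qed
  then have "quot_basis s Z B (SOME X. quot_basis s Z B X)" by (rule someI_ex)
  then show ?thesis unfolding quot_dim_def by (rule card)
qed

lemma homotopy_equivalent_sym:
  "homotopy_equivalent r s C d s' C' d' \<Longrightarrow> homotopy_equivalent r s' C' d' s C d"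
  unfolding homotopy_equivalent_def by metis

text \<open>
If $\psi(z) = d(w)$ for a cocycle \<open>z\<close>, then $z = \phi(\psi(z)) - d'(h'(z)) = d'(\phi(w) - h'(z))$.
\<close>

lemma coh_nonzero_transfer:
  assumes "free_complex r s C d" "free_complex r s' C' d'"
    and he: "homotopy_equivalent r s C d s' C' d'" and nz: "coh_nonzero r C' d' q"
  shows "coh_nonzero r C d q"
proof -
  obtain \<phi> \<psi> h' where
    \<phi>: "R_hom r s C s' C' 0 \<phi>" "\<And>f. f \<in> tens r UNIV \<Longrightarrow> \<phi> (d f) = d' (\<phi> f)" and
    \<psi>: "R_hom r s' C' s C 0 \<psi>" "\<And>f. f \<in> tens r UNIV \<Longrightarrow> \<psi> (d' f) = d (\<psi> f)" and
    h': "R_hom r s' C' s' C' (-1) h'"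
      "\<And>f. f \<in> tens r UNIV \<Longrightarrow> \<phi> (\<psi> f) - f = d' (h' f) + h' (d' f)"
    using he unfolding homotopy_equivalent_def by blast
  have gr: "graded_space s C" "graded_space s' C'" and "R_hom r s C s C 1 d" "R_hom r s' C' s' C' 1 d'"
    using assms by (auto simp: free_complex_def)
  then interpret d': graded_hom r s' C' s' C' 1 d' by unfold_locales
  interpret \<phi>: graded_hom r s C s' C' 0 \<phi> using gr \<phi> by unfold_locales
  interpret \<psi>: graded_hom r s' C' s C 0 \<psi> using gr \<psi> by unfold_locales
  interpret h': graded_hom r s' C' s' C' "-1" h' using gr h' by unfold_locales
  obtain z where z: "z \<in> tens_deg r C' q" "d' z = 0" "z \<notin> d' ` tens_deg r C' (q - 1)"
    using nz by (auto simp: coh_nonzero_def cocycles_def)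
  note zt = tens_deg_imp_tens [OF z(1)]
  show ?thesis
  proof (rule ccontr)
    assume "\<not> coh_nonzero r C d q"
    moreover have "\<psi> z \<in> cocycles d (tens_deg r C q)"
      using \<psi>.T_deg [OF z(1)] \<psi>(2) [OF zt] z(2) by (simp add: cocycles_def \<psi>.T_zero)
    ultimately obtain w where w: "w \<in> tens_deg r C (q - 1)" "\<psi> z = d w"
      by (auto simp: coh_nonzero_def)
    have deg: "\<phi> w \<in> tens_deg r C' (q - 1)" "h' z \<in> tens_deg r C' (q - 1)"
      using \<phi>.T_deg [OF w(1)] h'.T_deg [OF z(1)] by simp_all
    have "z = \<phi> (\<psi> z) - d' (h' z)" using h'(2) [OF zt] z(2) by (simp add: h'.T_zero algebra_simps)
    also have "\<dots> = d' (\<phi> w - h' z)"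
      using \<phi>(2) [OF tens_deg_imp_tens [OF w(1)]] deg
      by (simp add: w d'.T_diff tens_deg_imp_tens)
    finally have "z \<in> d' ` tens_deg r C' (q - 1)"
      using graded_tens_deg_diff [OF gr(2) deg] by blast
    with z(3) show False by simp
  qed
qed

section \<open>Free cochain complexes with finite-dimensional cohomology\<close>

theorem corollary4p3:
  fixes r :: nat
    and s :: "'k::field \<Rightarrow> 'c::ab_group_add \<Rightarrow> 'c"
    and C :: "int \<Rightarrow> 'c set"
    and d :: "(mono \<Rightarrow>\<^sub>0 'c) \<Rightarrow> (mono \<Rightarrow>\<^sub>0 'c)"
    and sH :: "'k \<Rightarrow> 'h::ab_group_add \<Rightarrow> 'h"
    and H :: "int \<Rightarrow> 'h set"
    and dH :: "(mono \<Rightarrow>\<^sub>0 'h) \<Rightarrow> (mono \<Rightarrow>\<^sub>0 'h)"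
  assumes "free_complex r s C d"
    and "total_coh_finite_dim r s d"
    and "total_coh_dim r s d \<noteq> 0"
    and "minimal_model r s C d sH H dH"
  shows
    "(vector_space.dim sH UNIV = Sum_any (\<lambda>i. red_coh_dim s C d i) \<and>
      Sum_any (\<lambda>i. red_coh_dim s C d i) \<ge> 2 * r) \<and>
     (Sum_any (\<lambda>q. lam_length r sH dH (H q)) \<ge> filt_length r dH \<and>
      filt_length r dH \<ge> r + 1) \<and>
     ((\<forall>i<r. \<forall>x. lam dH i x = 0) \<longrightarrow>
      card {q. coh_nonzero r C d q} \<ge> r + 1)"
proof -
  have fH: "free_complex r sH H dH" and he: "homotopy_equivalent r s C d sH H dH"
    and min: "\<And>x. coef (dH (emb x)) 0 = 0"
    using assms(4) by (auto simp: minimal_model_def tensI_def)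
  obtain \<phi> \<psi> h h' where
    \<phi>: "R_hom r s C sH H 0 \<phi>" "\<And>f. f \<in> tens r UNIV \<Longrightarrow> \<phi> (d f) = dH (\<phi> f)" and
    \<psi>: "R_hom r sH H s C 0 \<psi>" "\<And>f. f \<in> tens r UNIV \<Longrightarrow> \<psi> (dH f) = d (\<psi> f)" and
    h: "R_hom r s C s C (-1) h"
      "\<And>f. f \<in> tens r UNIV \<Longrightarrow> \<psi> (\<phi> f) - f = d (h f) + h (d f)" and
    h': "R_hom r sH H sH H (-1) h'"
      "\<And>f. f \<in> tens r UNIV \<Longrightarrow> \<phi> (\<psi> f) - f = dH (h' f) + h' (dH f)"
    using he unfolding homotopy_equivalent_def by blast
  have gr: "graded_space s C" "graded_space sH H" and homs: "R_hom r s C s C 1 d" "R_hom r sH H sH H 1 dH"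
    and sqH: "\<And>f. f \<in> tens r UNIV \<Longrightarrow> dH (dH f) = 0"
    using assms(1) fH by (auto simp: free_complex_def)
  interpret d: graded_hom r s C s C 1 d using gr homs by unfold_locales
  interpret dH: graded_hom r sH H sH H 1 dH using gr homs by unfold_locales
  interpret \<phi>: graded_hom r s C sH H 0 \<phi> using gr \<phi> by unfold_locales
  interpret \<psi>: graded_hom r sH H s C 0 \<psi> using gr \<psi> by unfold_locales
  interpret h: graded_hom r s C s C "-1" h using gr h by unfold_locales
  interpret h': graded_hom r sH H sH H "-1" h' using gr h' by unfold_locales
  interpret VC: vector_space s by (rule d.vs)
  interpret PC: vector_space "kscale s" by (rule vector_space_kscale [OF d.vs(1)])
  define D where "D x = dH (emb x)" for x
  have dH_lift: "dH f = lift D f" if "f \<in> tens r UNIV" for f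
    unfolding D_def by (rule dH.T_eq_lift [OF that])
  interpret M: minimal_complex sH r H D
  proof (rule minimal_complex.intro [OF dH.vs(1)], rule minimal_complex_axioms.intro)
    show "graded_space sH H" by (rule gr)
    show D_add: "additive D" unfolding D_def by (rule dH.additive_T_emb)
    show "D (sH a x) = kscale sH a (D x)" for a x
    proof -
      have "emb (sH a x) = kscale sH a (emb x)"
        by (rule poly_mapping_eqI) (simp add: coef_emb coef_kscale dH.vs vector_space_simps)
      then show ?thesis by (simp add: D_def dH.T_kscale emb_in_tens)
    qed
    show "Poly_Mapping.keys (D x) \<subseteq> monomials r" for x
      using dH.T_tens [OF emb_in_tens] by (simp add: D_def tens_UNIV_iff)
    show "coef (D x) m \<in> H (q + 1 - int (mdeg m))" if "x \<in> H q" for x q m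
      using dH.T_deg [OF emb_in_tens_deg [OF gr(2) that]] by (simp add: D_def tens_deg_def)
    show "coef (D x) 0 = 0" for x by (simp add: D_def min)
    show "lift D (D x) = 0" for x
      using dH_lift [of "D x"] sqH [OF emb_in_tens] dH.T_tens [OF emb_in_tens]
      by (simp add: D_def)
  qed
  have filt: "filt r dH n = filt r M.d n" for n
    by (induction n) (simp_all add: M.d_emb D_def [symmetric])
  have lam: "lam dH = lam M.d"
    by (intro ext) (simp add: lam_def M.d_emb D_def)
  have lam_length: "lam_length r sH dH V = lam_length r sH M.d V" for V
    by (simp add: lam_length_def lam_power_def lam)
  have filt_length: "filt_length r dH = filt_length r M.d"
    unfolding filt_length_def filt ..

  \<comment> \<open>The images under \<open>\<phi>\<close> of cocycles that span $H^*(\tilde C)$ span $H^*(\tilde H)$.\<close>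
  have fc: "M.finite_cohomology"
  proof -
    obtain X where X: "finite X" "quot_basis (kscale s) (cocycles d (tens r UNIV)) (d ` tens r UNIV) X"
      using assms(2) by (auto simp: total_coh_finite_dim_def quot_finite_dim_def)
    let ?S = "M.poly.span (\<phi> ` X \<union> M.d ` tens r UNIV)"
    have \<phi>_span: "g \<in> tens r UNIV \<and> \<phi> g \<in> ?S" if "g \<in> PC.span (X \<union> d ` tens r UNIV)" for g
      using that
    proof (induction rule: PC.span_induct)
      case base
      show "PC.subspace {g. g \<in> tens r UNIV \<and> \<phi> g \<in> ?S}"
        by (auto simp: PC.subspace_def zero_in_tens tens_add tens_kscale d.vs \<phi>.T_zero \<phi>.T_add
            \<phi>.T_kscale intro: M.poly.span_zero M.poly.span_add M.poly.span_scale)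
    next
      case (step g)
      then consider "g \<in> X" | f where "g = d f" "f \<in> tens r UNIV" by blast
      then show ?case
      proof cases
        case 1
        then show ?thesis using X(2) by (auto simp: quot_basis_def cocycles_def intro: M.poly.span_base)
      next
        case 2
        then have "\<phi> g = M.d (\<phi> f)" by (simp add: \<phi>(2) dH_lift \<phi>.T_tens)
        then show ?thesis using 2 d.T_tens \<phi>.T_tens by (auto intro: M.poly.span_base)
      qed
    qed
    have "z \<in> ?S" if z: "z \<in> tens r UNIV" "M.d z = 0" for z
    proof -
      have dz: "dH z = 0" using z dH_lift by simp
      have "\<psi> z \<in> cocycles d (tens r UNIV)"
        using \<psi>.T_tens [OF z(1)] \<psi>(2) [OF z(1)] by (simp add: cocycles_def dz \<psi>.T_zero)
      then have "\<psi> z \<in> PC.span (X \<union> d ` tens r UNIV)"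
        using X(2) by (auto simp: quot_basis_def)
      then have 1: "\<phi> (\<psi> z) \<in> ?S" using \<phi>_span by blast
      have h'z: "h' z \<in> tens r UNIV" by (rule h'.T_tens [OF z(1)])
      then have 2: "M.d (h' z) \<in> ?S" by (auto intro: M.poly.span_base)
      have "z = \<phi> (\<psi> z) - M.d (h' z)"
        using h'(2) [OF z(1)] dH_lift [OF h'z] by (simp add: dz h'.T_zero algebra_simps)
      then show ?thesis using M.poly.span_diff [OF 1 2] by simp
    qed
    then show ?thesis
      unfolding M.finite_cohomology_def using X(1) by (intro exI [of _ "\<phi> ` X"]) auto
  qed

  \<comment> \<open>If $H = 0$, every cocycle of $\tilde C$ is a boundary, and $H^*(\tilde C)$ has the empty basis only.\<close>
  have "\<exists>x. (x :: 'h) \<noteq> 0"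
  proof (rule ccontr)
    assume "\<nexists>x. (x :: 'h) \<noteq> 0"
    then have trivial: "f = 0" for f :: "mono \<Rightarrow>\<^sub>0 'h" by (intro poly_mapping_eqI) auto
    let ?Z = "cocycles d (tens r UNIV)" and ?B = "d ` tens r UNIV"
    have ZB: "?Z \<subseteq> ?B"
    proof
      fix z assume z: "z \<in> ?Z"
      then have zt: "z \<in> tens r UNIV" and dz: "d z = 0" by (auto simp: cocycles_def)
      have hz: "h z \<in> tens r UNIV" by (rule h.T_tens [OF zt])
      have "\<psi> (\<phi> z) = 0" using trivial [of "\<phi> z"] by (simp add: \<psi>.T_zero)
      then have "- z = d (h z)" using h(2) [OF zt] by (simp add: dz h.T_zero)
      then have "z = d (- h z)" using d.T_minus [OF hz] by (metis minus_minus)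
      then show "z \<in> ?B" using tens_minus [OF hz] by blast
    qed
    have "X = {}" if X: "quot_basis (kscale s) ?Z ?B X" for X
    proof (rule ccontr)
      assume "X \<noteq> {}"
      then obtain x where x: "x \<in> X" by blast
      then have "x \<in> ?B" using X ZB by (auto simp: quot_basis_def)
      then have "(\<Sum>y\<in>{x}. kscale s 1 y) \<in> ?B" by simp
      moreover have "\<And>F a. finite F \<and> F \<subseteq> X \<and> (\<Sum>x\<in>F. kscale s (a x) x) \<in> ?B \<Longrightarrow> \<forall>x\<in>F. a x = 0"
        using X by (simp add: quot_basis_def)
      from this [of "{x}" "\<lambda>_. 1"] have "(\<Sum>y\<in>{x}. kscale s 1 y) \<notin> ?B" using x by auto
      ultimately show False by simp
    qed
    moreover have "\<exists>X. quot_basis (kscale s) ?Z ?B X"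
      using assms(2) by (auto simp: total_coh_finite_dim_def quot_finite_dim_def)
    ultimately have "(SOME X. quot_basis (kscale s) ?Z ?B X) = {}" by (metis someI_ex)
    then have "total_coh_dim r s d = 0" by (simp add: total_coh_dim_def quot_dim_def)
    then show False using assms(3) by simp
  qed
  then obtain x0 :: 'h where x0: "x0 \<noteq> 0" by blast

  \<comment> \<open>Minimality makes the reduced boundary of $\tilde H$ zero, so \<open>\<phi>\<close> induces $H^q(\tilde C \otimes_R k) \cong H^q$.\<close>
  have red: "red_coh_dim s C d q = M.dim (H q)" for q
    unfolding red_coh_dim_def
  proof (rule quot_dim_eq_dim [where p = \<phi>.reduced, OF d.vs(1) dH.vs(1)])
    have d_red: "d_red d = d.reduced" by (simp add: fun_eq_iff d_red_def d.reduced_def)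
    have dH_0: "coef (dH f) 0 = 0" if "f \<in> tens r UNIV" for f
      using dH.coef_T_0 [OF that] by (simp add: dH.reduced_def min)
    have sub: "VC.subspace (C q)" for q using gr(1) by (simp add: graded_space_def)
    show "VC.subspace (cocycles (d_red d) (C q))"
      using sub [of q] by (auto simp: VC.subspace_def cocycles_def d_red d.reduced_zero d.reduced_add d.reduced_scale)
    show "\<phi>.reduced (x + y) = \<phi>.reduced x + \<phi>.reduced y" for x y by (rule \<phi>.reduced_add)
    show "\<phi>.reduced (s a x) = sH a (\<phi>.reduced x)" for a x by (rule \<phi>.reduced_scale)
    have \<phi>_d: "\<phi>.reduced (d.reduced x) = 0" for x
    proof -
      have "\<phi>.reduced (d.reduced x) = coef (\<phi> (d (emb x))) 0"
        by (simp add: \<phi>.coef_T_0 d.coef_T_0 d.T_tens emb_in_tens coef_emb)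
      then show ?thesis by (simp add: \<phi>(2) emb_in_tens dH_0 \<phi>.T_tens)
    qed
    have d_\<psi>: "d.reduced (\<psi>.reduced y) = 0" for y
    proof -
      have "d.reduced (\<psi>.reduced y) = coef (d (\<psi> (emb y))) 0"
        by (simp add: d.coef_T_0 \<psi>.coef_T_0 \<psi>.T_tens emb_in_tens coef_emb)
      also have "\<dots> = coef (\<psi> (dH (emb y))) 0" by (simp add: \<psi>(2) emb_in_tens)
      also have "\<dots> = \<psi>.reduced 0" by (simp add: \<psi>.coef_T_0 dH.T_tens emb_in_tens min)
      finally show ?thesis by (simp add: \<psi>.reduced_zero)
    qed
    have \<phi>_\<psi>: "\<phi>.reduced (\<psi>.reduced y) = y" for y
    proof -
      have "\<phi>.reduced (\<psi>.reduced y) - y = coef (\<phi> (\<psi> (emb y)) - emb y) 0"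
        by (simp add: \<phi>.coef_T_0 \<psi>.coef_T_0 \<psi>.T_tens emb_in_tens lookup_minus coef_emb)
      also have "\<dots> = coef (dH (h' (emb y))) 0 + coef (h' (dH (emb y))) 0"
        by (simp add: h'(2) emb_in_tens lookup_add)
      also have "\<dots> = 0"
        by (simp add: dH_0 h'.T_tens emb_in_tens h'.coef_T_0 dH.T_tens min h'.reduced_zero)
      finally show ?thesis by simp
    qed
    have \<psi>_\<phi>: "\<psi>.reduced (\<phi>.reduced x) - x = d.reduced (h.reduced x) + h.reduced (d.reduced x)" for x
    proof -
      have "\<psi>.reduced (\<phi>.reduced x) - x = coef (\<psi> (\<phi> (emb x)) - emb x) 0"
        by (simp add: \<psi>.coef_T_0 \<phi>.coef_T_0 \<phi>.T_tens emb_in_tens lookup_minus coef_emb)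
      also have "\<dots> = coef (d (h (emb x))) 0 + coef (h (d (emb x))) 0"
        by (simp add: h(2) emb_in_tens lookup_add)
      also have "\<dots> = d.reduced (h.reduced x) + h.reduced (d.reduced x)"
        by (simp add: d.coef_T_0 h.coef_T_0 d.T_tens h.T_tens emb_in_tens coef_emb)
      finally show ?thesis .
    qed
    show "\<phi>.reduced ` cocycles (d_red d) (C q) = H q"
    proof (intro subset_antisym subsetI)
      fix y assume "y \<in> H q"
      then have "\<psi>.reduced y \<in> cocycles (d_red d) (C q)"
        using \<psi>.reduced_deg [of y q] by (simp add: cocycles_def d_red d_\<psi>)
      then show "y \<in> \<phi>.reduced ` cocycles (d_red d) (C q)"
        using \<phi>_\<psi> [of y] by (metis image_eqI)
    next
      fix y assume "y \<in> \<phi>.reduced ` cocycles (d_red d) (C q)"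
      then show "y \<in> H q" using \<phi>.reduced_deg [of _ q] by (auto simp: cocycles_def)
    qed
    show "\<phi>.reduced x = 0 \<longleftrightarrow> x \<in> d_red d ` C (q - 1)" if x: "x \<in> cocycles (d_red d) (C q)" for x
    proof
      assume 0: "\<phi>.reduced x = 0"
      have xq: "x \<in> C q" "d.reduced x = 0" using x by (auto simp: cocycles_def d_red)
      have "- x = d.reduced (h.reduced x)"
        using \<psi>_\<phi> [of x] by (simp add: 0 xq \<psi>.reduced_zero h.reduced_zero)
      then have "x = - d.reduced (h.reduced x)" by (metis minus_minus)
      also have "\<dots> = d.reduced (s (- 1) (h.reduced x))"
        by (subst d.reduced_scale) simp
      finally have "x = d.reduced (s (- 1) (h.reduced x))" .
      moreover have "s (- 1) (h.reduced x) \<in> C (q - 1)"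
        by (rule VC.subspace_scale [OF sub]) (use h.reduced_deg [OF xq(1)] in simp)
      ultimately show "x \<in> d_red d ` C (q - 1)" unfolding d_red by blast
    next
      assume "x \<in> d_red d ` C (q - 1)"
      then show "\<phi>.reduced x = 0" by (auto simp: d_red \<phi>_d)
    qed
    show "d_red d ` C (q - 1) \<subseteq> cocycles (d_red d) (C q)"
    proof -
      have "d.reduced (d.reduced x) = 0" for x
      proof -
        have "d.reduced (d.reduced x) = coef (d (d (emb x))) 0"
          by (simp add: d.coef_T_0 d.T_tens emb_in_tens coef_emb)
        also have "d (d (emb x)) = 0" using assms(1) emb_in_tens by (auto simp: free_complex_def)
        finally show ?thesis by simp
      qed
      then show ?thesis using d.reduced_deg [of _ "q - 1"] by (auto simp: d_red cocycles_def)
    qed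
  qed

  obtain X where X: "finite X" "M.span X = UNIV" using M.finite_dimensional_generators [OF fc] by blast
  have dim: "M.dim UNIV = Sum_any (\<lambda>i. red_coh_dim s C d i)"
  proof -
    have "Sum_any (\<lambda>i. M.dim (H i)) = (\<Sum>q | H q \<noteq> {0}. M.dim (H q))"
    proof (rule Sum_any.expand_superset [OF M.finite_support [OF X]])
      have "M.dim {0} = 0"
        using M.dim_eq_card [of "{}" "{0}"] by (simp add: M.independent_empty)
      then show "{a. M.dim (H a) \<noteq> 0} \<subseteq> {q. H q \<noteq> {0}}" by auto
    qed
    then show ?thesis using M.dim_graded [OF X] by (simp add: red)
  qed
  have coh: "coh_nonzero r C d q \<longleftrightarrow> \<not> M.acyclic_mod H 1 0 q" for q
  proof -
    have "coh_nonzero r C d q \<longleftrightarrow> coh_nonzero r H dH q"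
      using coh_nonzero_transfer [OF assms(1) fH he, of q]
        coh_nonzero_transfer [OF fH assms(1) homotopy_equivalent_sym [OF he], of q] by blast
    also have "\<dots> \<longleftrightarrow> \<not> M.acyclic_mod H 1 0 q"
    proof -
      have eq: "dH f = M.d f" if "f \<in> tens_deg r H p" for f p
        using that by (intro dH_lift tens_deg_imp_tens)
      then have im: "dH ` tens_deg r H (q - 1) = M.d ` tens_deg r H (q - 1)"
        by (intro image_cong) auto
      show ?thesis
        unfolding coh_nonzero_def M.acyclic_mod_0_iff cocycles_def im subset_iff mem_Collect_eq
        by (metis eq)
    qed
    finally show ?thesis .
  qed
  have "2 * r \<le> M.dim UNIV" by (rule M.dim_ge [OF fc x0])
  moreover have "filt_length r dH \<le> Sum_any (\<lambda>q. lam_length r sH dH (H q))"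
    unfolding lam_length filt_length by (rule M.filt_length_le [OF fc])
  moreover have "r + 1 \<le> filt_length r dH"
    unfolding filt_length by (rule M.filt_length_ge [OF fc x0])
  moreover have "r + 1 \<le> card {q. coh_nonzero r C d q}" if "\<forall>i<r. \<forall>x. lam dH i x = 0"
    unfolding coh using that by (intro M.cohomology_degrees_ge [OF fc x0]) (simp add: lam)
  ultimately show ?thesis using dim by simp
qed

end
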